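(* Fix $\rho>0$ and $0<\gamma<1/3$. For every $t>0$ and every $H\in\mathcal{S}(\mathbb{R})$, $$\lim_{N\to\infty}\mathbb{E}^\gamma_{\nu_\rho}\Big[\Big(\int_0^t\frac{N^\gamma}{\sqrt N}\sum_{x\in\mathbb{Z}}H\Big(\frac{x}{N}\Big)V_g(\eta_s(x))\,ds\Big)^2\Big]=0,$$ where $V_g(\eta(x))=g(\eta(x))-\phi(\rho)-\phi'(\rho)[\eta(x)-\rho]$.
   Context: The TAZRP is the Markov process on $\mathbb{N}^{\mathbb{Z}}$ with generator $\mathcal{L}f(\eta)=\sum_{x\in\mathbb{Z}}g(\eta(x))[f(\eta^{x,x+1})-f(\eta)]$, where $g(k)=1_{\{k\ge1\}}$ and $\eta^{x,x+1}$ is obtained from $\eta$ by moving one particle from $x$ to $x+1$. $\nu_\rho$ is the product measure with geometric marginals $\nu_\rho(\eta(x)=k)=\frac{1}{1+\rho}\big(\frac{\rho}{1+\rho}\big)^k$, $k\ge0$ (invariant, mean $\rho$). $\phi(\rho)=E_{\nu_\rho}[g(\eta(0))]=\frac{\rho}{1+\rho}$. $\mathbb{E}^\gamma_{\nu_\rho}$ denotes expectation with respect to the law of the TAZRP started from $\nu_\rho$ and speeded up by $N^{1+\gamma}$, i.e. $\eta_s$ denotes the TAZRP configuration at (original) time $sN^{1+\gamma}$. *)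

theory Defs
  imports "HOL-Analysis.Analysis" "HOL-Probability.Probability"
begin

definition g_rate :: "nat \<Rightarrow> real" where
  "g_rate k = (if 1 \<le> k then 1 else 0)"

definition phi :: "real \<Rightarrow> real" where
  "phi \<rho> = \<rho> / (1 + \<rho>)"

definition Vg :: "real \<Rightarrow> nat \<Rightarrow> real" where
  "Vg \<rho> k = g_rate k - phi \<rho> - deriv phi \<rho> * (real k - \<rho>)"

definition nu_marg :: "real \<Rightarrow> nat \<Rightarrow> real" where
  "nu_marg \<rho> k = (1 / (1 + \<rho>)) * (\<rho> / (1 + \<rho>)) ^ k"

definition schwartz :: "(real \<Rightarrow> real) \<Rightarrow> bool" where
  "schwartz H \<longleftrightarrow>
     (\<forall>j x. ((deriv ^^ j) H) differentiable (at x)) \<and>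
     (\<forall>j k::nat. bounded (range (\<lambda>x. x ^ k * (deriv ^^ j) H x)))"

definition llim :: "(real \<Rightarrow> nat) \<Rightarrow> real \<Rightarrow> real" where
  "llim f s = Lim (at_left s) (\<lambda>r. real (f r))"

definition poisson_process :: "'a measure \<Rightarrow> ('a \<Rightarrow> real \<Rightarrow> nat) \<Rightarrow> bool" where
  "poisson_process M X \<longleftrightarrow>
     (AE \<omega> in M. X \<omega> 0 = 0 \<and> mono_on {0..} (X \<omega>) \<and>
        (\<forall>t. continuous (at_right t) (X \<omega>))) \<and>
     (\<forall>t. (\<lambda>\<omega>. X \<omega> t) \<in> measurable M (count_space UNIV)) \<and>
     (\<forall>s t k. 0 \<le> s \<longrightarrow> s \<le> t \<longrightarrow>
        measure M {\<omega> \<in> space M. X \<omega> t - X \<omega> s = k}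
          = exp (-(t - s)) * (t - s) ^ k / fact k) \<and>
     (\<forall>(\<tau>::nat \<Rightarrow> real) n. 0 \<le> \<tau> 0 \<longrightarrow> strict_mono \<tau> \<longrightarrow>
        prob_space.indep_vars M (\<lambda>_. count_space UNIV)
          (\<lambda>i \<omega>. X \<omega> (\<tau> (Suc i)) - X \<omega> (\<tau> i)) {..<n})"

text \<open>Number of jumps across the bond (x,x+1) during (0,t] in the graphical
  (Harris) construction: the clock at x rings while site x is occupied.\<close>
definition jumps ::
  "('a \<Rightarrow> real \<Rightarrow> int \<Rightarrow> nat) \<Rightarrow> ('a \<Rightarrow> int \<Rightarrow> real \<Rightarrow> nat) \<Rightarrow> 'a \<Rightarrow> int \<Rightarrow> real \<Rightarrow> nat" where
  "jumps \<eta> N \<omega> x t = card {s \<in> {0<..t}. real (N \<omega> x s) \<noteq> llim (N \<omega> x) s \<and>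
                                      1 \<le> llim (\<lambda>r. \<eta> \<omega> r x) s}"

text \<open>eta is the TAZRP (g = 1_{k>=1}) started from nu_rho, realised on the
  probability space M by the graphical construction with independent rate-one
  Poisson clocks N x, independent of the initial configuration (the initial
  configuration is encoded as a time-constant element of the same path space
  so that indep_var, which needs equal types, applies).\<close>
definition tazrp :: "'a measure \<Rightarrow> real \<Rightarrow> ('a \<Rightarrow> real \<Rightarrow> int \<Rightarrow> nat)
                     \<Rightarrow> ('a \<Rightarrow> int \<Rightarrow> real \<Rightarrow> nat) \<Rightarrow> bool" where
  "tazrp M \<rho> \<eta> N \<longleftrightarrow>
     prob_space M \<and>
     (\<forall>t x. (\<lambda>\<omega>. \<eta> \<omega> t x) \<in> measurable M (count_space UNIV)) \<and>
     (\<forall>S (k::int \<Rightarrow> nat). finite S \<longrightarrow>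
        measure M {\<omega> \<in> space M. \<forall>x\<in>S. \<eta> \<omega> 0 x = k x} = (\<Prod>x\<in>S. nu_marg \<rho> (k x))) \<and>
     (\<forall>x. poisson_process M (\<lambda>\<omega>. N \<omega> x)) \<and>
     prob_space.indep_vars M (\<lambda>_. PiM UNIV (\<lambda>_::real. count_space (UNIV::nat set)))
        (\<lambda>x \<omega>. N \<omega> x) UNIV \<and>
     prob_space.indep_var M
        (PiM UNIV (\<lambda>_::int. PiM UNIV (\<lambda>_::real. count_space (UNIV::nat set))))
        (\<lambda>\<omega> x _. \<eta> \<omega> 0 x)
        (PiM UNIV (\<lambda>_::int. PiM UNIV (\<lambda>_::real. count_space (UNIV::nat set)))) (\<lambda>\<omega>. N \<omega>) \<and>
     (AE \<omega> in M. \<forall>x t. 0 \<le> t \<longrightarrow>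
        real (\<eta> \<omega> t x) = real (\<eta> \<omega> 0 x) - real (jumps \<eta> N \<omega> x t)
                           + real (jumps \<eta> N \<omega> (x - 1) t))"

end

theory Submission
  imports Defs
begin

text \<open>
  Write \<open>\<eta>'\<close> and \<open>g'\<close> for the centred occupation number and rate. Since \<open>g k * k = k\<close>,
  \<open>- (1+\<rho>) V\<^sub>g(\<eta>(x)) = g'(\<eta>(x+1)) \<eta>'(x) + g(\<eta>(x)) w(\<eta>) - g(\<eta>(x+1)) w(\<eta>\<^bsup>x+1,x\<^esup>)\<close> with
  \<open>w(\<eta>) = \<eta>(x) - 1 - \<rho>\<close>,
  and \<open>g'(\<eta>(x+1))\<close> can be traded for its average over \<open>x+1, \<dots>, x+K\<close> at the price of gradients
  \<open>g(\<eta>(y)) - g(\<eta>(y+1))\<close>. So \<open>\<Sum> a(x) V\<^sub>g(\<eta>(x))\<close> is a sum of bond currents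
  \<open>g(\<eta>(y)) w\<^sub>y(\<eta>) - g(\<eta>(y+1)) w\<^sub>y(\<eta>\<^bsup>y+1,y\<^esup>)\<close> with total energy of order \<open>K \<Sum> a\<^sup>2\<close>, plus a
  remainder of variance of order \<open>\<Sum> a\<^sup>2 / K\<close>. The invariant measure pairs a bond current with a
  function only through the gradient of the latter along the jump, whence an \<open>H\<^sub>-\<^sub>1\<close> estimate: over a time
  \<open>T\<close> the currents contribute \<open>O(T K \<Sum> a\<^sup>2)\<close>, the remainder \<open>O(T\<^sup>2 \<Sum> a\<^sup>2 / K)\<close>. With
  \<open>K \<approx> \<surd>T\<close>, \<open>T = t N\<^bsup>1+\<gamma>\<^esup>\<close> and \<open>\<Sum> a\<^sup>2 = O(N)\<close> the second moment is
  \<open>O(N\<^bsup>(3\<gamma>-1)/2\<^esup>)\<close>.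

  The estimate is proved for a chain in discrete time on a finite ring, driven by the same clocks, which moves
  only if exactly one clock rings in a time step. It coincides with the process to the right of a site whose
  clock is silent up to time \<open>T\<close>; such sites exist far to the left, so the integral is an a.s. limit of
  Riemann sums along these chains, and Fatou's lemma transfers the bound.
\<close>

section \<open>Additive functionals of a finite Markov chain\<close>

text \<open>The dynamics is not reversible, so the energy estimate must rest on invariance: pairing
  \<open>h\<close> with \<open>h - Q h\<close> sees only the symmetric part of \<open>Q\<close>, and
  that suffices to absorb the test function. On a ring with a capped, conserved number of particles
  every expectation is a finite sum, and in discrete time the semigroup becomes the powers of one
  operator. Subtracting the constant and linear parts from the rate is what leaves, besides
  currents, only products of two centred variables at different sites. Averaging one of them over
  \<open>K\<close> sites costs current energy of order \<open>K\<close> and gains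
  \<open>1 / K\<close> in variance. The ring approximates the line because the process is totally
  asymmetric: a site is influenced only from its left, so a silent clock shields all sites to its
  right from the seam of the ring. On the rescaled clock, with \<kappa> the speed-up factor, the two
  contributions are of order \<open>K / \<kappa>\<close> and \<open>1 / K\<close> times N to the
  power 2 \<gamma>. They balance when \<open>K\<close> is about the square root of \<kappa>, and the
  resulting exponent is negative exactly for \<gamma> < 1/3.\<close>

locale finite_chain =
  fixes S :: "'c set" and \<nu> :: "'c \<Rightarrow> real" and W :: "'b set" and T :: "'b \<Rightarrow> 'c \<Rightarrow> 'c" and p :: real
  assumes weight_nonneg: "\<And>c. c \<in> S \<Longrightarrow> 0 \<le> \<nu> c"
    and p_pos: "0 < p" and p_card: "p * card W \<le> 1"
    and stationary: "\<And>u :: 'c \<Rightarrow> real. (\<Sum>c\<in>S. \<nu> c * (\<Sum>y\<in>W. u (T y c) - u c)) = 0"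
begin

text \<open>\<open>p * card W \<le> 1\<close> leaves the remaining probability for standing still.
  The weights \<open>\<nu>\<close> are not normalised, because they will be a product measure cut at
  a particle number.\<close>

definition Q :: "('c \<Rightarrow> real) \<Rightarrow> 'c \<Rightarrow> real" where
  "Q h c = h c + p * (\<Sum>y\<in>W. h (T y c) - h c)"

definition ip :: "('c \<Rightarrow> real) \<Rightarrow> ('c \<Rightarrow> real) \<Rightarrow> real" where
  "ip u v = (\<Sum>c\<in>S. \<nu> c * (u c * v c))"

text \<open>Partial sums of the potential series: they solve the Poisson equation
  \<open>u - Q u = f\<close> up to the error \<open>(Q ^^ l) f\<close>.\<close>

definition psum :: "('c \<Rightarrow> real) \<Rightarrow> nat \<Rightarrow> 'c \<Rightarrow> real" where
  "psum f l c = (\<Sum>j<l. (Q ^^ j) f c)"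

lemma ip_sum_right: "ip u (\<lambda>c. \<Sum>i\<in>I. v i c) = (\<Sum>i\<in>I. ip u (v i))"
  unfolding ip_def sum_distrib_left by (rule sum.swap)

lemma ip_nonneg: "0 \<le> ip u u"
  unfolding ip_def by (intro sum_nonneg mult_nonneg_nonneg[OF weight_nonneg]) auto

lemma ip_commute: "ip u v = ip v u"
  unfolding ip_def by (simp add: mult.commute)

lemma sum_Q: "(\<Sum>c\<in>S. \<nu> c * Q u c) = (\<Sum>c\<in>S. \<nu> c * u c)"
proof -
  have "\<nu> c * Q u c = \<nu> c * u c + p * (\<nu> c * (\<Sum>y\<in>W. u (T y c) - u c))" for c
    unfolding Q_def by (simp only: distrib_left mult.left_commute)
  then have "(\<Sum>c\<in>S. \<nu> c * Q u c)
      = (\<Sum>c\<in>S. \<nu> c * u c) + p * (\<Sum>c\<in>S. \<nu> c * (\<Sum>y\<in>W. u (T y c) - u c))"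
    by (simp only: sum.distrib sum_distrib_left[of p])
  then show ?thesis by (simp add: stationary)
qed

text \<open>Expanding the square leaves a cross term and a difference of squares; invariance applied
  to the square of \<open>h\<close> kills the latter.\<close>

lemma dirichlet_form:
  "p * (\<Sum>y\<in>W. \<Sum>c\<in>S. \<nu> c * (h (T y c) - h c)\<^sup>2) = 2 * (ip h h - ip h (Q h))"
proof -
  have "(\<Sum>y\<in>W. \<Sum>c\<in>S. \<nu> c * (h (T y c) - h c)\<^sup>2)
      = (\<Sum>c\<in>S. \<nu> c * (\<Sum>y\<in>W. (h (T y c))\<^sup>2 - (h c)\<^sup>2))
        - 2 * (\<Sum>c\<in>S. \<nu> c * (h c * (\<Sum>y\<in>W. h (T y c) - h c)))"
    unfolding sum_distrib_left sum_subtractf[symmetric]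
    by (subst sum.swap) (auto intro!: sum.cong simp: power2_eq_square algebra_simps)
  also have "\<dots> = - 2 * (\<Sum>c\<in>S. \<nu> c * (h c * (\<Sum>y\<in>W. h (T y c) - h c)))"
    using stationary[of "\<lambda>c. (h c)\<^sup>2"] by simp
  finally have *: "p * (\<Sum>y\<in>W. \<Sum>c\<in>S. \<nu> c * (h (T y c) - h c)\<^sup>2)
      = - 2 * (\<Sum>c\<in>S. \<nu> c * (h c * (p * (\<Sum>y\<in>W. h (T y c) - h c))))"
    by (simp add: sum_distrib_left algebra_simps)
  have "ip h (Q h) = ip h h + (\<Sum>c\<in>S. \<nu> c * (h c * (p * (\<Sum>y\<in>W. h (T y c) - h c))))"
    unfolding ip_def Q_def sum.distrib[symmetric] by (simp add: algebra_simps)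
  with * show ?thesis by simp
qed

text \<open>Jensen's inequality for the averaging operator \<open>Q\<close>; the moves carry total
  weight at most one by \<open>p_card\<close>.\<close>

lemma Q_square_le: "(Q h c)\<^sup>2 \<le> Q (\<lambda>c. (h c)\<^sup>2) c"
proof -
  define d where "d y = h (T y c) - h c" for y
  have "(\<Sum>y\<in>W. d y)\<^sup>2 \<le> card W * (\<Sum>y\<in>W. (d y)\<^sup>2)"
    using Cauchy_Schwarz_ineq_sum[of "\<lambda>_. 1" d W] by simp
  then have "p\<^sup>2 * (\<Sum>y\<in>W. d y)\<^sup>2 \<le> p\<^sup>2 * (card W * (\<Sum>y\<in>W. (d y)\<^sup>2))"
    by (intro mult_left_mono) auto
  also have "\<dots> = p * (p * card W) * (\<Sum>y\<in>W. (d y)\<^sup>2)"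
    by (simp add: power2_eq_square)
  also have "\<dots> \<le> p * 1 * (\<Sum>y\<in>W. (d y)\<^sup>2)"
    using p_pos p_card by (intro mult_right_mono mult_left_mono sum_nonneg) auto
  finally have *: "p\<^sup>2 * (\<Sum>y\<in>W. d y)\<^sup>2 \<le> p * (\<Sum>y\<in>W. (d y)\<^sup>2)" by simp
  have "Q (\<lambda>c. (h c)\<^sup>2) c = (h c)\<^sup>2 + p * (\<Sum>y\<in>W. 2 * h c * d y + (d y)\<^sup>2)"
    unfolding Q_def d_def by (simp add: power2_eq_square algebra_simps)
  also have "\<dots> = (h c)\<^sup>2 + 2 * p * h c * (\<Sum>y\<in>W. d y) + p * (\<Sum>y\<in>W. (d y)\<^sup>2)"
    by (simp only: sum.distrib sum_distrib_left[symmetric] distrib_left)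
  moreover have "(Q h c)\<^sup>2 = (h c)\<^sup>2 + 2 * p * h c * (\<Sum>y\<in>W. d y) + p\<^sup>2 * (\<Sum>y\<in>W. d y)\<^sup>2"
    unfolding Q_def d_def by (simp add: power2_eq_square algebra_simps)
  ultimately show ?thesis using * by simp
qed

lemma ip_Q_le: "ip (Q h) (Q h) \<le> ip h h"
proof -
  have "ip (Q h) (Q h) \<le> (\<Sum>c\<in>S. \<nu> c * Q (\<lambda>c. (h c)\<^sup>2) c)"
    unfolding ip_def using Q_square_le
    by (intro sum_mono mult_left_mono weight_nonneg) (auto simp: power2_eq_square)
  also have "\<dots> = ip h h" by (simp add: sum_Q ip_def power2_eq_square)
  finally show ?thesis .
qed

lemma ip_Qpow_le: "ip ((Q ^^ j) f) ((Q ^^ j) f) \<le> ip f f"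
  by (induction j) (auto intro: order_trans ip_Q_le)

lemma Q_psum: "Q (psum f l) c = psum f l c + (Q ^^ l) f c - f c"
proof -
  have "Q (psum f l) c = (\<Sum>j<l. Q ((Q ^^ j) f) c)"
    unfolding Q_def psum_def sum.distrib sum_distrib_left sum_subtractf[symmetric]
    by (subst (2) sum.swap) simp
  also have "\<dots> = (\<Sum>j<l. (Q ^^ Suc j) f c)" by simp
  also have "\<dots> = psum f l c + (Q ^^ l) f c - f c"
    using sum.lessThan_Suc_shift[of "\<lambda>j. (Q ^^ j) f c" l]
    unfolding psum_def by simp
  finally show ?thesis .
qed

text \<open>Energy estimate: testing \<open>f\<close> against the partial potentials \<open>psum f l\<close>, whose total
  Dirichlet energy is controlled by the same pairing; AM-GM then closes the loop.\<close>
lemma additive_functional_bound: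
  assumes grad: "\<And>h. ip f h = (\<Sum>y\<in>W. \<Sum>c\<in>S. \<nu> c * (w y c * (h c - h (T y c))))"
  shows "m * ip f f + 2 * (\<Sum>l=1..m. \<Sum>j=1..<l. ip f ((Q ^^ j) f))
     \<le> 4 * m * (\<Sum>y\<in>W. \<Sum>c\<in>S. \<nu> c * (w y c)\<^sup>2) / p + ip f f"
proof -
  define a where "a j = ip f ((Q ^^ j) f)" for j
  define G where "G = (\<Sum>y\<in>W. \<Sum>c\<in>S. \<nu> c * (w y c)\<^sup>2)"
  define E where "E = (\<Sum>l=1..m. ip f (psum f l))"
  define D where "D l = (\<Sum>y\<in>W. \<Sum>c\<in>S. \<nu> c * (psum f l (T y c) - psum f l c)\<^sup>2)" for l
  have ippsum: "ip f (psum f l) = (\<Sum>j<l. a j)" for l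
    using ip_sum_right[of f "\<lambda>j. (Q ^^ j) f" "{..<l}"] unfolding a_def psum_def by simp
  have split: "ip f (psum f l) = ip f f + (\<Sum>j=1..<l. a j)" if "1 \<le> l" for l
  proof -
    have "{..<l} = insert 0 {1..<l}" using that by auto
    then show ?thesis unfolding ippsum by (simp add: a_def)
  qed
  \<comment> \<open>The left side of the claim is the stationary second moment of the sum of
    \<open>f\<close> over \<open>m\<close> steps; it equals
    \<open>2 * E - m * ip f f\<close>.\<close>
  have E2: "2 * E = 2 * m * ip f f + 2 * (\<Sum>l=1..m. \<Sum>j=1..<l. a j)"
    unfolding E_def by (simp add: split sum.distrib)
  \<comment> \<open>The Poisson equation turns the energy of \<open>psum f l\<close> into its
    pairing with \<open>f\<close>, up to a boundary term at time \<open>l\<close>.\<close>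
  have D: "p * D l = 2 * (ip f (psum f l) - ip (psum f l) ((Q ^^ l) f))" for l
  proof -
    have "ip (psum f l) (psum f l) - ip (psum f l) (Q (psum f l))
        = ip (psum f l) f - ip (psum f l) ((Q ^^ l) f)"
      unfolding ip_def Q_psum sum_subtractf[symmetric]
      by (intro sum.cong refl) (simp add: algebra_simps)
    then show ?thesis
      unfolding D_def dirichlet_form by (simp add: ip_commute)
  qed
  \<comment> \<open>The boundary terms nearly telescope: passing to \<open>psum f (Suc l)\<close>
    adds \<open>(Q ^^ l) f\<close>, whose norm is at most that of \<open>f\<close> by
    contraction.\<close>
  have step: "2 * ip (psum f l) ((Q ^^ l) f)
      \<ge> ip (psum f (Suc l)) (psum f (Suc l)) - ip (psum f l) (psum f l) - ip f f" for l
  proof -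
    have "ip (psum f (Suc l)) (psum f (Suc l))
        = ip (psum f l) (psum f l) + 2 * ip (psum f l) ((Q ^^ l) f)
          + ip ((Q ^^ l) f) ((Q ^^ l) f)"
      unfolding ip_def psum_def sum_distrib_left[of 2] sum.distrib[symmetric]
      by (intro sum.cong refl) (simp add: algebra_simps)
    then show ?thesis using ip_Qpow_le[of l f] by simp
  qed
  have "(\<Sum>l=1..m. 2 * ip (psum f l) ((Q ^^ l) f))
      \<ge> (\<Sum>l=1..m. ip (psum f (Suc l)) (psum f (Suc l)) - ip (psum f l) (psum f l) - ip f f)"
    by (intro sum_mono step)
  moreover have "(\<Sum>l=1..m. ip (psum f (Suc l)) (psum f (Suc l)) - ip (psum f l) (psum f l) - ip f f)
     = ip (psum f (Suc m)) (psum f (Suc m)) - ip (psum f 1) (psum f 1) - m * ip f f"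
    by (induction m) (auto simp: algebra_simps)
  moreover have "ip (psum f 1) (psum f 1) = ip f f"
    unfolding psum_def by (simp add: ip_def)
  ultimately have lower: "(\<Sum>l=1..m. 2 * ip (psum f l) ((Q ^^ l) f)) \<ge> - ((m + 1) * ip f f)"
    using ip_nonneg[of "psum f (Suc m)"] by (simp add: algebra_simps)
  have "p * (\<Sum>l=1..m. D l) = 2 * E - (\<Sum>l=1..m. 2 * ip (psum f l) ((Q ^^ l) f))"
    unfolding sum_distrib_left D E_def by (simp add: sum_subtractf sum_distrib_left algebra_simps)
  with lower have DE: "p * (\<Sum>l=1..m. D l) \<le> 2 * E + (m + 1) * ip f f" by linarith
  have bound: "ip f (psum f l) \<le> G / p + p * D l / 4" for l
  proof -
    \<comment> \<open>AM-GM with weight \<open>p / 4\<close> on the gradient: after summation over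
      \<open>l\<close> the energies return as one half of \<open>E\<close>, which the left side
      absorbs.\<close>
    have "w y c * (psum f l c - psum f l (T y c))
        \<le> (w y c)\<^sup>2 / p + p * (psum f l (T y c) - psum f l c)\<^sup>2 / 4" for y c
    proof -
      define d where "d = psum f l c - psum f l (T y c)"
      have "0 \<le> (w y c - p * d / 2)\<^sup>2 / p" using p_pos by simp
      also have "\<dots> = (w y c)\<^sup>2 / p + p * d\<^sup>2 / 4 - w y c * d"
        using p_pos by (simp add: power2_eq_square field_simps)
      finally show ?thesis
        unfolding d_def by (simp add: power2_commute)
    qed
    then have "ip f (psum f l) \<le> (\<Sum>y\<in>W. \<Sum>c\<in>S. \<nu> c *
        ((w y c)\<^sup>2 / p + p * (psum f l (T y c) - psum f l c)\<^sup>2 / 4))"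
      unfolding grad by (intro sum_mono mult_left_mono weight_nonneg) auto
    also have "\<dots> = G / p + p * D l / 4"
      unfolding G_def D_def by (simp add: sum.distrib sum_distrib_left sum_divide_distrib algebra_simps)
    finally show ?thesis .
  qed
  have "E \<le> (\<Sum>l=1..m. G / p + p * D l / 4)"
    unfolding E_def by (intro sum_mono bound)
  also have "\<dots> = m * G / p + p * (\<Sum>l=1..m. D l) / 4"
    by (simp add: sum.distrib sum_distrib_left sum_divide_distrib)
  finally have "E \<le> m * G / p + (2 * E + (m + 1) * ip f f) / 4"
    using DE by (smt (verit) divide_right_mono)
  then have "2 * E \<le> 4 * (m * G / p) + (m + 1) * ip f f" by (simp add: field_simps)
  then show ?thesis using E2 unfolding a_def G_def by (simp add: algebra_simps)
qed

end

section \<open>The dynamics on a ring\<close>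

type_synonym cfg = "int \<Rightarrow> nat"

definition rnext :: "int \<Rightarrow> int \<Rightarrow> int" where
  "rnext R x = (if x = R then - R else x + 1)"

definition mv :: "int \<Rightarrow> int \<Rightarrow> cfg \<Rightarrow> cfg" where
  "mv R x c = (if 1 \<le> c x then c(x := c x - 1, rnext R x := c (rnext R x) + 1) else c)"

text \<open>Inverse of \<open>mv R x\<close> only if the site \<open>rnext R x\<close> is occupied.\<close>
definition bk :: "int \<Rightarrow> int \<Rightarrow> cfg \<Rightarrow> cfg" where
  "bk R x c = c(rnext R x := c (rnext R x) - 1, x := c x + 1)"

text \<open>The cap \<open>B\<close> makes the state space finite; since moves conserve particles,
  it is also invariant.\<close>

definition cfgs :: "int \<Rightarrow> nat \<Rightarrow> cfg set" where
  "cfgs R B = {c. (\<forall>x. x \<notin> {-R..R} \<longrightarrow> c x = 0) \<and> (\<Sum>x\<in>{-R..R}. c x) \<le> B}"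

definition wt :: "real \<Rightarrow> int \<Rightarrow> cfg \<Rightarrow> real" where
  "wt \<rho> R c = (\<Prod>x\<in>{-R..R}. nu_marg \<rho> (c x))"

lemma rnext_mem: "x \<in> {-R..R} \<Longrightarrow> rnext R x \<in> {-R..R}"
  by (auto simp: rnext_def)

lemma rnext_neq: "1 \<le> R \<Longrightarrow> rnext R x \<noteq> x"
  by (auto simp: rnext_def)

lemma bij_betw_rnext: "bij_betw (rnext R) {-R..R} {-R..R}"
proof -
  have "inj_on (rnext R) {-R..R}"
    by (auto simp: inj_on_def rnext_def split: if_splits)
  moreover have "rnext R ` {-R..R} \<subseteq> {-R..R}" using rnext_mem by auto
  ultimately show ?thesis
    by (simp add: bij_betw_def endo_inj_surj)
qed

lemma finite_cfgs: "finite (cfgs R B)"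
proof (rule finite_subset)
  show "cfgs R B \<subseteq> {c. \<forall>x. (x \<in> {-R..R} \<longrightarrow> c x \<in> {..B}) \<and> (x \<notin> {-R..R} \<longrightarrow> c x = 0)}"
  proof
    fix c assume c: "c \<in> cfgs R B"
    then have "c x \<le> B" if "x \<in> {-R..R}" for x
      using member_le_sum[of x "{-R..R}" c] that by (auto simp: cfgs_def)
    with c show "c \<in> {c. \<forall>x. (x \<in> {-R..R} \<longrightarrow> c x \<in> {..B}) \<and> (x \<notin> {-R..R} \<longrightarrow> c x = 0)}"
      by (auto simp: cfgs_def)
  qed
  show "finite {c::int \<Rightarrow> nat. \<forall>x. (x \<in> {-R..R} \<longrightarrow> c x \<in> {..B}) \<and> (x \<notin> {-R..R} \<longrightarrow> c x = 0)}"
    by (rule finite_set_of_finite_funs) auto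
qed

section \<open>Conservation of particles and invariance of the product weights\<close>

lemma sum_two:
  fixes f :: "'b \<Rightarrow> 'c::comm_monoid_add"
  assumes "finite I" "x \<in> I" "z \<in> I" "x \<noteq> z"
  shows "sum f I = f x + f z + sum f (I - {x, z})"
proof -
  have "sum f I = f x + sum f (I - {x})" using assms by (intro sum.remove) auto
  also have "sum f (I - {x}) = f z + sum f (I - {x} - {z})" using assms by (intro sum.remove) auto
  also have "I - {x} - {z} = I - {x, z}" by auto
  finally show ?thesis by (simp add: add.assoc)
qed

lemma sum_mv:
  assumes "1 \<le> R" "x \<in> {-R..R}"
  shows "(\<Sum>z\<in>{-R..R}. mv R x c z) = (\<Sum>z\<in>{-R..R}. c z)"
proof (cases "1 \<le> c x")
  case True
  have "(\<Sum>z\<in>{-R..R} - {x, rnext R x}. mv R x c z) = (\<Sum>z\<in>{-R..R} - {x, rnext R x}. c z)"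
    by (intro sum.cong) (auto simp: mv_def)
  moreover have "mv R x c x + mv R x c (rnext R x) = c x + c (rnext R x)"
    using True rnext_neq[OF assms(1), of x] by (auto simp: mv_def)
  ultimately show ?thesis
    using sum_two[of "{-R..R}" x "rnext R x" c] sum_two[of "{-R..R}" x "rnext R x" "mv R x c"]
      assms rnext_mem[OF assms(2)] rnext_neq[OF assms(1), of x] by simp
qed (simp add: mv_def)

lemma mv_supp: "x \<in> {-R..R} \<Longrightarrow> z \<notin> {-R..R} \<Longrightarrow> mv R x c z = c z"
  using rnext_mem[of x R] by (auto simp: mv_def)

lemma mv_cfgs:
  assumes "1 \<le> R" "x \<in> {-R..R}"
  shows "mv R x c \<in> cfgs R B \<longleftrightarrow> c \<in> cfgs R B"
  using assms by (auto simp: cfgs_def sum_mv mv_supp)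

lemma bk_mv: "1 \<le> R \<Longrightarrow> 1 \<le> c x \<Longrightarrow> bk R x (mv R x c) = c"
  using rnext_neq[of R x] by (auto simp: bk_def mv_def)

lemma mv_bk: "1 \<le> R \<Longrightarrow> 1 \<le> c (rnext R x) \<Longrightarrow> mv R x (bk R x c) = c"
  using rnext_neq[of R x] by (auto simp: bk_def mv_def)

text \<open>Geometric marginals make the weight a function of the total particle number alone, which
  every move conserves.\<close>

lemma wt_eq: "wt \<rho> R c = (1 / (1 + \<rho>)) ^ card {-R..R} * (\<rho> / (1 + \<rho>)) ^ (\<Sum>x\<in>{-R..R}. c x)"
  unfolding wt_def nu_marg_def by (simp only: prod.distrib prod_constant power_sum)

lemma wt_mv: "1 \<le> R \<Longrightarrow> x \<in> {-R..R} \<Longrightarrow> wt \<rho> R (mv R x c) = wt \<rho> R c"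
  by (simp add: wt_eq sum_mv)

lemma wt_nonneg: "0 < \<rho> \<Longrightarrow> 0 \<le> wt \<rho> R c"
  by (simp add: wt_eq)

text \<open>Moving a particle across the bond is a weight-preserving bijection from the
  configurations with \<open>y\<close> occupied onto those with the next site occupied.\<close>

lemma change_of_variables:
  assumes R: "1 \<le> R" and y: "y \<in> {-R..R}"
  shows "(\<Sum>c\<in>cfgs R B. wt \<rho> R c * (g_rate (c y) * F (mv R y c)))
       = (\<Sum>c\<in>cfgs R B. wt \<rho> R c * (g_rate (c (rnext R y)) * F c))"
proof -
  let ?A = "{c \<in> cfgs R B. 1 \<le> c y}" and ?B = "{c \<in> cfgs R B. 1 \<le> c (rnext R y)}"
  have "(\<Sum>c\<in>cfgs R B. wt \<rho> R c * (g_rate (c y) * F (mv R y c))) = (\<Sum>c\<in>?A. wt \<rho> R c * F (mv R y c))"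
    by (rule sum.mono_neutral_cong_right) (auto simp: finite_cfgs g_rate_def)
  also have "\<dots> = (\<Sum>c\<in>?B. wt \<rho> R c * F c)"
  proof (rule sum.reindex_bij_witness[of _ "bk R y" "mv R y"])
    fix c assume c: "c \<in> ?A"
    then show "bk R y (mv R y c) = c" using R by (simp add: bk_mv)
    show "mv R y c \<in> ?B" using c R y by (auto simp: mv_cfgs) (simp add: mv_def)
    show "wt \<rho> R (mv R y c) * F (mv R y c) = wt \<rho> R c * F (mv R y c)" using R y by (simp add: wt_mv)
  next
    fix c assume c: "c \<in> ?B"
    then show "mv R y (bk R y c) = c" using R by (simp add: mv_bk)
    then show "bk R y c \<in> ?A" using c R y mv_cfgs[of R y "bk R y c" B] by (auto simp: bk_def)
  qed
  also have "\<dots> = (\<Sum>c\<in>cfgs R B. wt \<rho> R c * (g_rate (c (rnext R y)) * F c))"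
    by (rule sum.mono_neutral_cong_left) (auto simp: finite_cfgs g_rate_def)
  finally show ?thesis .
qed

lemma g_rate_mv: "g_rate (c y) * (h (mv R y c) - h c) = h (mv R y c) - h c"
  by (simp add: g_rate_def mv_def)

text \<open>The change of variables turns the gain of each bond into the rate at its target site. On
  a ring \<open>rnext\<close> permutes the sites, so gains and losses cancel in the sum over
  bonds.\<close>

lemma wt_stationary:
  fixes u :: "cfg \<Rightarrow> real"
  assumes R: "1 \<le> R"
  shows "(\<Sum>c\<in>cfgs R B. wt \<rho> R c * (\<Sum>y\<in>{-R..R}. u (mv R y c) - u c)) = 0"
proof -
  let ?s = "\<lambda>F. \<Sum>c\<in>cfgs R B. wt \<rho> R c * F c"
  have "?s (\<lambda>c. \<Sum>y\<in>{-R..R}. u (mv R y c) - u c)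
      = (\<Sum>y\<in>{-R..R}. ?s (\<lambda>c. g_rate (c y) * (u (mv R y c) - u c)))"
    unfolding g_rate_mv sum_distrib_left by (rule sum.swap)
  also have "\<dots> = (\<Sum>y\<in>{-R..R}. ?s (\<lambda>c. g_rate (c (rnext R y)) * u c) - ?s (\<lambda>c. g_rate (c y) * u c))"
    by (intro sum.cong refl)
       (simp add: change_of_variables[OF R, symmetric] right_diff_distrib sum_subtractf)
  also have "\<dots> = 0"
    unfolding sum_subtractf
    using sum.reindex_bij_betw[OF bij_betw_rnext, of "\<lambda>y. ?s (\<lambda>c. g_rate (c y) * u c)"] by simp
  finally show ?thesis .
qed

text \<open>The adjoint, with respect to the invariant weights, of the gradient along jumps, applied
  to bond weights \<open>w\<close>. Where \<open>rnext R y\<close> is empty, \<open>bk\<close> does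
  not invert a move, but there the factor \<open>g_rate\<close> vanishes.\<close>

definition cur :: "int \<Rightarrow> (int \<Rightarrow> cfg \<Rightarrow> real) \<Rightarrow> cfg \<Rightarrow> real" where
  "cur R w c = (\<Sum>y\<in>{-R..R}. g_rate (c y) * w y c - g_rate (c (rnext R y)) * w y (bk R y c))"

text \<open>Supplies the hypothesis \<open>grad\<close> of the energy estimate, with
  \<open>g_rate (c y) * w y c\<close> as bond weights.\<close>

lemma cur_by_parts:
  assumes R: "1 \<le> R"
  shows "(\<Sum>c\<in>cfgs R B. wt \<rho> R c * (cur R w c * h c))
    = (\<Sum>y\<in>{-R..R}. \<Sum>c\<in>cfgs R B. wt \<rho> R c * (g_rate (c y) * w y c * (h c - h (mv R y c))))"
proof -
  let ?s = "\<lambda>F. \<Sum>c\<in>cfgs R B. wt \<rho> R c * F c"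
  have "?s (\<lambda>c. cur R w c * h c) = (\<Sum>y\<in>{-R..R}. ?s (\<lambda>c. g_rate (c y) * w y c * h c)
      - ?s (\<lambda>c. g_rate (c (rnext R y)) * (w y (bk R y c) * h c)))"
    unfolding cur_def sum_distrib_right sum_distrib_left sum_subtractf[symmetric]
    by (subst sum.swap) (simp add: algebra_simps)
  also have "\<dots> = (\<Sum>y\<in>{-R..R}. ?s (\<lambda>c. g_rate (c y) * w y c * h c)
      - ?s (\<lambda>c. g_rate (c y) * (w y c * h (mv R y c))))"
  proof (rule sum.cong[OF refl], rule arg_cong2[of _ _ _ _ "(-)", OF refl])
    fix y assume y: "y \<in> {-R..R}"
    have "?s (\<lambda>c. g_rate (c (rnext R y)) * (w y (bk R y c) * h c))
        = ?s (\<lambda>c. g_rate (c y) * (w y (bk R y (mv R y c)) * h (mv R y c)))"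
      using change_of_variables[OF R y, where F = "\<lambda>c. w y (bk R y c) * h c"] by simp
    also have "\<dots> = ?s (\<lambda>c. g_rate (c y) * (w y c * h (mv R y c)))"
      by (intro sum.cong refl) (auto simp: g_rate_def bk_mv[OF R])
    finally show "?s (\<lambda>c. g_rate (c (rnext R y)) * (w y (bk R y c) * h c))
        = ?s (\<lambda>c. g_rate (c y) * (w y c * h (mv R y c)))" .
  qed
  also have "\<dots> = (\<Sum>y\<in>{-R..R}. ?s (\<lambda>c. g_rate (c y) * w y c * (h c - h (mv R y c))))"
    by (simp add: sum_subtractf[symmetric] algebra_simps)
  finally show ?thesis .
qed

section \<open>Decomposition of the field into currents and a remainder\<close>

definition hat :: "real \<Rightarrow> nat \<Rightarrow> real" where "hat \<rho> k = real k - \<rho>"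
definition ghat :: "real \<Rightarrow> nat \<Rightarrow> real" where "ghat \<rho> k = g_rate k - phi \<rho>"

text \<open>The weights \<open>1 - j / K\<close> come from Abel summation, when the rate at one site
  is compared with its average over \<open>K\<close> sites; the comparison started at
  \<open>y - j\<close> crosses the bond at \<open>y\<close>.\<close>

definition Psi :: "real \<Rightarrow> nat \<Rightarrow> (int \<Rightarrow> real) \<Rightarrow> int \<Rightarrow> cfg \<Rightarrow> real" where
  "Psi \<rho> K a y c = (\<Sum>j=1..<K. (1 - real j / real K) * (a (y - int j) * hat \<rho> (c (y - int j))))"

text \<open>The \<open>- 1\<close> compensates for the particle that \<open>bk\<close> puts back at
  \<open>y\<close>: after the backward move the first term reads
  \<open>a y * hat \<rho> (c y)\<close>.\<close>

definition pot :: "real \<Rightarrow> nat \<Rightarrow> (int \<Rightarrow> real) \<Rightarrow> int \<Rightarrow> cfg \<Rightarrow> real" where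
  "pot \<rho> K a y c = - (a y * (real (c y) - 1 - \<rho>) + Psi \<rho> K a y c) / (1 + \<rho>)"

definition rem :: "real \<Rightarrow> nat \<Rightarrow> int \<Rightarrow> (int \<Rightarrow> real) \<Rightarrow> cfg \<Rightarrow> real" where
  "rem \<rho> K A a c = - (\<Sum>x\<in>{-A..A}. \<Sum>j=1..K. a x * hat \<rho> (c x) * ghat \<rho> (c (x + int j))) / (real K * (1 + \<rho>))"

lemma deriv_phi: "0 < \<rho> \<Longrightarrow> deriv phi \<rho> = 1 / (1 + \<rho>)\<^sup>2"
proof (rule DERIV_imp_deriv)
  assume "0 < \<rho>"
  then have "((\<lambda>r. r / (1 + r)) has_real_derivative 1 / (1 + \<rho>)\<^sup>2) (at \<rho>)"
    by (auto intro!: derivative_eq_intros simp: power2_eq_square field_simps)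
  moreover have "phi = (\<lambda>r. r / (1 + r))" by (simp add: fun_eq_iff phi_def)
  ultimately show "(phi has_real_derivative 1 / (1 + \<rho>)\<^sup>2) (at \<rho>)" by simp
qed

text \<open>Rests on \<open>g_rate k * k = k\<close>, which makes rate times occupation at one site
  linear again. With \<open>k\<close> and \<open>l\<close> at neighbouring sites the left side is a
  bond current, and what is left beyond \<open>Vg\<close> is a product of two centred variables, to
  be reduced by averaging.\<close>

lemma Vg_identity:
  assumes "0 < \<rho>"
  shows "g_rate k * (real k - 1 - \<rho>) - g_rate l * hat \<rho> k = - (1 + \<rho>) * Vg \<rho> k - ghat \<rho> l * hat \<rho> k"
proof -
  have gk: "g_rate k * real k = real k" by (simp add: g_rate_def)
  have V: "Vg \<rho> k = g_rate k - \<rho> / (1 + \<rho>) - (real k - \<rho>) / (1 + \<rho>)\<^sup>2"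
    unfolding Vg_def deriv_phi[OF assms] phi_def by simp
  have r: "1 + \<rho> \<noteq> 0" using assms by simp
  have "(1 + \<rho>) * Vg \<rho> k = (1 + \<rho>) * g_rate k - \<rho> - (real k - \<rho>) / (1 + \<rho>)"
    unfolding V right_diff_distrib using r by (simp add: power2_eq_square)
  moreover have "phi \<rho> * hat \<rho> k + (real k - \<rho>) / (1 + \<rho>) = real k - \<rho>"
  proof -
    have "phi \<rho> * hat \<rho> k + (real k - \<rho>) / (1 + \<rho>) = ((1 + \<rho>) * (real k - \<rho>)) / (1 + \<rho>)"
      unfolding phi_def hat_def distrib_right add_divide_distrib by simp
    then show ?thesis using r by simp
  qed
  moreover have "g_rate k * (real k - 1 - \<rho>) = real k - (1 + \<rho>) * g_rate k"
    using gk by (simp add: algebra_simps)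
  ultimately show ?thesis
    unfolding ghat_def left_diff_distrib minus_mult_left[symmetric] by linarith
qed

text \<open>Summation by parts, used to replace a rate by its average over \<open>m\<close> sites at
  the price of gradients.\<close>

lemma abel_sum:
  fixes G :: "nat \<Rightarrow> real"
  assumes "1 \<le> m"
  shows "(\<Sum>j=1..<m. (real m - real j) * (G j - G (Suc j))) = real m * G 1 - (\<Sum>j=1..m. G j)"
  using assms
proof (induction m rule: dec_induct)
  case (step m)
  have tele: "(\<Sum>j=1..<m. G j - G (Suc j)) = G 1 - G m"
    using step.hyps by (induction m rule: dec_induct) auto
  have "(\<Sum>j=1..<Suc m. (real (Suc m) - real j) * (G j - G (Suc j)))
     = (\<Sum>j=1..<m. (real m - real j) * (G j - G (Suc j))) + (\<Sum>j=1..<m. G j - G (Suc j)) + (G m - G (Suc m))"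
    using step.hyps by (simp add: sum.distrib[symmetric] algebra_simps)
  also have "\<dots> = real (Suc m) * G 1 - (\<Sum>j=1..Suc m. G j)"
    unfolding tele step.IH using step.hyps by (simp add: algebra_simps)
  finally show ?case .
qed simp

text \<open>\<open>A + int K \<le> R\<close> keeps all averaging windows off the seam, so that
  \<open>rnext\<close> is the right neighbour wherever the weights do not vanish.\<close>

lemma Vg_decomposition:
  assumes \<rho>: "0 < \<rho>" and K: "1 \<le> K" and A: "0 \<le> A" and AR: "A + int K \<le> R"
    and supp: "\<And>x. x \<notin> {-A..A} \<Longrightarrow> a x = 0"
  shows "(\<Sum>x\<in>{-A..A}. a x * Vg \<rho> (c x)) = cur R (pot \<rho> K a) c + rem \<rho> K A a c"
proof -
  define \<kappa> where "\<kappa> j = 1 - real j / real K" for j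
  define G where "G x = g_rate (c x)" for x
  define u where "u x = a x * hat \<rho> (c x)" for x
  have cancel: "(g * (- P / s) - g' * (- P' / s)) * - s = g * P - g' * P'"
    if "s \<noteq> 0" for g g' P P' s :: real using that by (simp add: field_simps)
  have solve: "V = X + - U / (k * s)" if "X * - s = - s * V - U / k" "s \<noteq> 0" "k \<noteq> 0" for X U V k s :: real
  proof -
    have "s * (V - (X + - U / (k * s))) = 0" using that by (simp add: field_simps)
    then show ?thesis using that by simp
  qed
  have R: "1 \<le> R" using K A AR by simp
  \<comment> \<open>\<open>bk R y\<close> changes only \<open>y\<close> and
    \<open>rnext R y\<close>, while \<open>Psi\<close> looks strictly to the left of
    \<open>y\<close>. It can meet the second site only across the seam, where \<open>a\<close>
    vanishes.\<close>
  have Psi_bk: "Psi \<rho> K a y (bk R y c) = Psi \<rho> K a y c" if "y \<in> {-R..R}" for y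
    unfolding Psi_def
  proof (intro sum.cong refl)
    fix j assume j: "j \<in> {1..<K}"
    show "(1 - real j / real K) * (a (y - int j) * hat \<rho> (bk R y c (y - int j)))
        = (1 - real j / real K) * (a (y - int j) * hat \<rho> (c (y - int j)))"
    proof (cases "y - int j = rnext R y")
      case True
      then have "y - int j = - R" using j by (auto simp: rnext_def split: if_splits)
      then have "y - int j \<notin> {-A..A}" using AR K by auto
      then show ?thesis by (simp add: supp)
    qed (use j in \<open>auto simp: bk_def\<close>)
  qed
  have pot_bk: "pot \<rho> K a y (bk R y c) = - (u y + Psi \<rho> K a y c) / (1 + \<rho>)" if "y \<in> {-R..R}" for y
    unfolding pot_def Psi_bk[OF that] u_def by (simp add: bk_def hat_def)
  have "cur R (pot \<rho> K a) c * (- (1 + \<rho>)) = (\<Sum>y\<in>{-R..R}.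
      a y * (G y * (real (c y) - 1 - \<rho>) - G (rnext R y) * hat \<rho> (c y))
      + (G y - G (rnext R y)) * Psi \<rho> K a y c)"
    unfolding cur_def sum_distrib_right
  proof (intro sum.cong refl)
    fix y assume y: "y \<in> {-R..R}"
    have r: "1 + \<rho> \<noteq> 0" using \<rho> by simp
    show "(g_rate (c y) * pot \<rho> K a y c - g_rate (c (rnext R y)) * pot \<rho> K a y (bk R y c)) * - (1 + \<rho>) =
         a y * (G y * (real (c y) - 1 - \<rho>) - G (rnext R y) * hat \<rho> (c y)) + (G y - G (rnext R y)) * Psi \<rho> K a y c"
      unfolding pot_bk[OF y] unfolding pot_def G_def u_def cancel[OF r]
      by (simp add: algebra_simps)
  qed
  also have "\<dots> = (\<Sum>y\<in>{-R..R}. a y * (- (1 + \<rho>) * Vg \<rho> (c y) - ghat \<rho> (c (rnext R y)) * hat \<rho> (c y)))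
      + (\<Sum>y\<in>{-R..R}. (G y - G (rnext R y)) * Psi \<rho> K a y c)"
    unfolding G_def Vg_identity[OF \<rho>] by (rule sum.distrib)
  also have "(\<Sum>y\<in>{-R..R}. a y * (- (1 + \<rho>) * Vg \<rho> (c y) - ghat \<rho> (c (rnext R y)) * hat \<rho> (c y)))
      = (\<Sum>x\<in>{-A..A}. a x * (- (1 + \<rho>) * Vg \<rho> (c x) - ghat \<rho> (c (x + 1)) * hat \<rho> (c x)))"
    using AR K by (intro sum.mono_neutral_cong_right) (auto simp: supp rnext_def)
  also have "\<dots> = - (1 + \<rho>) * (\<Sum>x\<in>{-A..A}. a x * Vg \<rho> (c x)) - (\<Sum>x\<in>{-A..A}. u x * ghat \<rho> (c (x + 1)))"
    unfolding sum_distrib_left sum_subtractf[symmetric] u_def by (simp add: algebra_simps)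
  \<comment> \<open>Regrouped by the source site \<open>x = y - j\<close>, the gradients to the
    right of \<open>x\<close> sum by parts to the rate at \<open>x + 1\<close> minus its
    average.\<close>
  also have "(\<Sum>y\<in>{-R..R}. (G y - G (rnext R y)) * Psi \<rho> K a y c)
      = (\<Sum>x\<in>{-A..A}. u x * (ghat \<rho> (c (x + 1)) - (\<Sum>j=1..K. ghat \<rho> (c (x + int j))) / K))"
  proof -
    have "(\<Sum>y\<in>{-R..R}. (G y - G (rnext R y)) * Psi \<rho> K a y c)
        = (\<Sum>j=1..<K. \<Sum>y\<in>{-R..R}. \<kappa> j * (u (y - int j) * (G y - G (rnext R y))))"
      unfolding Psi_def sum_distrib_left by (subst sum.swap) (simp add: \<kappa>_def u_def mult_ac)
    also have "\<dots> = (\<Sum>j=1..<K. \<Sum>x\<in>{-A..A}. \<kappa> j * (u x * (G (x + int j) - G (x + int j + 1))))"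
    proof (rule sum.cong[OF refl])
      fix j assume j: "j \<in> {1..<K}"
      have "(\<Sum>y\<in>{-R..R}. \<kappa> j * (u (y - int j) * (G y - G (rnext R y))))
         = (\<Sum>y\<in>{-A+int j..A+int j}. \<kappa> j * (u (y - int j) * (G y - G (y + 1))))"
        using AR j by (intro sum.mono_neutral_cong_right) (auto simp: supp rnext_def u_def)
      also have "\<dots> = (\<Sum>x\<in>{-A..A}. \<kappa> j * (u x * (G (x + int j) - G (x + int j + 1))))"
        by (rule sum.reindex_bij_witness[of _ "\<lambda>x. x + int j" "\<lambda>y. y - int j"]) auto
      finally show "(\<Sum>y\<in>{-R..R}. \<kappa> j * (u (y - int j) * (G y - G (rnext R y))))
         = (\<Sum>x\<in>{-A..A}. \<kappa> j * (u x * (G (x + int j) - G (x + int j + 1))))" .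
    qed
    also have "\<dots> = (\<Sum>x\<in>{-A..A}. u x * (\<Sum>j=1..<K. \<kappa> j * (G (x + int j) - G (x + int j + 1))))"
      unfolding sum_distrib_left by (subst sum.swap) (simp add: mult_ac)
    also have "\<dots> = (\<Sum>x\<in>{-A..A}. u x * (ghat \<rho> (c (x + 1)) - (\<Sum>j=1..K. ghat \<rho> (c (x + int j))) / K))"
    proof (rule sum.cong[OF refl], rule arg_cong2[of _ _ _ _ "(*)", OF refl])
      fix x
      have "(\<Sum>j=1..<K. \<kappa> j * (G (x + int j) - G (x + int j + 1)))
          = (\<Sum>j=1..<K. (real K - real j) * (ghat \<rho> (c (x + int j)) - ghat \<rho> (c (x + int (Suc j))))) / K"
        unfolding sum_divide_distrib using K
        by (intro sum.cong refl) (simp add: \<kappa>_def G_def ghat_def field_simps)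
      also have "\<dots> = ghat \<rho> (c (x + 1)) - (\<Sum>j=1..K. ghat \<rho> (c (x + int j))) / K"
        unfolding abel_sum[OF K, of "\<lambda>j. ghat \<rho> (c (x + int j))"] using K by (simp add: field_simps)
      finally show "(\<Sum>j=1..<K. \<kappa> j * (G (x + int j) - G (x + int j + 1)))
         = ghat \<rho> (c (x + 1)) - (\<Sum>j=1..K. ghat \<rho> (c (x + int j))) / K" .
    qed
    finally show ?thesis .
  qed
  also have "- (1 + \<rho>) * (\<Sum>x\<in>{-A..A}. a x * Vg \<rho> (c x)) - (\<Sum>x\<in>{-A..A}. u x * ghat \<rho> (c (x + 1)))
      + (\<Sum>x\<in>{-A..A}. u x * (ghat \<rho> (c (x + 1)) - (\<Sum>j=1..K. ghat \<rho> (c (x + int j))) / K))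
    = - (1 + \<rho>) * (\<Sum>x\<in>{-A..A}. a x * Vg \<rho> (c x)) - (\<Sum>x\<in>{-A..A}. \<Sum>j=1..K. u x * ghat \<rho> (c (x + int j))) / K"
    by (simp add: right_diff_distrib sum_subtractf sum_distrib_left sum_divide_distrib)
  finally have "cur R (pot \<rho> K a) c * (- (1 + \<rho>))
     = - (1 + \<rho>) * (\<Sum>x\<in>{-A..A}. a x * Vg \<rho> (c x)) - (\<Sum>x\<in>{-A..A}. \<Sum>j=1..K. u x * ghat \<rho> (c (x + int j))) / K" .
  moreover have "1 + \<rho> \<noteq> 0" "real K \<noteq> 0" using \<rho> K by auto
  ultimately show ?thesis
    unfolding rem_def u_def by (intro solve)
qed

section \<open>Riemann sums of right-continuous step functions\<close>

text \<open>Dominated convergence for the counting measure: the window grows while the summands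
  change.\<close>

lemma tannery_int:
  fixes f :: "nat \<Rightarrow> int \<Rightarrow> real" and g b :: "int \<Rightarrow> real"
  assumes b: "b summable_on UNIV" and le: "\<And>j x. \<bar>f j x\<bar> \<le> b x" and gle: "\<And>x. \<bar>g x\<bar> \<le> b x"
    and lim: "\<And>x. (\<lambda>j. f j x) \<longlonglongrightarrow> g x"
  shows "(\<lambda>j. \<Sum>x\<in>{-int j..int j}. f j x) \<longlonglongrightarrow> (\<Sum>\<^sub>\<infinity>x. g x)"
proof -
  define h where "h j x = (if x \<in> {-int j..int j} then f j x else 0)" for j x
  have bpos: "0 \<le> b x" for x using le[of 0 x] by linarith
  have "integrable (count_space UNIV) b"
    using b bpos abs_summable_equivalent[of b UNIV] by (simp add: abs_summable_on_def)
  moreover have "(\<lambda>j. h j x) \<longlonglongrightarrow> g x" for x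
  proof (rule Lim_transform_eventually[OF lim[of x]])
    show "eventually (\<lambda>j. f j x = h j x) sequentially"
      using eventually_ge_at_top[of "nat \<bar>x\<bar>"] by eventually_elim (auto simp: h_def)
  qed
  moreover have "\<bar>h j x\<bar> \<le> b x" for j x using le[of j x] bpos[of x] by (auto simp: h_def)
  ultimately have "(\<lambda>j. \<integral>x. h j x \<partial>count_space UNIV) \<longlonglongrightarrow> (\<integral>x. g x \<partial>count_space UNIV)"
    by (intro integral_dominated_convergence[where w = b]) auto
  moreover have "(\<integral>x. h j x \<partial>count_space UNIV) = (\<Sum>x\<in>{-int j..int j}. f j x)" for j
  proof -
    have "(\<integral>x. h j x \<partial>count_space UNIV) = (\<Sum>x | x \<in> UNIV \<and> h j x \<noteq> 0. h j x)"
      by (rule lebesgue_integral_count_space_finite_support)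
         (rule finite_subset[of _ "{-int j..int j}"], auto simp: h_def split: if_splits)
    also have "\<dots> = (\<Sum>x\<in>{-int j..int j}. f j x)"
      by (rule sum.mono_neutral_cong_left) (auto simp: h_def split: if_splits)
    finally show ?thesis .
  qed
  moreover have "(\<integral>x. g x \<partial>count_space UNIV) = (\<Sum>\<^sub>\<infinity>x. g x)"
  proof -
    have "(\<lambda>x. norm (g x)) summable_on UNIV"
      by (rule summable_on_comparison_test[OF b]) (use gle in auto)
    then have "Infinite_Set_Sum.abs_summable_on g UNIV" by (rule abs_summable_equivalent[THEN iffD1])
    then show ?thesis using infsetsum_infsum[of g UNIV] by (simp add: infsetsum_def)
  qed
  ultimately show ?thesis by simp
qed

text \<open>The ceiling is constant on cells open on the left and closed on the right, so it selects
  right endpoints.\<close>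

lemma ceiling_step_integral:
  fixes G :: "int \<Rightarrow> real" and m :: nat
  assumes t: "0 < t" and m: "1 \<le> m"
  shows "(\<integral>s. indicator {0<..t} s * G \<lceil>s * real m / t\<rceil> \<partial>lborel) = (t / real m) * (\<Sum>l=1..m. G (int l))"
proof -
  define h where "h = t / real m"
  have h: "0 < h" using t m by (simp add: h_def)
  have mh: "real m * h = t" using m by (simp add: h_def)
  define I where "I l = {real l * h - h<..real l * h}" for l :: nat
  have ceil: "s \<in> I l \<longleftrightarrow> \<lceil>s * real m / t\<rceil> = int l" for s l
  proof -
    have "s * real m / t = s / h" using t m by (simp add: h_def)
    moreover have "\<lceil>s / h\<rceil> = int l \<longleftrightarrow> s \<in> I l"
      using h by (auto simp: I_def ceiling_eq_iff field_simps)
    ultimately show ?thesis by simp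
  qed
  have "indicator {0<..t} s * G \<lceil>s * real m / t\<rceil> = (\<Sum>l=1..m. G (int l) * indicator (I l) s)" for s
  proof (cases "s \<in> {0<..t}")
    case True
    define k where "k = nat \<lceil>s * real m / t\<rceil>"
    have pos: "0 < s * real m / t" using True m t by simp
    have le: "s * real m / t \<le> real m" using True t m by (simp add: field_simps)
    have k: "\<lceil>s * real m / t\<rceil> = int k" "k \<in> {1..m}"
      using pos le by (auto simp: k_def ceiling_le_iff nat_le_iff) linarith+
    have "(\<Sum>l=1..m. G (int l) * indicator (I l) s) = (\<Sum>l=1..m. if l = k then G (int l) else 0)"
      by (intro sum.cong refl) (auto simp: ceil k indicator_def)
    then show ?thesis using True k by (simp add: sum.delta)
  next
    case False
    have "s \<notin> I l" if "l \<in> {1..m}" for l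
    proof
      assume "s \<in> I l"
      then have "real l * h - h < s" "s \<le> real l * h" by (auto simp: I_def)
      moreover have "real l * h \<le> t" using that h unfolding mh[symmetric] by (intro mult_right_mono) auto
      moreover have "1 * h \<le> real l * h" using that h by (intro mult_right_mono) auto
      ultimately have "0 < s" "s \<le> t" by linarith+
      then show False using False by simp
    qed
    then have "(\<Sum>l=1..m. G (int l) * indicator (I l) s) = 0"
      by (intro sum.neutral) auto
    then show ?thesis using False by simp
  qed
  then have "(\<integral>s. indicator {0<..t} s * G \<lceil>s * real m / t\<rceil> \<partial>lborel) = (\<integral>s. (\<Sum>l=1..m. G (int l) * indicator (I l) s) \<partial>lborel)"
    by simp
  also have "\<dots> = (\<Sum>l=1..m. G (int l) * measure lborel (I l))"
  proof -
    have int: "integrable lborel (indicator (I l) :: real \<Rightarrow> real)" for l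
      unfolding I_def using h by (intro integrable_real_indicator) auto
    show ?thesis
      using int by (subst Bochner_Integration.integral_sum) (auto simp: I_def)
  qed
  also have "\<dots> = h * (\<Sum>l=1..m. G (int l))"
    using h by (simp add: I_def sum_distrib_left mult.commute)
  finally show ?thesis unfolding h_def .
qed

text \<open>Right endpoints matter: the sample points approach \<open>s\<close> from the right,
  where a right-continuous step function is constant, so the samples are eventually exact. The bound
  \<open>b\<close>, uniform in time, dominates both the sum and the integral.\<close>

lemma riemann_sums_converge:
  fixes \<phi> :: "int \<Rightarrow> real \<Rightarrow> real" and b :: "int \<Rightarrow> real" and m :: "nat \<Rightarrow> nat"
  assumes t: "0 < t" and m1: "\<And>j. 1 \<le> m j" and m: "filterlim (\<lambda>j. real (m j)) at_top sequentially"
    and rc: "\<And>x s. 0 \<le> s \<Longrightarrow> \<exists>e>s. \<forall>r. s \<le> r \<longrightarrow> r < e \<longrightarrow> \<phi> x r = \<phi> x s"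
    and le: "\<And>x s. 0 \<le> s \<Longrightarrow> s \<le> t \<Longrightarrow> \<bar>\<phi> x s\<bar> \<le> b x" and b: "b summable_on UNIV"
  shows "(\<lambda>j. (t / real (m j)) * (\<Sum>l=1..m j. \<Sum>x\<in>{-int j..int j}. \<phi> x (real l * (t / real (m j)))))
     \<longlonglongrightarrow> (LBINT s=0..t. (\<Sum>\<^sub>\<infinity>x. \<phi> x s))"
proof -
  have bpos: "0 \<le> b x" for x using le[of 0 x] t by linarith
  \<comment> \<open>The right endpoint of the grid cell containing \<open>s\<close>.\<close>
  define c where "c j s = real_of_int \<lceil>s * real (m j) / t\<rceil> * (t / real (m j))" for j s
  define S where "S j s = indicator {0<..t} s * (\<Sum>x\<in>{-int j..int j}. \<phi> x (c j s))" for j s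
  define F where "F s = indicator {0<..t} s * (\<Sum>\<^sub>\<infinity>x. \<phi> x s)" for s
  have mpos: "0 < real (m j)" for j using m1[of j] by simp
  have c_ge: "s \<le> c j s" for j s
  proof -
    have "s = (s * real (m j) / t) * (t / real (m j))" using t mpos[of j] by simp
    also have "\<dots> \<le> c j s" unfolding c_def using t mpos[of j] by (intro mult_right_mono) auto
    finally show ?thesis .
  qed
  have c_le: "c j s \<le> t" if "s \<le> t" for j s
  proof -
    have "\<lceil>s * real (m j) / t\<rceil> \<le> int (m j)" using that t mpos[of j] by (simp add: ceiling_le_iff field_simps)
    then have "c j s \<le> real (m j) * (t / real (m j))"
      unfolding c_def using t mpos[of j] by (intro mult_right_mono) (auto simp: of_int_le_iff[symmetric, where 'a = real] simp del: of_int_le_iff)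
    then show ?thesis using mpos[of j] by simp
  qed
  have c_less: "c j s < s + t / real (m j)" for j s
  proof -
    have "c j s < (s * real (m j) / t + 1) * (t / real (m j))"
      unfolding c_def using t mpos[of j] by (intro mult_strict_right_mono) (auto simp: of_int_ceiling_le_add_one less_add_one ceiling_less_iff, linarith)
    also have "\<dots> = s + t / real (m j)" using t mpos[of j] by (simp add: field_simps)
    finally show ?thesis .
  qed
  have small: "(\<lambda>j. t / real (m j)) \<longlonglongrightarrow> 0"
    by (intro real_tendsto_divide_at_top[OF tendsto_const m])
  have pt: "(\<lambda>j. S j s) \<longlonglongrightarrow> F s" for s
  proof (cases "s \<in> {0<..t}")
    case True
    have "(\<lambda>j. \<Sum>x\<in>{-int j..int j}. \<phi> x (c j s)) \<longlonglongrightarrow> (\<Sum>\<^sub>\<infinity>x. \<phi> x s)"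
    proof (rule tannery_int[OF b])
      show "\<bar>\<phi> x (c j s)\<bar> \<le> b x" for j x
        by (rule le) (use True c_ge[of s j] c_le[of s j] in auto)
      show "\<bar>\<phi> x s\<bar> \<le> b x" for x using le[of s x] True by auto
      show "(\<lambda>j. \<phi> x (c j s)) \<longlonglongrightarrow> \<phi> x s" for x
      proof -
        obtain e where e: "e > s" "\<forall>r. s \<le> r \<longrightarrow> r < e \<longrightarrow> \<phi> x r = \<phi> x s" using rc[of s x] True by auto
        have "eventually (\<lambda>j. t / real (m j) < e - s) sequentially"
          using small e(1) by (intro order_tendstoD) auto
        then have "eventually (\<lambda>j. \<phi> x (c j s) = \<phi> x s) sequentially"
        proof eventually_elim
          case (elim j)
          show ?case by (rule e(2)[rule_format, OF c_ge]) (use c_less[of j s] elim in linarith)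
        qed
        then show ?thesis by (rule tendsto_eventually)
      qed
    qed
    then show ?thesis unfolding S_def F_def by (intro tendsto_mult tendsto_const)
  qed (simp add: S_def F_def)
  have meas: "S j \<in> borel_measurable lborel" for j
  proof -
    have "(\<lambda>s. \<phi> x (real_of_int \<lceil>s * real (m j) / t\<rceil> * (t / real (m j)))) \<in> borel_measurable lborel" for x
      by (rule measurable_compose[where N = "count_space UNIV" and f = "\<lambda>s. \<lceil>s * real (m j) / t\<rceil>"
            and g = "\<lambda>k. \<phi> x (real_of_int k * (t / real (m j)))"]) auto
    then show ?thesis unfolding S_def c_def by measurable
  qed
  have lim: "(\<lambda>j. \<integral>s. S j s \<partial>lborel) \<longlonglongrightarrow> (\<integral>s. F s \<partial>lborel)"
  proof (rule integral_dominated_convergence[where w = "\<lambda>s. indicator {0<..t} s * infsum b UNIV"])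
    show "F \<in> borel_measurable lborel" by (rule borel_measurable_LIMSEQ_real[OF pt meas])
    show "integrable lborel (\<lambda>s. indicator {0<..t} s * infsum b UNIV)"
      using t by (intro integrable_mult_left) auto
    show "AE s in lborel. norm (S j s) \<le> indicator {0<..t} s * infsum b UNIV" for j
    proof (rule AE_I2)
      fix s
      show "norm (S j s) \<le> indicator {0<..t} s * infsum b UNIV"
      proof (cases "s \<in> {0<..t}")
        case True
        have "\<bar>\<Sum>x\<in>{-int j..int j}. \<phi> x (c j s)\<bar> \<le> (\<Sum>x\<in>{-int j..int j}. b x)"
          by (intro order_trans[OF sum_abs] sum_mono le) (use True c_ge[of s j] c_le[of s j] in auto)
        also have "\<dots> \<le> infsum b UNIV" by (rule finite_sum_le_infsum[OF b]) (use bpos in auto)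
        finally show ?thesis using True by (simp add: S_def)
      qed (simp add: S_def)
    qed
  qed (use meas pt in auto)
  have "(\<integral>s. S j s \<partial>lborel) = (t / real (m j)) * (\<Sum>l=1..m j. \<Sum>x\<in>{-int j..int j}. \<phi> x (real l * (t / real (m j))))" for j
    using ceiling_step_integral[OF t m1[of j], of "\<lambda>k. \<Sum>x\<in>{-int j..int j}. \<phi> x (real_of_int k * (t / real (m j)))"]
    unfolding S_def c_def by simp
  moreover have "(\<integral>s. F s \<partial>lborel) = (LBINT s=0..t. (\<Sum>\<^sub>\<infinity>x. \<phi> x s))"
    using t unfolding F_def by (simp add: zero_ereal_def interval_integral_Ioc set_lebesgue_integral_def)
  ultimately show ?thesis using lim by simp
qed

section \<open>Variances under the invariant measure\<close>

locale tazrp_process =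
  fixes M :: "'a measure" and \<rho> :: real and \<eta> :: "'a \<Rightarrow> real \<Rightarrow> int \<Rightarrow> nat"
    and N :: "'a \<Rightarrow> int \<Rightarrow> real \<Rightarrow> nat"
  assumes tazrp: "tazrp M \<rho> \<eta> N" and rho_pos: "0 < \<rho>"

sublocale tazrp_process \<subseteq> prob_space M
  using tazrp by (simp add: tazrp_def)

section \<open>Moments of the geometric marginals\<close>

lemma summable_square_geometric:
  fixes z :: real
  assumes "norm z < 1"
  shows "summable (\<lambda>n. (real n)\<^sup>2 * z ^ n)"
proof -
  have 1: "summable (\<lambda>n. diffs (\<lambda>_. 1) n * x ^ n)" if "norm x < 1" for x :: real
    using that by (intro termdiff_converges[of x 1]) (auto intro: summable_geometric)
  have "summable (\<lambda>n. diffs (diffs (\<lambda>_. 1)) n * (norm z) ^ n)"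
    using assms 1 by (intro termdiff_converges[of _ 1]) auto
  then show ?thesis
  proof (rule summable_comparison_test'[where N = 0])
    fix n :: nat
    \<comment> \<open>Differentiating the geometric series twice produces the coefficients
      \<open>(n + 1) * (n + 2)\<close>.\<close>
    have "(real n)\<^sup>2 \<le> diffs (diffs (\<lambda>_. 1)) n"
      by (simp add: diffs_def power2_eq_square algebra_simps)
    then show "norm ((real n)\<^sup>2 * z ^ n) \<le> diffs (diffs (\<lambda>_. 1)) n * (norm z) ^ n"
      by (simp add: abs_mult power_abs mult_right_mono)
  qed
qed

lemma integrable_square_geometric_pmf:
  assumes p: "p \<in> {0<..1}"
  shows "integrable (geometric_pmf p) (\<lambda>n. (real n)\<^sup>2)"
proof -
  have "summable (\<lambda>n. p * ((real n)\<^sup>2 * (1 - p) ^ n))"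
    using p by (intro summable_mult summable_square_geometric) auto
  then have "summable (\<lambda>n. (1 - p) ^ n * p * (real n)\<^sup>2)"
    by (simp add: algebra_simps)
  then show ?thesis
    unfolding measure_pmf_eq_density using p
    by (subst integrable_density)
       (auto simp: integrable_count_space_nat_iff abs_mult)
qed

definition geo :: "real \<Rightarrow> nat pmf" where
  "geo \<rho> = geometric_pmf (1 / (1 + \<rho>))"

abbreviation Egeo :: "real \<Rightarrow> (nat \<Rightarrow> real) \<Rightarrow> real" where
  "Egeo \<rho> \<equiv> measure_pmf.expectation (geo \<rho>)"

definition vr :: "real \<Rightarrow> real" where
  "vr \<rho> = Egeo \<rho> (\<lambda>k. (hat \<rho> k)\<^sup>2)"

lemma pmf_geo: "0 < \<rho> \<Longrightarrow> pmf (geo \<rho>) k = nu_marg \<rho> k"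
  unfolding geo_def nu_marg_def by (simp add: field_simps power_divide)

lemma integrable_geo_bound:
  assumes "0 < \<rho>" and b: "\<And>k. \<bar>F k\<bar> \<le> C * (1 + (hat \<rho> k)\<^sup>2)"
  shows "integrable (geo \<rho>) (F :: nat \<Rightarrow> real)"
proof (rule Bochner_Integration.integrable_bound)
  have p: "1 / (1 + \<rho>) \<in> {0<..1}" using assms by auto
  have "integrable (geo \<rho>) (\<lambda>k. (real k)\<^sup>2)" "integrable (geo \<rho>) real"
    unfolding geo_def using integrable_square_geometric_pmf[OF p] integrable_real_geometric_pmf[OF p] by auto
  then show "integrable (geo \<rho>) (\<lambda>k. C * (1 + ((real k)\<^sup>2 - 2 * \<rho> * real k + \<rho>\<^sup>2)))" by auto
  show "AE k in geo \<rho>. norm (F k) \<le> norm (C * (1 + ((real k)\<^sup>2 - 2 * \<rho> * real k + \<rho>\<^sup>2)))"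
  proof (rule AE_I2)
    fix k
    have "1 + ((real k)\<^sup>2 - 2 * \<rho> * real k + \<rho>\<^sup>2) = 1 + (hat \<rho> k)\<^sup>2"
      by (simp add: hat_def power2_diff)
    then show "norm (F k) \<le> norm (C * (1 + ((real k)\<^sup>2 - 2 * \<rho> * real k + \<rho>\<^sup>2)))"
      using b[of k] by (simp only: real_norm_def)
  qed
qed simp

lemma abs_ghat_le: "0 < \<rho> \<Longrightarrow> \<bar>ghat \<rho> k\<bar> \<le> 1"
  by (auto simp: ghat_def g_rate_def phi_def field_simps abs_if)

lemma abs_le_one_plus_square: "\<bar>x\<bar> \<le> 1 + (x::real)\<^sup>2"
  using zero_le_power2[of "\<bar>x\<bar> - 1"] by (simp add: power2_diff)

lemma expectation_hat: "0 < \<rho> \<Longrightarrow> Egeo \<rho> (hat \<rho>) = 0"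
proof -
  assume r: "0 < \<rho>"
  then have p: "1 / (1 + \<rho>) \<in> {0<..1}" by auto
  have "Egeo \<rho> (\<lambda>k. real k - \<rho>) = Egeo \<rho> real - \<rho>"
    unfolding geo_def using integrable_real_geometric_pmf[OF p]
    by (subst Bochner_Integration.integral_diff) auto
  also have "\<dots> = 0" unfolding geo_def expectation_geometric_pmf[OF p] using r by (simp add: field_simps)
  finally show ?thesis by (simp add: hat_def[abs_def])
qed

lemma expectation_ghat: "0 < \<rho> \<Longrightarrow> Egeo \<rho> (ghat \<rho>) = 0"
proof -
  assume r: "0 < \<rho>"
  have "Egeo \<rho> (ghat \<rho>)
    = Egeo \<rho> (\<lambda>k. (1 - phi \<rho>) - indicator {0} k)"
    by (intro Bochner_Integration.integral_cong) (auto simp: ghat_def g_rate_def indicator_def)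
  also have "\<dots> = (1 - phi \<rho>) - measure_pmf.prob (geo \<rho>) {0}"
    by (subst Bochner_Integration.integral_diff) (auto intro!: measure_pmf.integrable_const_bound[where B = 1])
  also have "measure_pmf.prob (geo \<rho>) {0} = nu_marg \<rho> 0" using r by (simp add: measure_pmf_single pmf_geo)
  finally show ?thesis using r by (simp add: phi_def nu_marg_def field_simps)
qed

lemma (in prob_space) orthogonal_sum_bound:
  fixes Z :: "'b \<Rightarrow> 'a \<Rightarrow> real"
  assumes "finite J"
    and int: "\<And>i j. i \<in> J \<Longrightarrow> j \<in> J \<Longrightarrow> integrable M (\<lambda>w. Z i w * Z j w)"
    and orth: "\<And>i j. i \<in> J \<Longrightarrow> j \<in> J \<Longrightarrow> i \<noteq> j \<Longrightarrow> (\<integral>w. Z i w * Z j w \<partial>M) = 0"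
    and var: "\<And>i. i \<in> J \<Longrightarrow> (\<integral>w. Z i w * Z i w \<partial>M) \<le> v"
  shows "integrable M (\<lambda>w. (\<Sum>i\<in>J. b i * Z i w)\<^sup>2)"
    and "(\<integral>w. (\<Sum>i\<in>J. b i * Z i w)\<^sup>2 \<partial>M) \<le> v * (\<Sum>i\<in>J. (b i)\<^sup>2)"
proof -
  have eq: "(\<Sum>i\<in>J. b i * Z i w)\<^sup>2 = (\<Sum>i\<in>J. \<Sum>j\<in>J. b i * b j * (Z i w * Z j w))" for w
    unfolding power2_eq_square sum_product by (simp add: mult_ac)
  show "integrable M (\<lambda>w. (\<Sum>i\<in>J. b i * Z i w)\<^sup>2)"
    unfolding eq by (intro Bochner_Integration.integrable_sum integrable_mult_right int)
  have "(\<integral>w. (\<Sum>i\<in>J. b i * Z i w)\<^sup>2 \<partial>M) = (\<Sum>i\<in>J. \<Sum>j\<in>J. b i * b j * (\<integral>w. Z i w * Z j w \<partial>M))"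
    unfolding eq using int
    by (simp add: Bochner_Integration.integral_sum Bochner_Integration.integrable_sum)
  also have "\<dots> = (\<Sum>i\<in>J. \<Sum>j\<in>J. if j = i then (b i)\<^sup>2 * (\<integral>w. Z i w * Z i w \<partial>M) else 0)"
    using orth by (intro sum.cong refl) (auto simp: power2_eq_square)
  also have "\<dots> = (\<Sum>i\<in>J. (b i)\<^sup>2 * (\<integral>w. Z i w * Z i w \<partial>M))"
    using \<open>finite J\<close> by (simp add: sum.delta')
  also have "\<dots> \<le> (\<Sum>i\<in>J. (b i)\<^sup>2 * v)" by (intro sum_mono mult_left_mono var) auto
  finally show "(\<integral>w. (\<Sum>i\<in>J. b i * Z i w)\<^sup>2 \<partial>M) \<le> v * (\<Sum>i\<in>J. (b i)\<^sup>2)"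
    by (simp add: sum_distrib_left mult.commute)
qed

context tazrp_process begin

section \<open>Product structure of the initial configuration\<close>

lemma measurable_eta [measurable]: "(\<lambda>w. \<eta> w t x) \<in> measurable M (count_space UNIV)"
  using tazrp by (simp add: tazrp_def)

lemma law_eta0: "finite S \<Longrightarrow> prob {w \<in> space M. \<forall>x\<in>S. \<eta> w 0 x = k x} = (\<Prod>x\<in>S. nu_marg \<rho> (k x))"
  using tazrp by (simp add: tazrp_def)

lemma distr_eta0: "distr M (count_space UNIV) (\<lambda>w. \<eta> w 0 x) = measure_pmf (geo \<rho>)"
proof (rule measure_eqI_countable[where A = UNIV])
  fix k :: nat
  have "(\<lambda>w. \<eta> w 0 x) -` {k} \<inter> space M = {w \<in> space M. \<forall>x\<in>{x}. \<eta> w 0 x = k}" by auto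
  then have "emeasure (distr M (count_space UNIV) (\<lambda>w. \<eta> w 0 x)) {k} = ennreal (nu_marg \<rho> k)"
    using law_eta0[of "{x}" "\<lambda>_. k"] by (subst emeasure_distr) (auto simp: emeasure_eq_measure)
  then show "emeasure (distr M (count_space UNIV) (\<lambda>w. \<eta> w 0 x)) {k} = emeasure (measure_pmf (geo \<rho>)) {k}"
    by (simp add: emeasure_pmf_single pmf_geo rho_pos)
qed auto

lemma integrable_eta0: "integrable (geo \<rho>) F \<Longrightarrow> integrable M (\<lambda>w. F (\<eta> w 0 x) :: real)"
  using integrable_distr[of "\<lambda>w. \<eta> w 0 x" M "count_space UNIV" F] by (simp add: distr_eta0)

lemma expectation_eta0: "(\<integral>w. F (\<eta> w 0 x) \<partial>M) = Egeo \<rho> (F :: nat \<Rightarrow> real)"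
  using integral_distr[of "\<lambda>w. \<eta> w 0 x" M "count_space UNIV" F] by (simp add: distr_eta0)

lemma prob_eta0: "prob {w \<in> space M. \<eta> w 0 x = k} = nu_marg \<rho> k"
  using law_eta0[of "{x}" "\<lambda>_. k"] by simp

text \<open>The definition gives only the probabilities of prescribing finitely many occupation
  numbers. Singletons with the empty and the full set form a generating pi-system, on which these
  probabilities decide independence.\<close>

lemma indep_eta0:
  assumes "finite I" "I \<noteq> {}"
  shows "indep_vars (\<lambda>_. count_space UNIV) (\<lambda>x w. \<eta> w 0 x) I"
proof -
  define E :: "nat set set" where "E = {{}, UNIV} \<union> range (\<lambda>k. {k})"
  have sets: "sets (count_space UNIV) = sigma_sets (space (count_space UNIV)) E"
  proof -
    have "X \<in> sigma_sets UNIV E" for X :: "nat set"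
    proof -
      have "(\<Union>k\<in>X. {k}) \<in> sigma_sets UNIV E"
        by (intro sigma_sets_UNION) (auto simp: E_def intro: sigma_sets.Basic)
      then show ?thesis by simp
    qed
    then show ?thesis by auto
  qed
  show ?thesis
  proof (subst indep_vars_finite[where E = "\<lambda>_. E"])
    show "Int_stable E" by (auto simp: Int_stable_def E_def)
    show "\<forall>A\<in>I \<rightarrow> E. prob (\<Inter>j\<in>I. (\<lambda>w. \<eta> w 0 j) -` A j \<inter> space M)
        = (\<Prod>j\<in>I. prob ((\<lambda>w. \<eta> w 0 j) -` A j \<inter> space M))"
    proof
      fix A assume A: "A \<in> I \<rightarrow> E"
      show "prob (\<Inter>j\<in>I. (\<lambda>w. \<eta> w 0 j) -` A j \<inter> space M)
        = (\<Prod>j\<in>I. prob ((\<lambda>w. \<eta> w 0 j) -` A j \<inter> space M))"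
      proof (cases "\<exists>j\<in>I. A j = {}")
        case True
        then obtain j where "j \<in> I" "A j = {}" by auto
        then have "(\<Inter>j\<in>I. (\<lambda>w. \<eta> w 0 j) -` A j \<inter> space M) = {}"
          "prob ((\<lambda>w. \<eta> w 0 j) -` A j \<inter> space M) = 0" by auto
        then show ?thesis using assms \<open>j \<in> I\<close> by (auto simp: prod_zero_iff)
      next
        case False
        \<comment> \<open>A full set imposes nothing; the remaining coordinates prescribe single
          values, to which \<open>law_eta0\<close> applies.\<close>
        define J where "J = {j\<in>I. A j \<noteq> UNIV}"
        have "finite J" using assms by (simp add: J_def)
        define k where "k j = (THE k. A j = {k})" for j
        have k: "A j = {k j}" if "j \<in> J" for j
        proof -
          have "A j \<in> E" "A j \<noteq> {}" "A j \<noteq> UNIV" using that A False by (auto simp: J_def)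
          then obtain m where "A j = {m}" by (auto simp: E_def)
          then show ?thesis by (simp add: k_def)
        qed
        have "(\<Inter>j\<in>I. (\<lambda>w. \<eta> w 0 j) -` A j \<inter> space M) = {w\<in>space M. \<forall>x\<in>J. \<eta> w 0 x = k x}"
        proof (intro set_eqI iffI)
          fix w assume w: "w \<in> (\<Inter>j\<in>I. (\<lambda>w. \<eta> w 0 j) -` A j \<inter> space M)"
          have "\<eta> w 0 j = k j" if "j \<in> J" for j
          proof -
            have "j \<in> I" using that by (simp add: J_def)
            then have "\<eta> w 0 j \<in> A j" using w by blast
            then show ?thesis using k[OF that] by simp
          qed
          then show "w \<in> {w\<in>space M. \<forall>x\<in>J. \<eta> w 0 x = k x}"
            using assms w by blast
        next
          fix w assume w: "w \<in> {w\<in>space M. \<forall>x\<in>J. \<eta> w 0 x = k x}"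
          have "\<eta> w 0 j \<in> A j" if "j \<in> I" for j
          proof (cases "j \<in> J")
            case True
            then show ?thesis using w k[OF True] by simp
          next
            case False
            then have "A j = UNIV" using that by (simp add: J_def)
            then show ?thesis by simp
          qed
          then show "w \<in> (\<Inter>j\<in>I. (\<lambda>w. \<eta> w 0 j) -` A j \<inter> space M)" using w by blast
        qed
        then have "prob (\<Inter>j\<in>I. (\<lambda>w. \<eta> w 0 j) -` A j \<inter> space M) = (\<Prod>x\<in>J. nu_marg \<rho> (k x))"
          using law_eta0[of J k] \<open>finite J\<close> by simp
        also have "\<dots> = (\<Prod>j\<in>J. prob ((\<lambda>w. \<eta> w 0 j) -` A j \<inter> space M))"
        proof (intro prod.cong refl)
          fix x assume "x \<in> J"
          then have "(\<lambda>w. \<eta> w 0 x) -` A x \<inter> space M = {w\<in>space M. \<eta> w 0 x = k x}"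
            using k[OF \<open>x \<in> J\<close>] by auto
          then show "nu_marg \<rho> (k x) = prob ((\<lambda>w. \<eta> w 0 x) -` A x \<inter> space M)"
            by (simp add: prob_eta0)
        qed
        also have "\<dots> = (\<Prod>j\<in>I. prob ((\<lambda>w. \<eta> w 0 j) -` A j \<inter> space M))"
          using assms by (intro prod.mono_neutral_left) (auto simp: J_def prob_space)
        finally show ?thesis .
      qed
    qed
  qed (use assms sets in \<open>auto simp: E_def\<close>)
qed

lemma expectation_prod_eta0:
  assumes I: "finite I" and F: "\<And>i. i \<in> I \<Longrightarrow> integrable (geo \<rho>) (F i :: nat \<Rightarrow> real)"
  shows "integrable M (\<lambda>w. \<Prod>i\<in>I. F i (\<eta> w 0 i))"
    and "(\<integral>w. (\<Prod>i\<in>I. F i (\<eta> w 0 i)) \<partial>M) = (\<Prod>i\<in>I. Egeo \<rho> (F i))"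
proof -
  have "integrable M (\<lambda>w. \<Prod>i\<in>I. F i (\<eta> w 0 i)) \<and>
    (\<integral>w. (\<Prod>i\<in>I. F i (\<eta> w 0 i)) \<partial>M) = (\<Prod>i\<in>I. Egeo \<rho> (F i))"
  proof (cases "I = {}")
    case False
    have ind: "indep_vars (\<lambda>_. borel) (\<lambda>i w. F i (\<eta> w 0 i)) I"
      by (rule indep_vars_compose2[OF indep_eta0[OF I False]]) auto
    show ?thesis
      using indep_vars_lebesgue_integral[OF I ind] indep_vars_integrable[OF I ind] integrable_eta0[OF F]
      by (simp add: expectation_eta0)
  qed (simp add: prob_space)
  then show "integrable M (\<lambda>w. \<Prod>i\<in>I. F i (\<eta> w 0 i))"
    and "(\<integral>w. (\<Prod>i\<in>I. F i (\<eta> w 0 i)) \<partial>M) = (\<Prod>i\<in>I. Egeo \<rho> (F i))"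
    by auto
qed

lemma integrable_hat2: "integrable (geo \<rho>) (\<lambda>k. (hat \<rho> k)\<^sup>2)"
  by (rule integrable_geo_bound[OF rho_pos, of _ 1]) simp

lemma hat_hat:
  shows "integrable M (\<lambda>w. hat \<rho> (\<eta> w 0 x) * hat \<rho> (\<eta> w 0 y))"
    and "(\<integral>w. hat \<rho> (\<eta> w 0 x) * hat \<rho> (\<eta> w 0 y) \<partial>M) = (if x = y then vr \<rho> else 0)"
proof -
  \<comment> \<open>Factors at coinciding sites are merged, so that independence over a set of sites
    covers both cases at once.\<close>
  define F where "F i k = (if i = x then hat \<rho> k else 1) * (if i = y then hat \<rho> k else 1)" for i k
  have prod: "(\<Prod>i\<in>{x,y}. F i (\<eta> w 0 i)) = hat \<rho> (\<eta> w 0 x) * hat \<rho> (\<eta> w 0 y)" for w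
    by (cases "x = y") (auto simp: F_def)
  have F: "integrable (geo \<rho>) (F i)" for i
    by (rule integrable_geo_bound[OF rho_pos, of _ 1])
       (auto simp: F_def abs_mult power2_eq_square intro: order_trans[OF abs_le_one_plus_square])
  show "integrable M (\<lambda>w. hat \<rho> (\<eta> w 0 x) * hat \<rho> (\<eta> w 0 y))"
    using expectation_prod_eta0(1)[of "{x,y}" F] F unfolding prod by simp
  have "(\<integral>w. hat \<rho> (\<eta> w 0 x) * hat \<rho> (\<eta> w 0 y) \<partial>M) = (\<Prod>i\<in>{x,y}. Egeo \<rho> (F i))"
    using expectation_prod_eta0(2)[of "{x,y}" F] F unfolding prod by simp
  also have "\<dots> = (if x = y then vr \<rho> else 0)"
    using expectation_hat[OF rho_pos]
    by (auto simp: F_def[abs_def] vr_def power2_eq_square)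
  finally show "(\<integral>w. hat \<rho> (\<eta> w 0 x) * hat \<rho> (\<eta> w 0 y) \<partial>M) = (if x = y then vr \<rho> else 0)" .
qed

text \<open>Two distinct pairs leave some site carrying exactly one centred factor. Having the rate
  always to the right of the occupation excludes the crossed coincidence \<open>x = y'\<close>,
  \<open>x' = y\<close>.\<close>

lemma hat_ghat:
  assumes "x < x'" "y < y'"
  shows "integrable M (\<lambda>w. (hat \<rho> (\<eta> w 0 x) * ghat \<rho> (\<eta> w 0 x')) * (hat \<rho> (\<eta> w 0 y) * ghat \<rho> (\<eta> w 0 y')))"
      (is "integrable M ?Z")
    and "(x, x') \<noteq> (y, y') \<Longrightarrow> (\<integral>w. (hat \<rho> (\<eta> w 0 x) * ghat \<rho> (\<eta> w 0 x')) * (hat \<rho> (\<eta> w 0 y) * ghat \<rho> (\<eta> w 0 y')) \<partial>M) = 0"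
proof -
  define F where "F i k = (if i = x then hat \<rho> k else 1) * (if i = x' then ghat \<rho> k else 1)
     * ((if i = y then hat \<rho> k else 1) * (if i = y' then ghat \<rho> k else 1))" for i k
  let ?I = "{x,x',y,y'}"
  have prod: "(\<Prod>i\<in>?I. F i (\<eta> w 0 i))
     = ?Z w" for w
    unfolding F_def prod.distrib by (simp add: prod.delta del: prod.insert)
  have F: "integrable (geo \<rho>) (F i)" for i
  proof (rule integrable_geo_bound[OF rho_pos])
    fix k
    define h where "h b = \<bar>if b then hat \<rho> k else 1\<bar>" for b
    define g where "g b = \<bar>if b then ghat \<rho> k else 1\<bar>" for b
    have g: "0 \<le> g b" "g b \<le> 1" for b using abs_ghat_le[OF rho_pos] by (auto simp: g_def)
    have h: "0 \<le> h b" for b by (auto simp: h_def)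
    have hh: "h b * h b' \<le> 1 + (hat \<rho> k)\<^sup>2" for b b'
      by (auto simp: h_def power2_eq_square abs_le_one_plus_square[unfolded power2_eq_square])
    have "\<bar>F i k\<bar> = (h (i = x) * g (i = x')) * (h (i = y) * g (i = y'))"
      by (simp only: F_def abs_mult h_def g_def)
    also have "\<dots> \<le> (h (i = x) * 1) * (h (i = y) * 1)"
      using g h by (intro mult_mono mult_nonneg_nonneg) auto
    also have "\<dots> \<le> 1 * (1 + (hat \<rho> k)\<^sup>2)" using hh by simp
    finally show "\<bar>F i k\<bar> \<le> 1 * (1 + (hat \<rho> k)\<^sup>2)" .
  qed
  show "integrable M ?Z"
    using expectation_prod_eta0(1)[of ?I F] F unfolding prod by simp
  assume ne: "(x, x') \<noteq> (y, y')"
  \<comment> \<open>If the left sites agree, \<open>x'\<close> carries \<open>ghat\<close> alone;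
    otherwise the leftmost site carries \<open>hat\<close> alone.\<close>
  have "\<exists>z\<in>?I. Egeo \<rho> (F z) = 0"
  proof (cases "x = y")
    case True
    then have "F x' = ghat \<rho>" using ne assms by (auto simp: F_def fun_eq_iff)
    then show ?thesis using expectation_ghat[OF rho_pos] by (intro bexI[of _ x']) auto
  next
    case False
    then have "F (min x y) = hat \<rho>" using assms by (auto simp: F_def fun_eq_iff min_def)
    then show ?thesis using expectation_hat[OF rho_pos] by (intro bexI[of _ "min x y"]) (auto simp: min_def)
  qed
  then have "(\<Prod>i\<in>?I. Egeo \<rho> (F i)) = 0"
    by (subst prod_zero_iff) auto
  then show "integral\<^sup>L M ?Z = 0"
    using expectation_prod_eta0(2)[of ?I F] F unfolding prod by simp
qed

section \<open>Energy of the potentials and variance of the remainder\<close>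

lemma vr_nonneg: "0 \<le> vr \<rho>"
  unfolding vr_def by (intro Bochner_Integration.integral_nonneg) auto

lemma Psi_bound:
  shows "integrable M (\<lambda>w. (Psi \<rho> K a y (\<eta> w 0))\<^sup>2)"
    and "(\<integral>w. (Psi \<rho> K a y (\<eta> w 0))\<^sup>2 \<partial>M) \<le> vr \<rho> * (\<Sum>j=1..<K. (a (y - int j))\<^sup>2)"
proof -
  let ?Z = "\<lambda>j w. hat \<rho> (\<eta> w 0 (y - int j))"
  let ?b = "\<lambda>j. (1 - real j / real K) * a (y - int j)"
  have eq: "Psi \<rho> K a y (\<eta> w 0) = (\<Sum>j=1..<K. ?b j * ?Z j w)" for w
    unfolding Psi_def by (simp add: mult.assoc)
  note b = orthogonal_sum_bound[of "{1..<K}" ?Z "vr \<rho>" ?b]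
  show "integrable M (\<lambda>w. (Psi \<rho> K a y (\<eta> w 0))\<^sup>2)"
    unfolding eq by (rule b(1)) (auto simp: hat_hat)
  have "(\<integral>w. (Psi \<rho> K a y (\<eta> w 0))\<^sup>2 \<partial>M) \<le> vr \<rho> * (\<Sum>j=1..<K. (?b j)\<^sup>2)"
    unfolding eq by (rule b(2)) (auto simp: hat_hat)
  also have "\<dots> \<le> vr \<rho> * (\<Sum>j=1..<K. (a (y - int j))\<^sup>2)"
  proof (intro mult_left_mono sum_mono vr_nonneg)
    fix j assume j: "j \<in> {1..<K}"
    then have "(1 - real j / real K)\<^sup>2 \<le> 1" by (auto simp: abs_square_le_1 field_simps)
    then have "(1 - real j / real K)\<^sup>2 * (a (y - int j))\<^sup>2 \<le> 1 * (a (y - int j))\<^sup>2"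
      by (intro mult_right_mono) auto
    then show "(?b j)\<^sup>2 \<le> (a (y - int j))\<^sup>2" by (simp add: power_mult_distrib)
  qed
  finally show "(\<integral>w. (Psi \<rho> K a y (\<eta> w 0))\<^sup>2 \<partial>M) \<le> vr \<rho> * (\<Sum>j=1..<K. (a (y - int j))\<^sup>2)" .
qed

lemma pot_bound:
  shows "integrable M (\<lambda>w. (pot \<rho> K a y (\<eta> w 0))\<^sup>2)" (is ?int)
    and "1 \<le> K \<Longrightarrow> (\<integral>w. (pot \<rho> K a y (\<eta> w 0))\<^sup>2 \<partial>M) \<le> 4 * (vr \<rho> + 1) * (\<Sum>j<K. (a (y - int j))\<^sup>2)"
proof -
  let ?U = "\<lambda>w. 4 * (a y)\<^sup>2 * (1 + (hat \<rho> (\<eta> w 0 y))\<^sup>2) + 2 * (Psi \<rho> K a y (\<eta> w 0))\<^sup>2"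
  have U: "(pot \<rho> K a y c)\<^sup>2 \<le> 4 * (a y)\<^sup>2 * (1 + (hat \<rho> (c y))\<^sup>2) + 2 * (Psi \<rho> K a y c)\<^sup>2" for c
  proof -
    let ?P = "a y * (real (c y) - 1 - \<rho>) + Psi \<rho> K a y c"
    have "(pot \<rho> K a y c)\<^sup>2 = ?P\<^sup>2 / (1 + \<rho>)\<^sup>2" unfolding pot_def power_divide power2_minus ..
    also have "\<dots> \<le> ?P\<^sup>2 / 1" using rho_pos by (intro divide_left_mono) auto
    also have "\<dots> \<le> 2 * (a y * (hat \<rho> (c y) - 1))\<^sup>2 + 2 * (Psi \<rho> K a y c)\<^sup>2"
    proof -
      have 1: "a y * (real (c y) - 1 - \<rho>) = a y * (hat \<rho> (c y) - 1)" by (simp add: hat_def)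
      show ?thesis
        unfolding 1 using sum_squares_bound[of "a y * (hat \<rho> (c y) - 1)" "Psi \<rho> K a y c"]
        unfolding power2_sum div_by_1 by linarith
    qed
    also have "2 * (a y * (hat \<rho> (c y) - 1))\<^sup>2 \<le> 4 * (a y)\<^sup>2 * (1 + (hat \<rho> (c y))\<^sup>2)"
    proof -
      have "(hat \<rho> (c y) - 1)\<^sup>2 \<le> 2 * (1 + (hat \<rho> (c y))\<^sup>2)"
        using zero_le_power2[of "hat \<rho> (c y) + 1"] by (simp add: power2_eq_square algebra_simps)
      from mult_left_mono[OF this, of "2 * (a y)\<^sup>2"] show ?thesis
        unfolding power_mult_distrib by (simp add: algebra_simps)
    qed
    finally show ?thesis by simp
  qed
  have iU: "integrable M ?U"
    using Psi_bound(1) integrable_eta0[OF integrable_hat2] by auto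
  have ms: "(\<lambda>w. pot \<rho> K a y (\<eta> w 0)) \<in> borel_measurable M"
    unfolding pot_def Psi_def hat_def by measurable
  show int: ?int
    using U by (intro Bochner_Integration.integrable_bound[OF iU]) (auto intro: borel_measurable_power ms order_trans[OF _ abs_ge_self])
  assume K: "1 \<le> K"
  have "(\<integral>w. (pot \<rho> K a y (\<eta> w 0))\<^sup>2 \<partial>M) \<le> (\<integral>w. ?U w \<partial>M)"
    using U by (intro integral_mono int iU) auto
  also have "\<dots> = 4 * (a y)\<^sup>2 * (1 + vr \<rho>) + 2 * (\<integral>w. (Psi \<rho> K a y (\<eta> w 0))\<^sup>2 \<partial>M)"
    using Psi_bound(1) integrable_eta0[OF integrable_hat2]
    by (subst Bochner_Integration.integral_add)
       (auto simp: expectation_eta0[of "\<lambda>k. 1 + (hat \<rho> k)\<^sup>2"] integrable_hat2 vr_def)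
  also have "\<dots> \<le> 4 * (vr \<rho> + 1) * (a y)\<^sup>2 + 4 * (vr \<rho> + 1) * (\<Sum>j=1..<K. (a (y - int j))\<^sup>2)"
  proof -
    have "2 * (\<integral>w. (Psi \<rho> K a y (\<eta> w 0))\<^sup>2 \<partial>M) \<le> 2 * vr \<rho> * (\<Sum>j=1..<K. (a (y - int j))\<^sup>2)"
      using Psi_bound(2)[of K a y] by simp
    also have "\<dots> \<le> 4 * (vr \<rho> + 1) * (\<Sum>j=1..<K. (a (y - int j))\<^sup>2)"
      using vr_nonneg by (intro mult_right_mono sum_nonneg) auto
    finally show ?thesis by (simp add: algebra_simps)
  qed
  also have "\<dots> = 4 * (vr \<rho> + 1) * (\<Sum>j<K. (a (y - int j))\<^sup>2)"
  proof -
    have "{..<K} = insert 0 {1..<K}" using K by auto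
    then show ?thesis by (simp add: algebra_simps)
  qed
  finally show "(\<integral>w. (pot \<rho> K a y (\<eta> w 0))\<^sup>2 \<partial>M) \<le> 4 * (vr \<rho> + 1) * (\<Sum>j<K. (a (y - int j))\<^sup>2)" .
qed

text \<open>Each \<open>a x\<close> enters the potentials of at most \<open>K\<close> bonds, those
  at \<open>x\<close> up to \<open>x + K - 1\<close>; hence the factor \<open>K\<close>.\<close>

lemma sum_pot_bound:
  assumes K: "1 \<le> K" and supp: "\<And>x. x \<notin> {-A..A} \<Longrightarrow> a x = 0"
  shows "(\<Sum>y\<in>{-R..R}. \<integral>w. (pot \<rho> K a y (\<eta> w 0))\<^sup>2 \<partial>M) \<le> 4 * (vr \<rho> + 1) * (real K * (\<Sum>x\<in>{-A..A}. (a x)\<^sup>2))"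
proof -
  have "(\<Sum>y\<in>{-R..R}. \<integral>w. (pot \<rho> K a y (\<eta> w 0))\<^sup>2 \<partial>M)
      \<le> (\<Sum>y\<in>{-R..R}. 4 * (vr \<rho> + 1) * (\<Sum>j<K. (a (y - int j))\<^sup>2))"
    by (intro sum_mono pot_bound K)
  also have "\<dots> = 4 * (vr \<rho> + 1) * (\<Sum>j<K. \<Sum>y\<in>{-R..R}. (a (y - int j))\<^sup>2)"
    unfolding sum_distrib_left by (rule sum.swap)
  also have "\<dots> \<le> 4 * (vr \<rho> + 1) * (\<Sum>j<K. \<Sum>x\<in>{-A..A}. (a x)\<^sup>2)"
  proof (intro mult_left_mono sum_mono)
    fix j
    have "(\<Sum>y\<in>{-R..R}. (a (y - int j))\<^sup>2) = (\<Sum>x\<in>{-R-int j..R-int j}. (a x)\<^sup>2)"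
      by (rule sum.reindex_bij_witness[of _ "\<lambda>x. x + int j" "\<lambda>y. y - int j"]) auto
    also have "\<dots> = (\<Sum>x\<in>{-R-int j..R-int j} \<inter> {-A..A}. (a x)\<^sup>2)"
      by (intro sum.mono_neutral_right) (auto simp: supp)
    also have "\<dots> \<le> (\<Sum>x\<in>{-A..A}. (a x)\<^sup>2)" by (intro sum_mono2) auto
    finally show "(\<Sum>y\<in>{-R..R}. (a (y - int j))\<^sup>2) \<le> (\<Sum>x\<in>{-A..A}. (a x)\<^sup>2)" .
  qed (use vr_nonneg in auto)
  finally show ?thesis by simp
qed

text \<open>Products over distinct pairs of sites are orthogonal, so \<open>K\<close> terms of size
  \<open>a x / K\<close> contribute only \<open>(a x)^2 / K\<close>: the gain from
  averaging.\<close>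

lemma rem_bound:
  assumes K: "1 \<le> K"
  shows "integrable M (\<lambda>w. (rem \<rho> K A a (\<eta> w 0))\<^sup>2)"
    and "(\<integral>w. (rem \<rho> K A a (\<eta> w 0))\<^sup>2 \<partial>M) \<le> vr \<rho> * (\<Sum>x\<in>{-A..A}. (a x)\<^sup>2) / real K"
proof -
  let ?J = "{-A..A} \<times> {1..K}"
  let ?Z = "\<lambda>i w. hat \<rho> (\<eta> w 0 (fst i)) * ghat \<rho> (\<eta> w 0 (fst i + int (snd i)))"
  let ?b = "\<lambda>i. - a (fst i) / (real K * (1 + \<rho>))"
  have eq: "rem \<rho> K A a (\<eta> w 0) = (\<Sum>i\<in>?J. ?b i * ?Z i w)" for w
    unfolding rem_def sum.cartesian_product sum_divide_distrib sum_negf[symmetric]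
    by (intro sum.cong) (auto simp: mult_ac)
  have var: "(\<integral>w. ?Z i w * ?Z i w \<partial>M) \<le> vr \<rho>" if "i \<in> ?J" for i
  proof -
    have "(\<integral>w. ?Z i w * ?Z i w \<partial>M) \<le> (\<integral>w. hat \<rho> (\<eta> w 0 (fst i)) * hat \<rho> (\<eta> w 0 (fst i)) \<partial>M)"
    proof (intro integral_mono hat_hat hat_ghat)
      fix w
      have "(hat \<rho> (\<eta> w 0 (fst i)))\<^sup>2 * (ghat \<rho> (\<eta> w 0 (fst i + int (snd i))))\<^sup>2 \<le> (hat \<rho> (\<eta> w 0 (fst i)))\<^sup>2 * 1"
        using abs_ghat_le[OF rho_pos] by (intro mult_left_mono) (auto simp: abs_square_le_1)
      then show "?Z i w * ?Z i w \<le> hat \<rho> (\<eta> w 0 (fst i)) * hat \<rho> (\<eta> w 0 (fst i))"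
        by (simp add: power2_eq_square mult_ac)
    qed (use that in auto)
    then show ?thesis by (simp add: hat_hat)
  qed
  note b = orthogonal_sum_bound[of ?J ?Z "vr \<rho>" ?b]
  show "integrable M (\<lambda>w. (rem \<rho> K A a (\<eta> w 0))\<^sup>2)"
    unfolding eq by (rule b(1)) (use var in \<open>auto intro!: hat_ghat\<close>)
  have "(\<integral>w. (rem \<rho> K A a (\<eta> w 0))\<^sup>2 \<partial>M) \<le> vr \<rho> * (\<Sum>i\<in>?J. (?b i)\<^sup>2)"
    unfolding eq by (rule b(2)) (use var in \<open>auto intro!: hat_ghat\<close>)
  also have "(\<Sum>i\<in>?J. (?b i)\<^sup>2) \<le> (\<Sum>i\<in>?J. (a (fst i))\<^sup>2 / (real K)\<^sup>2)"
  proof (rule sum_mono)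
    fix i
    have "(?b i)\<^sup>2 = (a (fst i))\<^sup>2 / (real K)\<^sup>2 / (1 + \<rho>)\<^sup>2" by (simp add: power_divide power_mult_distrib)
    also have "\<dots> \<le> (a (fst i))\<^sup>2 / (real K)\<^sup>2 / 1"
      using rho_pos by (intro divide_left_mono) auto
    finally show "(?b i)\<^sup>2 \<le> (a (fst i))\<^sup>2 / (real K)\<^sup>2" by simp
  qed
  also have "\<dots> = (\<Sum>x\<in>{-A..A}. \<Sum>j=1..K. (a x)\<^sup>2 / (real K)\<^sup>2)"
    unfolding sum.cartesian_product by (intro sum.cong) auto
  also have "\<dots> = (\<Sum>x\<in>{-A..A}. (a x)\<^sup>2) / real K"
    using K by (simp add: sum_divide_distrib power2_eq_square)
  finally show "(\<integral>w. (rem \<rho> K A a (\<eta> w 0))\<^sup>2 \<partial>M) \<le> vr \<rho> * (\<Sum>x\<in>{-A..A}. (a x)\<^sup>2) / real K"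
    using vr_nonneg by (simp add: mult_left_mono)
qed

end

section \<open>The discretised chain\<close>

text \<open>Sorted by lag, because stationary correlations depend on the lag only.\<close>

lemma square_sum_lags:
  fixes b :: "nat \<Rightarrow> real"
  shows "(\<Sum>l=1..m. b l)\<^sup>2 = (\<Sum>l=1..m. b l * b l) + 2 * (\<Sum>l=1..m. \<Sum>j=1..<l. b (l - j) * b l)"
proof (induction m)
  case (Suc m)
  have rev: "(\<Sum>j=1..<Suc m. b (Suc m - j)) = (\<Sum>l=1..m. b l)"
    by (rule sum.reindex_bij_witness[of _ "\<lambda>l. Suc m - l" "\<lambda>j. Suc m - j"]) auto
  have "(\<Sum>l=1..Suc m. b l)\<^sup>2 = (\<Sum>l=1..m. b l)\<^sup>2 + b (Suc m) * b (Suc m) + 2 * ((\<Sum>l=1..m. b l) * b (Suc m))"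
    by (simp add: power2_eq_square algebra_simps)
  also have "(\<Sum>l=1..m. b l) * b (Suc m) = (\<Sum>j=1..<Suc m. b (Suc m - j) * b (Suc m))"
    unfolding rev[symmetric] sum_distrib_right ..
  finally show ?case unfolding Suc.IH by simp
qed simp

lemma square_sum_le_card:
  fixes b :: "nat \<Rightarrow> real"
  shows "(\<Sum>l=1..m. b l)\<^sup>2 \<le> real m * (\<Sum>l=1..m. (b l)\<^sup>2)"
  using Cauchy_Schwarz_ineq_sum[of "\<lambda>_. 1" b "{1..m}"] by simp

context tazrp_process begin

section \<open>Independence of the initial configuration and the clock increments\<close>

lemma poisson_clock: "poisson_process M (\<lambda>w. N w x)"
  using tazrp by (simp add: tazrp_def)

lemma measurable_clock [measurable]: "(\<lambda>w. N w x t) \<in> measurable M (count_space UNIV)"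
  using poisson_clock[of x] unfolding poisson_process_def by blast

definition inc :: "real \<Rightarrow> int \<Rightarrow> nat \<Rightarrow> 'a \<Rightarrow> nat" where
  "inc h x i w = N w x (real (Suc i) * h) - N w x (real i * h)"

lemma measurable_inc [measurable]: "inc h x i \<in> measurable M (count_space UNIV)"
  unfolding inc_def by measurable

lemma prob_inc:
  assumes "0 \<le> h"
  shows "prob {w \<in> space M. inc h x i w = k} = exp (- h) * h ^ k / fact k"
proof -
  have "prob {w \<in> space M. N w x t - N w x s = k} = exp (- (t - s)) * (t - s) ^ k / fact k"
    if "0 \<le> s" "s \<le> t" for s t
    using poisson_clock[of x] that unfolding poisson_process_def by blast
  from this[of "real i * h" "real (Suc i) * h"] show ?thesis
    using assms unfolding inc_def by (simp add: algebra_simps)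
qed

text \<open>Combines three independence assumptions: initial state against clocks, clocks among each
  other, increments of one clock. The events are pulled back from path space, where the initial
  configuration, encoded as constant in time, is read off at time 0.\<close>

lemma prob_joint:
  assumes h: "0 < h" and W: "finite W" "W \<noteq> {}"
  shows "prob {w\<in>space M. (\<forall>x\<in>W. \<eta> w 0 x \<in> A x) \<and> (\<forall>x\<in>W. \<forall>i<m. inc h x i w \<in> C x i)}
    = prob {w\<in>space M. \<forall>x\<in>W. \<eta> w 0 x \<in> A x} * (\<Prod>x\<in>W. \<Prod>i<m. prob {w\<in>space M. inc h x i w \<in> C x i})"
proof -
  let ?P = "PiM UNIV (\<lambda>_::real. count_space (UNIV::nat set))"
  let ?S = "PiM UNIV (\<lambda>_::int. ?P)"
  let ?Xa = "{f\<in>space ?S. \<forall>x\<in>W. f x 0 \<in> A x}"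
  define B where "B x = {n\<in>space ?P. \<forall>i<m. n (real (Suc i) * h) - n (real i * h) \<in> C x i}" for x
  let ?Xb = "{f\<in>space ?S. \<forall>x\<in>W. f x \<in> B x}"
  have sP: "space ?P = UNIV" and sS: "space ?S = UNIV" by (simp_all add: space_PiM)
  have B: "B x \<in> sets ?P" for x
    unfolding B_def by measurable
  have comp: "(\<lambda>f. f x) \<in> measurable ?S ?P" for x
    by (rule measurable_component_singleton) auto
  have comp0: "(\<lambda>f. f x 0) \<in> measurable ?S (count_space UNIV)" for x
    by (rule measurable_compose[OF comp measurable_component_singleton]) auto
  have Xa: "?Xa \<in> sets ?S"
  proof (rule sets.sets_Collect_finite_All'[OF _ W(1)])
    fix x
    have "{f\<in>space ?S. f x 0 \<in> A x} = (\<lambda>f. f x 0) -` A x \<inter> space ?S" by auto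
    then show "{f\<in>space ?S. f x 0 \<in> A x} \<in> sets ?S" using measurable_sets[OF comp0] by simp
  qed (use W in auto)
  have Xb: "?Xb \<in> sets ?S"
  proof (rule sets.sets_Collect_finite_All'[OF _ W(1)])
    fix x
    have "{f\<in>space ?S. f x \<in> B x} = (\<lambda>f. f x) -` B x \<inter> space ?S" by auto
    then show "{f\<in>space ?S. f x \<in> B x} \<in> sets ?S" using measurable_sets[OF comp B] by simp
  qed (use W in auto)
  have ind: "indep_var ?S (\<lambda>w x _. \<eta> w 0 x) ?S (\<lambda>w. N w)"
    using tazrp by (simp add: tazrp_def)
  have indN: "indep_vars (\<lambda>_. ?P) (\<lambda>x w. N w x) UNIV"
    using tazrp by (simp add: tazrp_def)
  have "{w\<in>space M. (\<forall>x\<in>W. \<eta> w 0 x \<in> A x) \<and> (\<forall>x\<in>W. \<forall>i<m. inc h x i w \<in> C x i)}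
      = (\<lambda>w. ((\<lambda>x _. \<eta> w 0 x), N w)) -` (?Xa \<times> ?Xb) \<inter> space M"
    by (auto simp: sP sS B_def inc_def)
  then have "prob {w\<in>space M. (\<forall>x\<in>W. \<eta> w 0 x \<in> A x) \<and> (\<forall>x\<in>W. \<forall>i<m. inc h x i w \<in> C x i)}
      = prob ((\<lambda>w x _. \<eta> w 0 x) -` ?Xa \<inter> space M) * prob ((\<lambda>w. N w) -` ?Xb \<inter> space M)"
    using indep_varD[OF ind Xa Xb] by simp
  also have "(\<lambda>w x _. \<eta> w 0 x) -` ?Xa \<inter> space M = {w\<in>space M. \<forall>x\<in>W. \<eta> w 0 x \<in> A x}"
    by (auto simp: sS)
  also have "(\<lambda>w. N w) -` ?Xb \<inter> space M = (\<Inter>x\<in>W. (\<lambda>w. N w x) -` B x \<inter> space M)"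
    using W by (auto simp: sS)
  also have "prob \<dots> = (\<Prod>x\<in>W. prob ((\<lambda>w. N w x) -` B x \<inter> space M))"
    using W B by (intro indep_varsD[OF indN]) auto
  also have "\<dots> = (\<Prod>x\<in>W. \<Prod>i<m. prob {w\<in>space M. inc h x i w \<in> C x i})"
  proof (rule prod.cong[OF refl])
    fix x assume "x \<in> W"
    show "prob ((\<lambda>w. N w x) -` B x \<inter> space M) = (\<Prod>i<m. prob {w\<in>space M. inc h x i w \<in> C x i})"
    proof (cases "m = 0")
      case True
      then show ?thesis by (simp add: B_def sP prob_space)
    next
      case False
      have sm: "strict_mono (\<lambda>i. real i * h)" using h by (auto simp: strict_mono_def)
      have iv0: "\<forall>\<tau> n. 0 \<le> \<tau> 0 \<longrightarrow> strict_mono \<tau> \<longrightarrow>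
          indep_vars (\<lambda>_. count_space UNIV) (\<lambda>i w. N w x (\<tau> (Suc i)) - N w x (\<tau> i)) {..<n}"
        using poisson_clock[of x] unfolding poisson_process_def by blast
      have iv: "indep_vars (\<lambda>_. count_space UNIV) (\<lambda>i w. N w x (real (Suc i) * h) - N w x (real i * h)) {..<m}"
        by (rule iv0[rule_format, OF _ sm]) simp
      have "(\<lambda>w. N w x) -` B x \<inter> space M = (\<Inter>i\<in>{..<m}. (\<lambda>w. N w x (real (Suc i) * h) - N w x (real i * h)) -` C x i \<inter> space M)"
        using False by (auto simp: B_def sP)
      also have "prob \<dots> = (\<Prod>i<m. prob ((\<lambda>w. N w x (real (Suc i) * h) - N w x (real i * h)) -` C x i \<inter> space M))"
        using False by (intro indep_varsD_finite[OF iv]) auto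
      also have "\<dots> = (\<Prod>i<m. prob {w\<in>space M. inc h x i w \<in> C x i})"
        by (intro prod.cong refl arg_cong[of _ _ prob]) (auto simp: inc_def)
      finally show ?thesis .
    qed
  qed
  finally show ?thesis .
qed

section \<open>The discrete chain and its history\<close>

definition sg :: "int \<Rightarrow> real \<Rightarrow> int \<Rightarrow> nat \<Rightarrow> 'a \<Rightarrow> bool" where
  "sg R h x i w \<longleftrightarrow> inc h x i w = 1 \<and> (\<forall>y\<in>{-R..R} - {x}. inc h y i w = 0)"

text \<open>Steps with several rings are ignored: no order of moves within a step has to be chosen,
  and every single move gets the same probability.\<close>

primrec chain :: "int \<Rightarrow> real \<Rightarrow> 'a \<Rightarrow> nat \<Rightarrow> cfg" where
  "chain R h w 0 = (\<lambda>x. if x \<in> {-R..R} then \<eta> w 0 x else 0)"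
| "chain R h w (Suc i) = (if \<exists>x\<in>{-R..R}. sg R h x i w
     then mv R (THE x. x \<in> {-R..R} \<and> sg R h x i w) (chain R h w i) else chain R h w i)"

lemma sg_unique:
  assumes "x \<in> {-R..R}" "y \<in> {-R..R}" "sg R h x i w" "sg R h y i w"
  shows "x = y"
proof (rule ccontr)
  assume "x \<noteq> y"
  then have "y \<in> {-R..R} - {x}" using assms by auto
  then have "inc h y i w = 0" using assms(3) unfolding sg_def by blast
  then show False using assms(4) unfolding sg_def by simp
qed

lemma chain_Suc_sg:
  assumes "x \<in> {-R..R}" "sg R h x i w"
  shows "chain R h w (Suc i) = mv R x (chain R h w i)"
proof -
  have "(THE x. x \<in> {-R..R} \<and> sg R h x i w) = x"
    using assms sg_unique by (intro the_equality) blast+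
  then show ?thesis using assms by auto
qed

lemma chain_Suc_none: "\<not> (\<exists>x\<in>{-R..R}. sg R h x i w) \<Longrightarrow> chain R h w (Suc i) = chain R h w i"
  by simp

lemma chain_Suc_sum:
  fixes v :: "cfg \<Rightarrow> real"
  shows "v (chain R h w (Suc i)) = v (chain R h w i) + (\<Sum>x\<in>{-R..R}.
     (if sg R h x i w then v (mv R x (chain R h w i)) - v (chain R h w i) else 0))"
proof (cases "\<exists>x\<in>{-R..R}. sg R h x i w")
  case True
  then obtain z where z: "z \<in> {-R..R}" "sg R h z i w" by auto
  have "sg R h x i w \<longleftrightarrow> x = z" if "x \<in> {-R..R}" for x
    using z that sg_unique[OF z(1) that] by auto
  then have "(\<Sum>x\<in>{-R..R}. (if sg R h x i w then v (mv R x (chain R h w i)) - v (chain R h w i) else 0))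
    = (\<Sum>x\<in>{-R..R}. (if x = z then v (mv R x (chain R h w i)) - v (chain R h w i) else 0))"
    by (intro sum.cong) auto
  then show ?thesis using z(1) unfolding chain_Suc_sg[OF z] by (simp add: sum.delta)
next
  case False
  then have "(\<Sum>x\<in>{-R..R}. (if sg R h x i w then v (mv R x (chain R h w i)) - v (chain R h w i) else 0)) = 0"
    by (intro sum.neutral) auto
  then show ?thesis using chain_Suc_none[OF False] by simp
qed

lemma chain_cfgs:
  assumes "1 \<le> R"
  shows "chain R h w i \<in> cfgs R B \<longleftrightarrow> chain R h w 0 \<in> cfgs R B"
proof (induction i)
  case (Suc i)
  show ?case
  proof (cases "\<exists>x\<in>{-R..R}. sg R h x i w")
    case True
    then obtain x where "x \<in> {-R..R}" "sg R h x i w" by auto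
    then show ?thesis using Suc mv_cfgs[OF assms] by (simp only: chain_Suc_sg)
  qed (use Suc in simp)
qed simp

abbreviation cyl :: "int \<Rightarrow> real \<Rightarrow> nat \<Rightarrow> (int \<Rightarrow> nat set) \<Rightarrow> (int \<Rightarrow> nat \<Rightarrow> nat set) \<Rightarrow> 'a set" where
  "cyl R h i A C \<equiv> {w\<in>space M. (\<forall>x\<in>{-R..R}. \<eta> w 0 x \<in> A x) \<and> (\<forall>x\<in>{-R..R}. \<forall>j<i. inc h x j w \<in> C x j)}"

text \<open>A pi-system generating the history before step \<open>i\<close>; on cylinders
  independence is a product formula.\<close>

definition past_gen :: "int \<Rightarrow> real \<Rightarrow> nat \<Rightarrow> 'a set set" where
  "past_gen R h i = {cyl R h i A C | A C. True}"

abbreviation past :: "int \<Rightarrow> real \<Rightarrow> nat \<Rightarrow> 'a set set" where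
  "past R h i \<equiv> sigma_sets (space M) (past_gen R h i)"

lemma past_genI:
  "cyl R h i A C \<in> past_gen R h i"
  unfolding past_gen_def by blast

lemma past_gen_events: "past_gen R h i \<subseteq> events"
  unfolding past_gen_def by auto

lemma Int_stable_past_gen: "Int_stable (past_gen R h i)"
proof (rule Int_stableI)
  fix a b assume "a \<in> past_gen R h i" "b \<in> past_gen R h i"
  then obtain A C A' C' where
    "a = cyl R h i A C"
    "b = cyl R h i A' C'"
    unfolding past_gen_def by blast
  then have "a \<inter> b = {w\<in>space M. (\<forall>x\<in>{-R..R}. \<eta> w 0 x \<in> A x \<inter> A' x)
      \<and> (\<forall>x\<in>{-R..R}. \<forall>j<i. inc h x j w \<in> C x j \<inter> C' x j)}" by auto
  then show "a \<inter> b \<in> past_gen R h i" by (simp only: past_genI)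
qed

lemma sg_iff: "x \<in> {-R..R} \<Longrightarrow> sg R h x i w \<longleftrightarrow> (\<forall>y\<in>{-R..R}. inc h y i w \<in> (if y = x then {1} else {0}))"
  unfolding sg_def by auto

lemma sg_set: "x \<in> {-R..R} \<Longrightarrow> {w\<in>space M. sg R h x i w} = {w\<in>space M. \<forall>y\<in>{-R..R}. inc h y i w \<in> (if y = x then {1} else {0})}"
  unfolding sg_def by auto

lemma sg_past:
  assumes "k < i" "x \<in> {-R..R}"
  shows "{w\<in>space M. sg R h x k w} \<in> past_gen R h i"
proof -
  have "{w\<in>space M. sg R h x k w} = {w\<in>space M. (\<forall>y\<in>{-R..R}. \<eta> w 0 y \<in> UNIV) \<and>
     (\<forall>y\<in>{-R..R}. \<forall>j<i. inc h y j w \<in> (if j = k then (if y = x then {1} else {0}) else UNIV))}"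
    unfolding sg_set[OF assms(2)] using assms(1) by (auto split: if_splits)
  then show ?thesis by (simp only: past_genI)
qed

lemma countable_supported: "countable {c::int \<Rightarrow> nat. \<forall>x. x \<notin> {-R..R} \<longrightarrow> c x = 0}"
proof -
  let ?e = "\<lambda>(f::int \<Rightarrow> nat) x. if x \<in> {-R..R} then f x else 0"
  have "{c::int \<Rightarrow> nat. \<forall>x. x \<notin> {-R..R} \<longrightarrow> c x = 0} \<subseteq> ?e ` (PiE {-R..R} (\<lambda>_. UNIV))"
  proof
    fix c :: cfg assume "c \<in> {c. \<forall>x. x \<notin> {-R..R} \<longrightarrow> c x = 0}"
    then have "c = ?e (restrict c {-R..R})" by auto
    then show "c \<in> ?e ` (PiE {-R..R} (\<lambda>_. UNIV))" by (intro image_eqI) auto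
  qed
  moreover have "countable (?e ` (PiE {-R..R} (\<lambda>_. UNIV::nat set)))"
    by (intro countable_image countable_PiE) auto
  ultimately show ?thesis by (rule countable_subset)
qed

text \<open>The state is determined by the initial ring configuration and the earlier rings. Ring
  configurations are countable, so initial events are countable unions of cylinders.\<close>

lemma chain_past:
  assumes "k \<le> i"
  shows "{w\<in>space M. chain R h w k \<in> D} \<in> past R h i"
  using assms
proof (induction k arbitrary: D)
  case 0
  have sub: "past_gen R h i \<subseteq> Pow (space M)" using past_gen_events sets.sets_into_space by blast
  interpret A: sigma_algebra "space M" "past R h i"
    by (rule sigma_algebra_sigma_sets[OF sub])
  let ?Z = "{c::int \<Rightarrow> nat. \<forall>x. x \<notin> {-R..R} \<longrightarrow> c x = 0}"
  have "{w\<in>space M. chain R h w 0 \<in> D} = (\<Union>c\<in>D \<inter> ?Z.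
     {w\<in>space M. (\<forall>x\<in>{-R..R}. \<eta> w 0 x \<in> {c x}) \<and> (\<forall>x\<in>{-R..R}. \<forall>j<i. inc h x j w \<in> UNIV)})"
    (is "?L = (\<Union>c\<in>_. ?F c)")
  proof (intro set_eqI iffI)
    fix w assume "w \<in> ?L"
    then show "w \<in> (\<Union>c\<in>D \<inter> ?Z. ?F c)" by (intro UN_I[of "chain R h w 0"]) auto
  next
    fix w assume "w \<in> (\<Union>c\<in>D \<inter> ?Z. ?F c)"
    then obtain c where c: "c \<in> D" "c \<in> ?Z" "w \<in> ?F c" by auto
    then have "chain R h w 0 = c" by auto
    then show "w \<in> ?L" using c by auto
  qed
  also have "\<dots> \<in> past R h i"
  proof (rule A.countable_UN')
    show "countable (D \<inter> ?Z)" by (rule countable_subset[OF _ countable_supported[of R]]) auto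
    show "?F ` (D \<inter> ?Z) \<subseteq> past R h i"
      by (intro image_subsetI sigma_sets.Basic past_genI)
  qed
  finally show ?case .
next
  case (Suc k)
  have sub: "past_gen R h i \<subseteq> Pow (space M)" using past_gen_events sets.sets_into_space by blast
  interpret A: sigma_algebra "space M" "past R h i"
    by (rule sigma_algebra_sigma_sets[OF sub])
  let ?sg = "\<lambda>x. {w\<in>space M. sg R h x k w}"
  have sg: "?sg x \<in> past R h i" if "x \<in> {-R..R}" for x
    using sg_past[of k i x R h] that Suc.prems by auto
  have IH: "{w\<in>space M. chain R h w k \<in> D'} \<in> past R h i" for D'
    using Suc.IH[of D'] Suc.prems by simp
  have "{w\<in>space M. chain R h w (Suc k) \<in> D}
     = (\<Union>x\<in>{-R..R}. ?sg x \<inter> {w\<in>space M. chain R h w k \<in> {c. mv R x c \<in> D}})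
       \<union> (space M - (\<Union>x\<in>{-R..R}. ?sg x)) \<inter> {w\<in>space M. chain R h w k \<in> D}" (is "?L = ?Rr")
  proof (intro set_eqI)
    fix w
    show "w \<in> ?L \<longleftrightarrow> w \<in> ?Rr"
    proof (cases "\<exists>x\<in>{-R..R}. sg R h x k w")
      case True
      then obtain z where z: "z \<in> {-R..R}" "sg R h z k w" by auto
      have "sg R h x k w \<longleftrightarrow> x = z" if "x \<in> {-R..R}" for x
        using z that sg_unique[OF z(1) that] by auto
      then show ?thesis using z chain_Suc_sg[OF z] by (auto simp del: chain.simps)
    next
      case False
      then show ?thesis using chain_Suc_none[OF False] by (auto simp del: chain.simps)
    qed
  qed
  also have "\<dots> \<in> past R h i"
    by (intro A.Un A.Int A.Diff A.finite_UN A.top sg IH) auto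
  finally show ?case .
qed

text \<open>The probability that one given clock rings exactly once during time \<open>h\<close> and
  all other clocks of the ring stay silent: one factor \<open>exp (- h)\<close> per site.\<close>

definition pr :: "int \<Rightarrow> real \<Rightarrow> real" where
  "pr R h = h * exp (- h) ^ card {-R..R}"

lemma prob_sg:
  assumes h: "0 < h" and R: "0 \<le> R" and x: "x \<in> {-R..R}"
  shows "(\<Prod>y\<in>{-R..R}. prob {w\<in>space M. inc h y i w \<in> (if y = x then {1} else {0})}) = pr R h"
proof -
  have "prob {w\<in>space M. inc h y i w \<in> (if y = x then {1} else {0})} = exp (- h) * (if y = x then h else 1)" for y
    using prob_inc[of h y i 1] prob_inc[of h y i 0] h by auto
  then show ?thesis using x by (simp add: prod.distrib prod.delta pr_def)
qed

text \<open>A cylinder of the past intersected with a single ring in step \<open>i\<close> is a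
  cylinder one step longer. The product formula thus yields independence on the pi-system, and it
  extends to the generated sigma-algebra.\<close>

lemma past_indep:
  assumes h: "0 < h" and R: "0 \<le> R" and x: "x \<in> {-R..R}"
    and E: "E \<in> past R h i"
  shows "prob (E \<inter> {w\<in>space M. sg R h x i w}) = prob E * pr R h"
proof -
  let ?b = "{w\<in>space M. sg R h x i w}"
  let ?W = "{-R..R}"
  define S where "S y = (if y = x then {1} else {0::nat})" for y
  have W: "finite ?W" "?W \<noteq> {}" using R by auto
  have b: "?b \<in> events" using sg_past[of i "Suc i" x R h] x past_gen_events by auto
  have split: "prob {w\<in>space M. (\<forall>y\<in>?W. \<eta> w 0 y \<in> A y) \<and> (\<forall>y\<in>?W. \<forall>j<i. inc h y j w \<in> C y j) \<and> sg R h x i w}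
     = prob (cyl R h i A C) * pr R h" for A C
  proof -
    define C' where "C' y j = (if j < i then C y j else S y)" for y j
    have "{w\<in>space M. (\<forall>y\<in>?W. \<eta> w 0 y \<in> A y) \<and> (\<forall>y\<in>?W. \<forall>j<i. inc h y j w \<in> C y j) \<and> sg R h x i w}
      = {w\<in>space M. (\<forall>y\<in>?W. \<eta> w 0 y \<in> A y) \<and> (\<forall>y\<in>?W. \<forall>j<Suc i. inc h y j w \<in> C' y j)}"
      unfolding sg_iff[OF x] S_def[symmetric] by (auto simp: C'_def less_Suc_eq)
    then have "prob {w\<in>space M. (\<forall>y\<in>?W. \<eta> w 0 y \<in> A y) \<and> (\<forall>y\<in>?W. \<forall>j<i. inc h y j w \<in> C y j) \<and> sg R h x i w}
      = prob {w\<in>space M. \<forall>y\<in>?W. \<eta> w 0 y \<in> A y} * (\<Prod>y\<in>?W. \<Prod>j<Suc i. prob {w\<in>space M. inc h y j w \<in> C' y j})"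
      using prob_joint[OF h W, of A "Suc i" C'] by simp
    also have "(\<Prod>y\<in>?W. \<Prod>j<Suc i. prob {w\<in>space M. inc h y j w \<in> C' y j})
       = (\<Prod>y\<in>?W. \<Prod>j<i. prob {w\<in>space M. inc h y j w \<in> C y j}) * pr R h"
      unfolding prob_sg[OF h R x, symmetric, of i] prod.distrib[symmetric]
      by (intro prod.cong refl) (simp add: C'_def S_def)
    finally show ?thesis unfolding prob_joint[OF h W] by simp
  qed
  have pb: "prob ?b = pr R h"
    using split[of "\<lambda>_. UNIV" "\<lambda>_ _. UNIV"] by (simp add: prob_space)
  have "indep_set (past_gen R h i) {?b}"
    unfolding indep_sets2_eq
  proof (intro conjI ballI)
    fix a b' assume a: "a \<in> past_gen R h i" "b' \<in> {?b}"
    then obtain A C where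
      "a = cyl R h i A C"
      unfolding past_gen_def by blast
    moreover have "cyl R h i A C \<inter> ?b
       = {w\<in>space M. (\<forall>y\<in>?W. \<eta> w 0 y \<in> A y) \<and> (\<forall>y\<in>?W. \<forall>j<i. inc h y j w \<in> C y j) \<and> sg R h x i w}" by auto
    ultimately show "prob (a \<inter> b') = prob a * prob b'" using a split[of A C] pb by simp
  qed (use b past_gen_events in auto)
  then have "indep_set (past R h i) (sigma_sets (space M) {?b})"
    by (intro indep_set_sigma_sets Int_stable_past_gen) (auto simp: Int_stable_def)
  then show ?thesis using E pb unfolding indep_sets2_eq by (auto intro: sigma_sets.Basic)
qed


lemma sigma_past_events: "past R h i \<subseteq> events"
  by (rule sets.sigma_sets_subset[OF past_gen_events])

lemma chain_events [measurable]: "{w\<in>space M. chain R h w k \<in> D} \<in> events"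
  using chain_past[of k k R h D] sigma_past_events by blast

section \<open>Markov property and stationary correlations\<close>

abbreviation pair_at :: "int \<Rightarrow> real \<Rightarrow> nat \<Rightarrow> nat \<Rightarrow> cfg \<Rightarrow> cfg \<Rightarrow> 'a set" where
  "pair_at R h k i c d \<equiv> {w\<in>space M. chain R h w k = c \<and> chain R h w i = d}"

lemma chain_pair_past:
  assumes "k \<le> i"
  shows "pair_at R h k i c d \<in> past R h i"
proof -
  have sub: "past_gen R h i \<subseteq> Pow (space M)" using past_gen_events sets.sets_into_space by blast
  interpret A: sigma_algebra "space M" "past R h i"
    by (rule sigma_algebra_sigma_sets[OF sub])
  have "pair_at R h k i c d
     = {w\<in>space M. chain R h w k \<in> {c}} \<inter> {w\<in>space M. chain R h w i \<in> {d}}" by auto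
  then show ?thesis using chain_past[OF assms] chain_past[of i i] by (simp only: A.Int order_refl)
qed

text \<open>The particle cap at time 0 persists, so only finitely many pairs of states occur. The
  event \<open>E\<close> is carried along to hold the ring of the next step.\<close>

lemma expectation_chain_pair:
  fixes F :: "cfg \<Rightarrow> cfg \<Rightarrow> real" and h :: real and B :: nat
  assumes R: "1 \<le> R" and ki: "k \<le> i" and E: "E \<in> events"
  defines "Z \<equiv> \<lambda>w. if chain R h w 0 \<in> cfgs R B \<and> w \<in> E then F (chain R h w k) (chain R h w i) else 0"
  shows "integrable M Z"
    and "integral\<^sup>L M Z = (\<Sum>c\<in>cfgs R B. \<Sum>d\<in>cfgs R B.
       F c d * prob (pair_at R h k i c d \<inter> E))"
proof -
  let ?S = "cfgs R B"
  define e where "e c d = pair_at R h k i c d \<inter> E" for c d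
  have e: "e c d \<in> events" for c d
    unfolding e_def using chain_pair_past[OF ki] sigma_past_events E by blast
  have eq: "Z w = (\<Sum>c\<in>?S. \<Sum>d\<in>?S. F c d * indicator (e c d) w)" if w: "w \<in> space M" for w
  proof (cases "chain R h w 0 \<in> ?S \<and> w \<in> E")
    case True
    then have S: "chain R h w k \<in> ?S" "chain R h w i \<in> ?S"
      using chain_cfgs[OF R, of h w k B] chain_cfgs[OF R, of h w i B] by auto
    have "(\<Sum>c\<in>?S. \<Sum>d\<in>?S. F c d * indicator (e c d) w)
      = (\<Sum>c\<in>?S. \<Sum>d\<in>?S. if d = chain R h w i then (if c = chain R h w k then F c d else 0) else 0)"
      using True w by (intro sum.cong refl) (auto simp: e_def indicator_def)
    also have "\<dots> = Z w" using S True by (simp add: sum.delta finite_cfgs Z_def)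
    finally show ?thesis by simp
  next
    case False
    have "F c d * indicator (e c d) w = 0" if "c \<in> ?S" for c d
      using False that chain_cfgs[OF R, of h w k B] by (auto simp: e_def indicator_def)
    then have "(\<Sum>c\<in>?S. \<Sum>d\<in>?S. F c d * indicator (e c d) w) = 0"
      by (intro sum.neutral ballI) auto
    then show ?thesis using False unfolding Z_def by auto
  qed
  have int: "integrable M (\<lambda>w. \<Sum>c\<in>?S. \<Sum>d\<in>?S. F c d * indicator (e c d) w)"
    using e by (intro Bochner_Integration.integrable_sum integrable_mult_right) (auto simp: emeasure_eq_measure)
  show "integrable M Z"
    by (rule Bochner_Integration.integrable_cong[OF refl, THEN iffD2, OF _ int]) (rule eq)
  have "integral\<^sup>L M Z = (\<integral>w. (\<Sum>c\<in>?S. \<Sum>d\<in>?S. F c d * indicator (e c d) w) \<partial>M)"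
    by (rule Bochner_Integration.integral_cong[OF refl eq])
  also have "\<dots> = (\<Sum>c\<in>?S. \<Sum>d\<in>?S. F c d * prob (e c d))"
    using e by (simp add: Bochner_Integration.integral_sum Bochner_Integration.integrable_sum emeasure_eq_measure)
  finally show "integral\<^sup>L M Z = (\<Sum>c\<in>?S. \<Sum>d\<in>?S.
       F c d * prob (pair_at R h k i c d \<inter> E))"
    unfolding e_def .
qed

text \<open>Expectation restricted to the finite, invariant set of configurations with at most \<open>B\<close> particles.\<close>
definition ex :: "int \<Rightarrow> real \<Rightarrow> nat \<Rightarrow> ('a \<Rightarrow> real) \<Rightarrow> real" where
  "ex R h B Z = (\<integral>w. (if chain R h w 0 \<in> cfgs R B then Z w else 0) \<partial>M)"

lemma chain_integrable:
  fixes F :: "cfg \<Rightarrow> cfg \<Rightarrow> real"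
  assumes "1 \<le> R"
  shows "integrable M (\<lambda>w. if chain R h w 0 \<in> cfgs R B then F (chain R h w k) (chain R h w i) else 0)"
proof -
  have *: "integrable M (\<lambda>w. if chain R h w 0 \<in> cfgs R B \<and> w \<in> space M then F (chain R h w k) (chain R h w i) else 0)"
    if "k \<le> i" for k i and F :: "cfg \<Rightarrow> cfg \<Rightarrow> real"
    by (rule expectation_chain_pair(1)[OF assms that, where E = "space M"]) auto
  have "integrable M (\<lambda>w. if chain R h w 0 \<in> cfgs R B \<and> w \<in> space M then F (chain R h w k) (chain R h w i) else 0)"
    using *[of k i F] *[of i k "\<lambda>c d. F d c"] by (cases "k \<le> i") auto
  then show ?thesis
    by (rule Bochner_Integration.integrable_cong[OF refl, THEN iffD1, rotated]) auto
qed

lemma finite_chain_ring: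
  fixes p :: real
  assumes "1 \<le> R" "0 < p" "p * card {-R..R} \<le> 1"
  shows "finite_chain (cfgs R B) (wt \<rho> R) {-R..R} (mv R) p"
  by unfold_locales (use assms rho_pos wt_nonneg wt_stationary in auto)

text \<open>The Markov property in weak form: the ring that decides step \<open>i\<close> is
  independent of the states at times \<open>k\<close> and \<open>i\<close>, and for each site it has
  probability \<open>pr R h\<close>.\<close>

lemma ex_step:
  fixes u v :: "cfg \<Rightarrow> real"
  assumes R: "1 \<le> R" and h: "0 < h" and ki: "k \<le> i"
  shows "ex R h B (\<lambda>w. u (chain R h w k) * v (chain R h w (Suc i)))
    = ex R h B (\<lambda>w. u (chain R h w k) *
        (v (chain R h w i) + pr R h * (\<Sum>x\<in>{-R..R}. v (mv R x (chain R h w i)) - v (chain R h w i))))"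
proof -
  let ?S = "cfgs R B"
  define F where "F x c d = u c * (v (mv R x d) - v d)" for x c d
  define Z where "Z x w = (if chain R h w 0 \<in> ?S then F x (chain R h w k) (chain R h w i) else 0)" for x w
  define Y where "Y x w = (if chain R h w 0 \<in> ?S \<and> w \<in> {w\<in>space M. sg R h x i w}
     then F x (chain R h w k) (chain R h w i) else 0)" for x w
  define U where "U w = (if chain R h w 0 \<in> ?S then u (chain R h w k) * v (chain R h w i) else 0)" for w
  have sgE: "{w\<in>space M. sg R h x i w} \<in> events" if "x \<in> {-R..R}" for x
    using sg_past[of i "Suc i" x R h] that past_gen_events by auto
  have iU: "integrable M U" unfolding U_def by (rule chain_integrable[OF R, of _ _ "\<lambda>c d. u c * v d"])
  have iZ: "integrable M (Z x)" for x unfolding Z_def by (rule chain_integrable[OF R])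
  have iY: "integrable M (Y x)" if "x \<in> {-R..R}" for x
    unfolding Y_def by (rule expectation_chain_pair(1)[OF R ki sgE[OF that]])
  have key: "integral\<^sup>L M (Y x) = pr R h * integral\<^sup>L M (Z x)" if x: "x \<in> {-R..R}" for x
  proof -
    have "integral\<^sup>L M (Y x) = (\<Sum>c\<in>?S. \<Sum>d\<in>?S.
       F x c d * prob (pair_at R h k i c d \<inter> {w\<in>space M. sg R h x i w}))"
      unfolding Y_def by (rule expectation_chain_pair(2)[OF R ki sgE[OF x]])
    also have "\<dots> = (\<Sum>c\<in>?S. \<Sum>d\<in>?S.
       F x c d * (prob (pair_at R h k i c d) * pr R h))"
      using past_indep[OF h _ x chain_pair_past[OF ki]] R by simp
    also have "\<dots> = pr R h * (\<Sum>c\<in>?S. \<Sum>d\<in>?S.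
       F x c d * prob (pair_at R h k i c d \<inter> space M))"
      unfolding sum_distrib_left
      by (intro sum.cong refl) (simp add: mult_ac Int_absorb2 Collect_restrict)
    also have "\<dots> = pr R h * (\<integral>w. (if chain R h w 0 \<in> ?S \<and> w \<in> space M
        then F x (chain R h w k) (chain R h w i) else 0) \<partial>M)"
      by (subst expectation_chain_pair(2)[OF R ki]) auto
    also have "(\<integral>w. (if chain R h w 0 \<in> ?S \<and> w \<in> space M
        then F x (chain R h w k) (chain R h w i) else 0) \<partial>M) = integral\<^sup>L M (Z x)"
      unfolding Z_def by (intro Bochner_Integration.integral_cong) auto
    finally show ?thesis .
  qed
  have "ex R h B (\<lambda>w. u (chain R h w k) * v (chain R h w (Suc i))) = (\<integral>w. U w + (\<Sum>x\<in>{-R..R}. Y x w) \<partial>M)"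
    unfolding ex_def
  proof (rule Bochner_Integration.integral_cong[OF refl])
    fix w assume w: "w \<in> space M"
    show "(if chain R h w 0 \<in> ?S then u (chain R h w k) * v (chain R h w (Suc i)) else 0) = U w + (\<Sum>x\<in>{-R..R}. Y x w)"
    proof (cases "chain R h w 0 \<in> ?S")
      case True
      then have "(\<Sum>x\<in>{-R..R}. Y x w) = u (chain R h w k) * (\<Sum>x\<in>{-R..R}.
         (if sg R h x i w then v (mv R x (chain R h w i)) - v (chain R h w i) else 0))"
        unfolding sum_distrib_left using w by (intro sum.cong refl) (simp add: Y_def F_def)
      then show ?thesis using True unfolding chain_Suc_sum[of v] U_def by (simp add: distrib_left)
    qed (simp add: U_def Y_def)
  qed
  also have "\<dots> = integral\<^sup>L M U + (\<Sum>x\<in>{-R..R}. integral\<^sup>L M (Y x))"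
    by (subst Bochner_Integration.integral_add)
       (auto intro!: iU iY Bochner_Integration.integrable_sum Bochner_Integration.integral_sum)
  also have "\<dots> = integral\<^sup>L M U + (\<Sum>x\<in>{-R..R}. pr R h * integral\<^sup>L M (Z x))"
    using key by simp
  also have "\<dots> = (\<integral>w. U w + (\<Sum>x\<in>{-R..R}. pr R h * Z x w) \<partial>M)"
    using iU iZ by (subst Bochner_Integration.integral_add) (auto simp: Bochner_Integration.integral_sum)
  also have "\<dots> = ex R h B (\<lambda>w. u (chain R h w k) *
        (v (chain R h w i) + pr R h * (\<Sum>x\<in>{-R..R}. v (mv R x (chain R h w i)) - v (chain R h w i))))"
    unfolding ex_def
    by (intro Bochner_Integration.integral_cong refl)
       (auto simp: U_def Z_def F_def sum_distrib_left distrib_left mult_ac)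
  finally show ?thesis .
qed

context
  fixes R :: int and h :: real and B :: nat
  assumes R: "1 \<le> R" and h: "0 < h" and pc: "pr R h * card {-R..R} \<le> 1"
begin

lemma pr_pos: "0 < pr R h"
  using h by (simp add: pr_def)

interpretation fc: finite_chain "cfgs R B" "wt \<rho> R" "{-R..R}" "mv R" "pr R h"
  by (rule finite_chain_ring[OF R pr_pos pc])

lemma ex_chain_0: "ex R h B (\<lambda>w. z (chain R h w 0)) = (\<Sum>c\<in>cfgs R B. wt \<rho> R c * z c)"
proof -
  have "ex R h B (\<lambda>w. z (chain R h w 0))
    = (\<integral>w. (if chain R h w 0 \<in> cfgs R B \<and> w \<in> space M then z (chain R h w 0) else 0) \<partial>M)"
    unfolding ex_def by (intro Bochner_Integration.integral_cong) auto
  also have "\<dots> = (\<Sum>c\<in>cfgs R B. \<Sum>d\<in>cfgs R B.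
       z c * prob ({w\<in>space M. chain R h w 0 = c \<and> chain R h w 0 = d} \<inter> space M))"
    by (rule expectation_chain_pair(2)[OF R, where F = "\<lambda>c d. z c"]) auto
  also have "\<dots> = (\<Sum>c\<in>cfgs R B. \<Sum>d\<in>cfgs R B. if d = c then z c * wt \<rho> R c else 0)"
  proof (intro sum.cong refl)
    fix c d assume c: "c \<in> cfgs R B" "d \<in> cfgs R B"
    show "z c * prob ({w\<in>space M. chain R h w 0 = c \<and> chain R h w 0 = d} \<inter> space M) = (if d = c then z c * wt \<rho> R c else 0)"
    proof (cases "d = c")
      case True
      have "{w\<in>space M. chain R h w 0 = c \<and> chain R h w 0 = d} \<inter> space M = {w\<in>space M. \<forall>x\<in>{-R..R}. \<eta> w 0 x = c x}"
        using c True by (auto simp: cfgs_def fun_eq_iff)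
      then show ?thesis using True law_eta0[of "{-R..R}" c] by (simp add: wt_def)
    next
      case False
      then have "{w\<in>space M. chain R h w 0 = c \<and> chain R h w 0 = d} \<inter> space M = {}" by auto
      then show ?thesis using False by simp
    qed
  qed
  also have "\<dots> = (\<Sum>c\<in>cfgs R B. wt \<rho> R c * z c)"
    by (simp add: sum.delta' finite_cfgs mult.commute)
  finally show ?thesis .
qed

lemma ex_chain_stationary: "ex R h B (\<lambda>w. z (chain R h w k)) = (\<Sum>c\<in>cfgs R B. wt \<rho> R c * z c)"
proof (induction k arbitrary: z)
  case (Suc k)
  have "ex R h B (\<lambda>w. z (chain R h w (Suc k))) = ex R h B (\<lambda>w. fc.Q z (chain R h w k))"
    using ex_step[OF R h, of 0 k B "\<lambda>_. 1" z] unfolding fc.Q_def by simp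
  then show ?case unfolding Suc fc.sum_Q .
qed (rule ex_chain_0)

text \<open>The Markov property, applied from the later time backwards, peels off one
  \<open>Q\<close> per step until stationarity finishes.\<close>

lemma ex_chain_corr:
  "ex R h B (\<lambda>w. u (chain R h w k) * v (chain R h w (k + j))) = fc.ip u ((fc.Q ^^ j) v)"
proof (induction j arbitrary: v)
  case 0
  show ?case using ex_chain_stationary[of "\<lambda>c. u c * v c" k] by (simp add: fc.ip_def)
next
  case (Suc j)
  have "ex R h B (\<lambda>w. u (chain R h w k) * v (chain R h w (k + Suc j)))
     = ex R h B (\<lambda>w. u (chain R h w k) * fc.Q v (chain R h w (k + j)))"
    using ex_step[OF R h, of k "k + j" B u v] unfolding fc.Q_def by simp
  also have "\<dots> = fc.ip u ((fc.Q ^^ j) (fc.Q v))" by (rule Suc)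
  finally show ?case by (simp only: funpow_Suc_right o_apply)
qed

text \<open>Lag by lag the correlations are the pairings \<open>fc.ip\<close>, so the second moment
  is exactly the quantity controlled by the abstract energy estimate.\<close>

lemma ex_square_current:
  "ex R h B (\<lambda>w. (\<Sum>l=1..m. cur R u (chain R h w l))\<^sup>2)
     \<le> 4 * m * (\<Sum>y\<in>{-R..R}. \<Sum>c\<in>cfgs R B. wt \<rho> R c * (g_rate (c y) * u y c)\<^sup>2) / pr R h
       + (\<Sum>c\<in>cfgs R B. wt \<rho> R c * (cur R u c)\<^sup>2)"
proof -
  let ?f = "cur R u"
  let ?Z = "\<lambda>k l w. if chain R h w 0 \<in> cfgs R B then ?f (chain R h w k) * ?f (chain R h w l) else 0"
  have iZ: "integrable M (?Z k l)" for k l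
    by (rule chain_integrable[OF R, of _ _ "\<lambda>c d. ?f c * ?f d"])
  have "ex R h B (\<lambda>w. (\<Sum>l=1..m. ?f (chain R h w l))\<^sup>2)
     = (\<integral>w. (\<Sum>l=1..m. ?Z l l w) + 2 * (\<Sum>l=1..m. \<Sum>j=1..<l. ?Z (l - j) l w) \<partial>M)"
    unfolding ex_def square_sum_lags by (intro Bochner_Integration.integral_cong) auto
  also have "\<dots> = (\<Sum>l=1..m. integral\<^sup>L M (?Z l l)) + 2 * (\<Sum>l=1..m. \<Sum>j=1..<l. integral\<^sup>L M (?Z (l - j) l))"
    using iZ by (subst Bochner_Integration.integral_add)
      (auto simp: Bochner_Integration.integral_sum Bochner_Integration.integrable_sum)
  also have "\<dots> = (\<Sum>l=1..m. fc.ip ?f ?f) + 2 * (\<Sum>l=1..m. \<Sum>j=1..<l. fc.ip ?f ((fc.Q ^^ j) ?f))"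
  proof (intro arg_cong2[where f = "(+)"] arg_cong[where f = "\<lambda>x. 2 * x"] sum.cong refl)
    fix l
    show "integral\<^sup>L M (?Z l l) = fc.ip ?f ?f"
      using ex_chain_corr[of ?f l ?f 0] by (simp add: ex_def)
  next
    fix l j assume "l \<in> {1..m}" "j \<in> {1..<l}"
    then show "integral\<^sup>L M (?Z (l - j) l) = fc.ip ?f ((fc.Q ^^ j) ?f)"
      using ex_chain_corr[of ?f "l - j" ?f j] by (simp add: ex_def)
  qed
  also have "\<dots> = m * fc.ip ?f ?f + 2 * (\<Sum>l=1..m. \<Sum>j=1..<l. fc.ip ?f ((fc.Q ^^ j) ?f))" by simp
  also have "\<dots> \<le> 4 * m * (\<Sum>y\<in>{-R..R}. \<Sum>c\<in>cfgs R B. wt \<rho> R c * (g_rate (c y) * u y c)\<^sup>2) / pr R h + fc.ip ?f ?f"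
    using fc.additive_functional_bound[of ?f "\<lambda>y c. g_rate (c y) * u y c" m]
    unfolding fc.ip_def using cur_by_parts[OF R, where w = u and \<rho> = \<rho>] by simp
  finally show ?thesis by (simp add: fc.ip_def power2_eq_square)
qed

text \<open>Cauchy-Schwarz over the \<open>m\<close> steps, without any decorrelation in time;
  enough for the remainder, whose variance is already small.\<close>

lemma ex_square_static:
  "ex R h B (\<lambda>w. (\<Sum>l=1..m. f (chain R h w l))\<^sup>2) \<le> (real m)\<^sup>2 * (\<Sum>c\<in>cfgs R B. wt \<rho> R c * (f c)\<^sup>2)"
proof -
  let ?Z = "\<lambda>k l w. if chain R h w 0 \<in> cfgs R B then f (chain R h w k) * f (chain R h w l) else 0"
  have iZ: "integrable M (?Z k l)" for k l
    by (rule chain_integrable[OF R, of _ _ "\<lambda>c d. f c * f d"])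
  have "ex R h B (\<lambda>w. (\<Sum>l=1..m. f (chain R h w l))\<^sup>2) \<le> (\<integral>w. real m * (\<Sum>l=1..m. ?Z l l w) \<partial>M)"
    unfolding ex_def
  proof (rule integral_mono)
    have "(\<lambda>w. if chain R h w 0 \<in> cfgs R B then (\<Sum>l=1..m. f (chain R h w l))\<^sup>2 else 0) = (\<lambda>w. \<Sum>k=1..m. \<Sum>l=1..m. ?Z k l w)"
      by (auto simp: fun_eq_iff power2_eq_square sum_product)
    then show "integrable M (\<lambda>w. if chain R h w 0 \<in> cfgs R B then (\<Sum>l=1..m. f (chain R h w l))\<^sup>2 else 0)"
      using iZ by (simp add: Bochner_Integration.integrable_sum)
    show "integrable M (\<lambda>w. real m * (\<Sum>l=1..m. ?Z l l w))" using iZ by auto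
    show "(if chain R h w 0 \<in> cfgs R B then (\<Sum>l=1..m. f (chain R h w l))\<^sup>2 else 0) \<le> real m * (\<Sum>l=1..m. ?Z l l w)" for w
      using square_sum_le_card[of "\<lambda>l. f (chain R h w l)" m] by (auto simp: power2_eq_square)
  qed
  also have "\<dots> = real m * (\<Sum>l=1..m. integral\<^sup>L M (?Z l l))"
    using iZ by (simp add: Bochner_Integration.integral_sum)
  also have "\<dots> = real m * (\<Sum>l=1..m. \<Sum>c\<in>cfgs R B. wt \<rho> R c * (f c)\<^sup>2)"
  proof (intro arg_cong[where f = "\<lambda>x. real m * x"] sum.cong[OF refl])
    fix l
    show "integral\<^sup>L M (?Z l l) = (\<Sum>c\<in>cfgs R B. wt \<rho> R c * (f c)\<^sup>2)"
      using ex_chain_stationary[of "\<lambda>c. f c * f c" l] by (simp add: ex_def power2_eq_square)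
  qed
  finally show ?thesis by (simp add: power2_eq_square)
qed

text \<open>Capping the particle number only discards nonnegative mass, so bounds under the product
  measure hold uniformly in \<open>B\<close>.\<close>

lemma sum_wt_le:
  assumes "\<And>c. 0 \<le> z c" "integrable M (\<lambda>w. z (chain R h w 0))"
  shows "(\<Sum>c\<in>cfgs R B. wt \<rho> R c * z c) \<le> (\<integral>w. z (chain R h w 0) \<partial>M)"
  unfolding ex_chain_0[symmetric] ex_def
  by (rule integral_mono[OF chain_integrable[OF R, of _ _ "\<lambda>c d. z c" 0 0]]) (use assms in auto)

end

end

section \<open>Second moment bound for the chain\<close>

lemma Vg_eq: "0 < \<rho> \<Longrightarrow> Vg \<rho> k = ghat \<rho> k - hat \<rho> k / (1 + \<rho>)\<^sup>2"
  by (simp add: Vg_def deriv_phi ghat_def hat_def)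

lemma abs_Vg_le: "0 < \<rho> \<Longrightarrow> \<bar>Vg \<rho> k\<bar> \<le> 1 + \<bar>hat \<rho> k\<bar>"
proof -
  assume r: "0 < \<rho>"
  have "\<bar>hat \<rho> k / (1 + \<rho>)\<^sup>2\<bar> \<le> \<bar>hat \<rho> k\<bar> / 1"
    unfolding abs_divide using r by (intro divide_left_mono) auto
  then show ?thesis
    unfolding Vg_eq[OF r] using abs_ghat_le[OF r, of k] by linarith
qed

lemma Vg_square_le: "0 < \<rho> \<Longrightarrow> (Vg \<rho> k)\<^sup>2 \<le> 2 * (1 + (hat \<rho> k)\<^sup>2)"
proof -
  assume r: "0 < \<rho>"
  have "(Vg \<rho> k)\<^sup>2 \<le> (1 + \<bar>hat \<rho> k\<bar>)\<^sup>2"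
    using abs_Vg_le[OF r, of k] by (metis abs_ge_zero abs_le_square_iff abs_of_nonneg add_nonneg_nonneg zero_le_one)
  also have "\<dots> \<le> 2 * (1 + (hat \<rho> k)\<^sup>2)"
    using zero_le_power2[of "1 - \<bar>hat \<rho> k\<bar>"] by (simp add: power2_sum power2_diff)
  finally show ?thesis .
qed

lemma add_square_le: "(x + y)\<^sup>2 \<le> 2 * x\<^sup>2 + 2 * (y::real)\<^sup>2"
  using sum_squares_bound[of x y] unfolding power2_sum by linarith

context tazrp_process begin

text \<open>The three terms are the energy of the currents over \<open>m\<close> steps, the boundary
  term of the energy estimate, and the remainder. The middle one is bounded crudely by the window
  size; it carries no factor \<open>m\<close> and disappears as the time step is refined.\<close>

lemma chain_square_bound:
  assumes R: "1 \<le> R" and h: "0 < h" and pc: "pr R h * card {-R..R} \<le> 1"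
    and K: "1 \<le> K" and A: "0 \<le> A" and AR: "A + int K \<le> R"
    and supp: "\<And>x. x \<notin> {-A..A} \<Longrightarrow> a x = 0"
  defines "s2 \<equiv> \<Sum>x\<in>{-A..A}. (a x)\<^sup>2"
  shows "(\<integral>\<^sup>+w. ennreal ((\<Sum>l=1..m. \<Sum>x\<in>{-A..A}. a x * Vg \<rho> (chain R h w l x))\<^sup>2) \<partial>M)
    \<le> ennreal ((vr \<rho> + 1) * s2 * (32 * real m * real K / pr R h + 16 * (A + 1) + 2 * (real m)\<^sup>2 / real K))"
proof -
  let ?c = "\<lambda>w. chain R h w 0"
  let ?cu = "cur R (pot \<rho> K a)"
  define f where "f c = (\<Sum>x\<in>{-A..A}. a x * Vg \<rho> (c x))" for c :: cfg
  define F where "F w = (\<Sum>l=1..m. f (chain R h w l))" for w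
  define bound where "bound = (vr \<rho> + 1) * s2 * (32 * real m * real K / pr R h + 16 * (A + 1) + 2 * (real m)\<^sup>2 / real K)"
  have s2: "0 \<le> s2" unfolding s2_def by (intro sum_nonneg) auto
  have decomp: "f c = ?cu c + rem \<rho> K A a c" for c
    unfolding f_def by (rule Vg_decomposition[OF rho_pos K A AR supp])
  \<comment> \<open>The chain is zero outside the ring, unlike the process, but there the weights
    \<open>a\<close> vanish.\<close>
  have pot0: "pot \<rho> K a y (?c w) = pot \<rho> K a y (\<eta> w 0)" if y: "y \<in> {-R..R}" for y w
  proof -
    have *: "a z * F' (?c w z) = a z * F' (\<eta> w 0 z)" for z and F' :: "nat \<Rightarrow> real"
      using supp[of z] AR by (cases "z \<in> {-A..A}") auto
    show ?thesis
      unfolding pot_def Psi_def *[of _ "hat \<rho>"] *[of y "\<lambda>k. real k - 1 - \<rho>"] ..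
  qed
  have rem0: "rem \<rho> K A a (?c w) = rem \<rho> K A a (\<eta> w 0)" for w
    unfolding rem_def using AR by (intro arg_cong2[where f = "(/)"] arg_cong[where f = uminus] sum.cong refl) auto
  have f0: "f (?c w) = f (\<eta> w 0)" for w
    unfolding f_def using AR by (intro sum.cong refl) auto
  have G: "(\<Sum>y\<in>{-R..R}. \<Sum>c\<in>cfgs R B. wt \<rho> R c * (g_rate (c y) * pot \<rho> K a y c)\<^sup>2)
      \<le> 4 * (vr \<rho> + 1) * (real K * s2)" for B
  proof -
    have "(\<Sum>c\<in>cfgs R B. wt \<rho> R c * (g_rate (c y) * pot \<rho> K a y c)\<^sup>2) \<le> (\<integral>w. (pot \<rho> K a y (\<eta> w 0))\<^sup>2 \<partial>M)"
      if y: "y \<in> {-R..R}" for y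
    proof -
      have "(\<Sum>c\<in>cfgs R B. wt \<rho> R c * (g_rate (c y) * pot \<rho> K a y c)\<^sup>2) \<le> (\<Sum>c\<in>cfgs R B. wt \<rho> R c * (pot \<rho> K a y c)\<^sup>2)"
        by (intro sum_mono mult_left_mono wt_nonneg rho_pos) (auto simp: g_rate_def)
      also have "\<dots> \<le> (\<integral>w. (pot \<rho> K a y (?c w))\<^sup>2 \<partial>M)"
        by (rule sum_wt_le[OF R h pc]) (use pot_bound(1) pot0[OF y] in auto)
      finally show ?thesis using pot0[OF y] by simp
    qed
    then have "(\<Sum>y\<in>{-R..R}. \<Sum>c\<in>cfgs R B. wt \<rho> R c * (g_rate (c y) * pot \<rho> K a y c)\<^sup>2)
        \<le> (\<Sum>y\<in>{-R..R}. \<integral>w. (pot \<rho> K a y (\<eta> w 0))\<^sup>2 \<partial>M)" by (intro sum_mono)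
    also have "\<dots> \<le> 4 * (vr \<rho> + 1) * (real K * s2)"
      unfolding s2_def by (rule sum_pot_bound[OF K supp])
    finally show ?thesis .
  qed
  have Rm: "(\<Sum>c\<in>cfgs R B. wt \<rho> R c * (rem \<rho> K A a c)\<^sup>2) \<le> vr \<rho> * s2 / real K" for B
  proof -
    have "(\<Sum>c\<in>cfgs R B. wt \<rho> R c * (rem \<rho> K A a c)\<^sup>2) \<le> (\<integral>w. (rem \<rho> K A a (?c w))\<^sup>2 \<partial>M)"
      by (rule sum_wt_le[OF R h pc]) (use rem_bound(1)[OF K] rem0 in auto)
    also have "\<dots> \<le> vr \<rho> * s2 / real K" unfolding rem0 s2_def by (rule rem_bound(2)[OF K])
    finally show ?thesis .
  qed
  have fint: "integrable M (\<lambda>w. 2 * (real_of_int (2 * A + 1) * (\<Sum>x\<in>{-A..A}. (a x)\<^sup>2 * (2 * (1 + (hat \<rho> (\<eta> w 0 x))\<^sup>2)))) + 2 * (rem \<rho> K A a (\<eta> w 0))\<^sup>2)"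
    (is "integrable M ?U")
    using integrable_eta0[OF integrable_hat2] rem_bound(1)[OF K] by (auto intro!: Bochner_Integration.integrable_sum)
  \<comment> \<open>The decomposition is read backwards: the current is the full sum minus the
    remainder, both with known second moments.\<close>
  have curU: "(?cu (?c w))\<^sup>2 \<le> ?U w" for w
  proof -
    have "(?cu (?c w))\<^sup>2 = (f (\<eta> w 0) + - rem \<rho> K A a (\<eta> w 0))\<^sup>2"
      using decomp[of "?c w"] unfolding f0 rem0 by simp
    also have "\<dots> \<le> 2 * (f (\<eta> w 0))\<^sup>2 + 2 * (rem \<rho> K A a (\<eta> w 0))\<^sup>2"
      using add_square_le[of "f (\<eta> w 0)" "- rem \<rho> K A a (\<eta> w 0)"] by simp
    also have "(f (\<eta> w 0))\<^sup>2 \<le> real_of_int (2 * A + 1) * (\<Sum>x\<in>{-A..A}. (a x)\<^sup>2 * (2 * (1 + (hat \<rho> (\<eta> w 0 x))\<^sup>2)))"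
    proof -
      have "(f (\<eta> w 0))\<^sup>2 \<le> real (card {-A..A}) * (\<Sum>x\<in>{-A..A}. (a x * Vg \<rho> (\<eta> w 0 x))\<^sup>2)"
        using Cauchy_Schwarz_ineq_sum[of "\<lambda>_. 1" "\<lambda>x. a x * Vg \<rho> (\<eta> w 0 x)" "{-A..A}"] by (simp add: f_def)
      also have "real (card {-A..A}) = real_of_int (2 * A + 1)" using A by simp
      also have "(\<Sum>x\<in>{-A..A}. (a x * Vg \<rho> (\<eta> w 0 x))\<^sup>2) \<le> (\<Sum>x\<in>{-A..A}. (a x)\<^sup>2 * (2 * (1 + (hat \<rho> (\<eta> w 0 x))\<^sup>2)))"
        unfolding power_mult_distrib by (intro sum_mono mult_left_mono Vg_square_le rho_pos) auto
      finally show ?thesis using A by (simp add: mult_left_mono)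
    qed
    finally show ?thesis by simp
  qed
  have cint: "integrable M (\<lambda>w. (?cu (?c w))\<^sup>2)"
  proof (rule Bochner_Integration.integrable_bound[OF fint])
    have eq: "?cu (?c w) = f (\<eta> w 0) - rem \<rho> K A a (\<eta> w 0)" for w
      using decomp[of "?c w"] unfolding f0 rem0 by simp
    show "(\<lambda>w. (?cu (?c w))\<^sup>2) \<in> borel_measurable M"
      unfolding eq unfolding f_def rem_def hat_def ghat_def by measurable
    show "AE w in M. norm ((?cu (?c w))\<^sup>2) \<le> norm (?U w)"
      using curU by (intro AE_I2) (auto intro: order_trans[OF _ abs_ge_self])
  qed
  have C: "(\<Sum>c\<in>cfgs R B. wt \<rho> R c * (?cu c)\<^sup>2) \<le> 8 * (A + 1) * (vr \<rho> + 1) * s2" for B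
  proof -
    have "(\<Sum>c\<in>cfgs R B. wt \<rho> R c * (?cu c)\<^sup>2) \<le> (\<integral>w. (?cu (?c w))\<^sup>2 \<partial>M)"
      by (rule sum_wt_le[OF R h pc]) (use cint in auto)
    also have "\<dots> \<le> (\<integral>w. ?U w \<partial>M)" by (intro integral_mono cint fint curU)
    also have "\<dots> = 4 * real_of_int (2 * A + 1) * ((vr \<rho> + 1) * s2) + 2 * (\<integral>w. (rem \<rho> K A a (\<eta> w 0))\<^sup>2 \<partial>M)"
    proof -
      define V where "V w = (\<Sum>x\<in>{-A..A}. (a x)\<^sup>2 * (2 * (1 + (hat \<rho> (\<eta> w 0 x))\<^sup>2)))" for w
      have "(\<integral>w. V w \<partial>M) = (\<Sum>x\<in>{-A..A}. (a x)\<^sup>2 * (2 * (1 + vr \<rho>)))"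
        unfolding V_def using integrable_eta0[OF integrable_hat2]
        by (subst Bochner_Integration.integral_sum) (auto simp: expectation_eta0[of "\<lambda>k. (hat \<rho> k)\<^sup>2"] vr_def prob_space)
      then have EV: "(\<integral>w. V w \<partial>M) = 2 * ((vr \<rho> + 1) * s2)"
        unfolding sum_distrib_right[symmetric] s2_def by (simp add: mult_ac add.commute)
      have iV: "integrable M V"
        unfolding V_def using integrable_eta0[OF integrable_hat2] by (auto intro!: Bochner_Integration.integrable_sum)
      have "(\<integral>w. 2 * (real_of_int (2 * A + 1) * V w) + 2 * (rem \<rho> K A a (\<eta> w 0))\<^sup>2 \<partial>M)
         = 2 * (real_of_int (2 * A + 1) * (\<integral>w. V w \<partial>M)) + 2 * (\<integral>w. (rem \<rho> K A a (\<eta> w 0))\<^sup>2 \<partial>M)"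
        using rem_bound(1)[OF K] iV by (subst Bochner_Integration.integral_add) auto
      then show ?thesis unfolding EV unfolding V_def by simp
    qed
    also have "\<dots> \<le> 4 * real_of_int (2 * A + 1) * ((vr \<rho> + 1) * s2) + 2 * ((vr \<rho> + 1) * s2)"
    proof -
      have "(\<integral>w. (rem \<rho> K A a (\<eta> w 0))\<^sup>2 \<partial>M) \<le> vr \<rho> * s2 / real K"
        unfolding s2_def by (rule rem_bound(2)[OF K])
      also have "\<dots> \<le> vr \<rho> * s2 / 1" using K s2 vr_nonneg by (intro divide_left_mono) auto
      also have "\<dots> \<le> (vr \<rho> + 1) * s2" using s2 by (simp add: algebra_simps)
      finally show ?thesis by simp
    qed
    also have "\<dots> \<le> 8 * (A + 1) * (vr \<rho> + 1) * s2"
    proof -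
      have "0 \<le> (vr \<rho> + 1) * s2" using s2 vr_nonneg by simp
      then show ?thesis by (simp add: algebra_simps)
    qed
    finally show ?thesis by simp
  qed
  have trunc: "(\<integral>\<^sup>+w. ennreal (if ?c w \<in> cfgs R B then (F w)\<^sup>2 else 0) \<partial>M) \<le> ennreal bound"
    and tmeas: "(\<lambda>w. if ?c w \<in> cfgs R B then (F w)\<^sup>2 else 0) \<in> borel_measurable M" for B
  proof -
    define FC where "FC w = (\<Sum>l=1..m. ?cu (chain R h w l))" for w
    define FR where "FR w = (\<Sum>l=1..m. rem \<rho> K A a (chain R h w l))" for w
    have F: "F w = FC w + FR w" for w
      unfolding F_def FC_def FR_def decomp by (rule sum.distrib)
    have sq: "integrable M (\<lambda>w. if ?c w \<in> cfgs R B then (\<Sum>l=1..m. z (chain R h w l))\<^sup>2 else 0)"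
      for z :: "cfg \<Rightarrow> real"
    proof -
      have "(\<lambda>w. if ?c w \<in> cfgs R B then (\<Sum>l=1..m. z (chain R h w l))\<^sup>2 else 0)
        = (\<lambda>w. \<Sum>k=1..m. \<Sum>l=1..m. if ?c w \<in> cfgs R B then z (chain R h w k) * z (chain R h w l) else 0)"
        by (auto simp: fun_eq_iff power2_eq_square sum_product)
      then show ?thesis
        using chain_integrable[OF R, of h B "\<lambda>c d. z c * z d"] by (simp add: Bochner_Integration.integrable_sum)
    qed
    have i: "integrable M (\<lambda>w. if ?c w \<in> cfgs R B then (F w)\<^sup>2 else 0)"
      "integrable M (\<lambda>w. if ?c w \<in> cfgs R B then (FC w)\<^sup>2 else 0)"
      "integrable M (\<lambda>w. if ?c w \<in> cfgs R B then (FR w)\<^sup>2 else 0)"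
      unfolding F_def FC_def FR_def by (rule sq)+
    from i(1) show "(\<lambda>w. if ?c w \<in> cfgs R B then (F w)\<^sup>2 else 0) \<in> borel_measurable M" by auto
    have "(\<integral>w. (if ?c w \<in> cfgs R B then (F w)\<^sup>2 else 0) \<partial>M)
       \<le> (\<integral>w. 2 * (if ?c w \<in> cfgs R B then (FC w)\<^sup>2 else 0) + 2 * (if ?c w \<in> cfgs R B then (FR w)\<^sup>2 else 0) \<partial>M)"
      using i by (intro integral_mono) (auto simp: F add_square_le)
    also have "\<dots> = 2 * ex R h B (\<lambda>w. (FC w)\<^sup>2) + 2 * ex R h B (\<lambda>w. (FR w)\<^sup>2)"
      unfolding ex_def using i by simp
    also have "\<dots> \<le> 2 * (4 * real m * (4 * (vr \<rho> + 1) * (real K * s2)) / pr R h + 8 * (A + 1) * (vr \<rho> + 1) * s2)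
        + 2 * ((real m)\<^sup>2 * (vr \<rho> * s2 / real K))"
    proof -
      have "ex R h B (\<lambda>w. (FC w)\<^sup>2)
        \<le> 4 * real m * (\<Sum>y\<in>{-R..R}. \<Sum>c\<in>cfgs R B. wt \<rho> R c * (g_rate (c y) * pot \<rho> K a y c)\<^sup>2) / pr R h
          + (\<Sum>c\<in>cfgs R B. wt \<rho> R c * (?cu c)\<^sup>2)"
        unfolding FC_def by (rule ex_square_current[OF R h pc])
      also have "\<dots> \<le> 4 * real m * (4 * (vr \<rho> + 1) * (real K * s2)) / pr R h + 8 * (A + 1) * (vr \<rho> + 1) * s2"
        using pr_pos[OF R h pc] by (intro add_mono divide_right_mono mult_left_mono G C) auto
      finally have 1: "ex R h B (\<lambda>w. (FC w)\<^sup>2) \<le> 4 * real m * (4 * (vr \<rho> + 1) * (real K * s2)) / pr R h + 8 * (A + 1) * (vr \<rho> + 1) * s2" .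
      have "ex R h B (\<lambda>w. (FR w)\<^sup>2) \<le> (real m)\<^sup>2 * (\<Sum>c\<in>cfgs R B. wt \<rho> R c * (rem \<rho> K A a c)\<^sup>2)"
        unfolding FR_def by (rule ex_square_static[OF R h pc])
      also have "\<dots> \<le> (real m)\<^sup>2 * (vr \<rho> * s2 / real K)" by (intro mult_left_mono Rm) auto
      finally have 2: "ex R h B (\<lambda>w. (FR w)\<^sup>2) \<le> (real m)\<^sup>2 * (vr \<rho> * s2 / real K)" .
      show ?thesis by (intro add_mono[OF mult_left_mono[OF 1] mult_left_mono[OF 2]]) auto
    qed
    also have "\<dots> \<le> bound"
    proof -
      have "(real m)\<^sup>2 * (vr \<rho> * s2 / real K) \<le> (real m)\<^sup>2 * ((vr \<rho> + 1) * s2 / real K)"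
        using s2 by (intro mult_left_mono divide_right_mono mult_right_mono) auto
      moreover have "bound = 2 * (4 * real m * (4 * (vr \<rho> + 1) * (real K * s2)) / pr R h + 8 * (A + 1) * (vr \<rho> + 1) * s2)
        + 2 * ((real m)\<^sup>2 * ((vr \<rho> + 1) * s2 / real K))"
        unfolding bound_def using pr_pos[OF R h pc] K by (simp add: distrib_left mult_ac)
      ultimately show ?thesis by linarith
    qed
    finally have "(\<integral>w. (if ?c w \<in> cfgs R B then (F w)\<^sup>2 else 0) \<partial>M) \<le> bound" .
    then show "(\<integral>\<^sup>+w. ennreal (if ?c w \<in> cfgs R B then (F w)\<^sup>2 else 0) \<partial>M) \<le> ennreal bound"
      by (subst nn_integral_eq_integral[OF i(1)]) (auto intro: ennreal_leI)
  qed
  \<comment> \<open>Every ring configuration obeys some particle cap, so monotone convergence in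
    \<open>B\<close> removes the truncation.\<close>
  have "(\<integral>\<^sup>+w. ennreal ((F w)\<^sup>2) \<partial>M) = (\<integral>\<^sup>+w. (SUP B. ennreal (if ?c w \<in> cfgs R B then (F w)\<^sup>2 else 0)) \<partial>M)"
  proof (rule nn_integral_cong)
    fix w
    have "?c w \<in> cfgs R (\<Sum>x\<in>{-R..R}. ?c w x)" by (auto simp: cfgs_def)
    then show "ennreal ((F w)\<^sup>2) = (SUP B. ennreal (if ?c w \<in> cfgs R B then (F w)\<^sup>2 else 0))"
      by (intro antisym SUP_least SUP_upper2[of "\<Sum>x\<in>{-R..R}. ?c w x"]) auto
  qed
  also have "\<dots> = (SUP B. \<integral>\<^sup>+w. ennreal (if ?c w \<in> cfgs R B then (F w)\<^sup>2 else 0) \<partial>M)"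
  proof (rule nn_integral_monotone_convergence_SUP)
    show "incseq (\<lambda>B w. ennreal (if ?c w \<in> cfgs R B then (F w)\<^sup>2 else 0))"
      by (auto simp: incseq_def le_fun_def cfgs_def)
  qed (use tmeas in auto)
  also have "\<dots> \<le> ennreal bound" by (intro SUP_least trunc)
  finally show ?thesis unfolding F_def f_def bound_def .
qed

end

section \<open>Coupling of the process with the chain\<close>

lemma llim_eqI:
  fixes f :: "real \<Rightarrow> nat"
  assumes "r0 < s" "\<And>r. r0 \<le> r \<Longrightarrow> r < s \<Longrightarrow> f r = v"
  shows "llim f s = real v"
proof -
  have "eventually (\<lambda>r. real (f r) = real v) (at_left s)"
    unfolding eventually_at_left_field by (rule exI[of _ r0]) (use assms in auto)
  then have "((\<lambda>r. real (f r)) \<longlongrightarrow> real v) (at_left s)"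
    by (rule tendsto_eventually)
  then show ?thesis
    unfolding llim_def by (intro tendsto_Lim) auto
qed

lemma mono_nat_left_const:
  fixes f :: "real \<Rightarrow> nat"
  assumes f: "mono_on {0..} f" and s: "0 < s"
  obtains r0 where "0 \<le> r0" "r0 < s" "\<forall>r. r0 \<le> r \<longrightarrow> r < s \<longrightarrow> f r = f r0"
proof -
  let ?V = "f ` {0..<s}"
  have "?V \<subseteq> {..f s}" using f by (auto simp: mono_on_def)
  then have fin: "finite ?V" by (rule finite_subset) auto
  moreover have "?V \<noteq> {}" using s by auto
  ultimately have "Max ?V \<in> ?V" by (rule Max_in)
  then obtain r0 where r0: "r0 \<in> {0..<s}" "f r0 = Max ?V" by auto
  have const: "f r = f r0" if "r0 \<le> r" "r < s" for r
  proof (rule antisym)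
    show "f r \<le> f r0" unfolding r0(2) using that r0 fin by (intro Max_ge) auto
    show "f r0 \<le> f r" using mono_onD[OF f, of r0 r] that r0(1) by auto
  qed
  show ?thesis
  proof (rule that)
    show "0 \<le> r0" "r0 < s" using r0(1) by simp_all
    show "\<forall>r. r0 \<le> r \<longrightarrow> r < s \<longrightarrow> f r = f r0" by (intro allI impI const)
  qed
qed

definition jt :: "(real \<Rightarrow> nat) \<Rightarrow> real \<Rightarrow> real \<Rightarrow> real set" where
  "jt f a b = {s \<in> {a<..b}. real (f s) \<noteq> llim f s}"

lemma jt_increase:
  fixes f :: "real \<Rightarrow> nat"
  assumes f: "mono_on {0..} f" and s: "0 < s" "real (f s) \<noteq> llim f s" and r: "0 \<le> r" "r < s"
  shows "f r < f s"
proof -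
  obtain r0 where r0: "0 \<le> r0" "r0 < s" "\<forall>r. r0 \<le> r \<longrightarrow> r < s \<longrightarrow> f r = f r0"
    using mono_nat_left_const[OF f s(1)] by blast
  have "llim f s = real (f r0)" by (rule llim_eqI[OF r0(2)]) (rule r0(3)[rule_format])
  then have "f s \<noteq> f r0" using s by auto
  moreover have "f r0 \<le> f s" using mono_onD[OF f, of r0 s] r0(1,2) by simp
  moreover have "f r \<le> f r0"
  proof (cases "r \<le> r0")
    case True then show ?thesis using mono_onD[OF f, of r r0] r(1) r0(1) by simp
  next
    case False then show ?thesis using r0(3)[rule_format, of r] r(2) by simp
  qed
  ultimately show ?thesis by linarith
qed

text \<open>At a jump time the path exceeds all its earlier values, so it is injective on jump
  times. Finiteness matters because \<open>jumps\<close> is a cardinality, which is zero for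
  infinite sets.\<close>

lemma jt_finite:
  assumes f: "mono_on {0..} f" and a: "0 \<le> a"
  shows "finite (jt f a b)" and "card (jt f a b) \<le> f b + 1"
proof -
  have inj: "inj_on f (jt f a b)"
  proof (rule inj_onI)
    fix s s' assume s: "s \<in> jt f a b" "s' \<in> jt f a b" "f s = f s'"
    show "s = s'"
      using s a jt_increase[OF f, of s s'] jt_increase[OF f, of s' s]
      by (cases s s' rule: linorder_cases) (auto simp: jt_def)
  qed
  have im: "f ` jt f a b \<subseteq> {..f b}" using f a by (auto simp: jt_def mono_on_def)
  show "finite (jt f a b)" by (rule inj_on_finite[OF inj im]) auto
  show "card (jt f a b) \<le> f b + 1"
    using card_inj_on_le[OF inj im] by simp
qed

lemma mono_nat_const:
  fixes f :: "real \<Rightarrow> nat"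
  assumes "mono_on {0..} f" "0 \<le> a" "f a = f b" "a \<le> r" "r \<le> b"
  shows "f r = f a"
  using mono_onD[OF assms(1), of a r] mono_onD[OF assms(1), of r b] assms by simp

lemma jt_empty:
  assumes f: "mono_on {0..} f" and a: "0 \<le> a" and eq: "f a = f b"
  shows "jt f a b = {}"
proof -
  have "real (f s) = llim f s" if "s \<in> {a<..b}" for s
  proof -
    have "llim f s = real (f a)"
      by (rule llim_eqI[of a], use that in simp, rule mono_nat_const[OF f a eq]) (use that in auto)
    moreover have "f s = f a" by (rule mono_nat_const[OF f a eq]) (use that in auto)
    ultimately show ?thesis by simp
  qed
  then show ?thesis by (auto simp: jt_def)
qed

lemma right_const:
  fixes f :: "real \<Rightarrow> nat"
  assumes "continuous (at_right t) f"
  obtains e where "t < e" "\<forall>r. t \<le> r \<longrightarrow> r < e \<longrightarrow> f r = f t"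
proof -
  have "(f \<longlongrightarrow> f t) (at_right t)"
    using assms by (simp add: continuous_within)
  then have "eventually (\<lambda>r. f r = f t) (at_right t)"
    by (simp add: tendsto_discrete)
  then obtain e where "t < e" "\<And>r. t < r \<Longrightarrow> r < e \<Longrightarrow> f r = f t"
    unfolding eventually_at_right_field by auto
  then have "f r = f t" if "t \<le> r" "r < e" for r
    using that by (cases "r = t") auto
  then show ?thesis using that \<open>t < e\<close> by blast
qed

text \<open>Right-continuity makes the infimum of the times at the new level a time at that level;
  before and after it the path is flat.\<close>

lemma jt_single:
  assumes f: "mono_on {0..} f" and rc: "\<And>t. continuous (at_right t) f"
    and a: "0 \<le> a" "a \<le> b" and one: "f b = f a + 1"
  shows "\<exists>s. a < s \<and> s \<le> b \<and> jt f a b = {s} \<and> (\<forall>r. a \<le> r \<longrightarrow> r < s \<longrightarrow> f r = f a)"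
proof -
  have ab: "a < b" using a one by (cases "a = b") auto
  have le: "f r \<le> f r'" if "a \<le> r" "r \<le> r'" for r r' using f a that by (auto simp: mono_on_def)
  define S where "S = {r\<in>{a..b}. f r = f a + 1}"
  define s where "s = Inf S"
  have bS: "b \<in> S" using ab one by (auto simp: S_def)
  have bdd: "bdd_below S" by (auto simp: S_def bdd_below_def)
  have as: "a \<le> s" unfolding s_def using bS by (intro cInf_greatest) (auto simp: S_def)
  have sb: "s \<le> b" unfolding s_def using bS bdd by (intro cInf_lower) auto
  obtain e where e: "s < e" "\<forall>r. s \<le> r \<longrightarrow> r < e \<longrightarrow> f r = f s"
    using right_const[OF rc, of s] by blast
  obtain r where r: "r \<in> S" "r < e" using cInf_lessD[of S e] bS e unfolding s_def by auto
  have "s \<le> r" unfolding s_def using r bdd by (intro cInf_lower) auto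
  then have fs: "f s = f a + 1" using e(2)[rule_format, of r] r by (auto simp: S_def)
  then have "a < s" using as by (cases "a = s") auto
  have before: "f r = f a" if "a \<le> r" "r < s" for r
  proof -
    have "r \<notin> S" using that bdd cInf_lower[of r S] unfolding s_def by auto
    then have "f r \<noteq> f a + 1" using that sb by (auto simp: S_def)
    moreover have "f a \<le> f r" "f r \<le> f s" using le that \<open>a \<le> s\<close> by auto
    ultimately show ?thesis using fs by linarith
  qed
  have "jt f a b = {s}"
  proof (intro set_eqI iffI)
    fix u assume u: "u \<in> jt f a b"
    show "u \<in> {s}"
    proof (rule ccontr)
      assume "u \<notin> {s}"
      then consider "u < s" | "s < u" by force
      then show False
      proof cases
        case 1
        have "u \<in> jt f a u" using u by (auto simp: jt_def)
        moreover have "f a = f u" using before[of u] 1 u by (auto simp: jt_def)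
        ultimately show False using jt_empty[OF f a(1), of u] by auto
      next
        case 2
        have "u \<in> jt f s u" using u 2 by (auto simp: jt_def)
        moreover have "f s = f u" using fs one le[of s u] le[of u b] 2 u as by (auto simp: jt_def)
        ultimately show False using jt_empty[OF f, of s u] as a by auto
      qed
    qed
  next
    fix u assume "u \<in> {s}"
    moreover have "llim f s = real (f a)" by (rule llim_eqI[OF \<open>a < s\<close> before])
    ultimately show "u \<in> jt f a b" using \<open>a < s\<close> sb fs by (auto simp: jt_def)
  qed
  then show ?thesis using \<open>a < s\<close> sb by (intro exI[of _ s] conjI allI impI before)
qed

context tazrp_process begin

section \<open>Pathwise consequences of the graphical construction\<close>

definition good :: "'a \<Rightarrow> bool" where
  "good w \<longleftrightarrow> (\<forall>x. N w x 0 = 0 \<and> mono_on {0..} (N w x) \<and> (\<forall>t. continuous (at_right t) (N w x))) \<and>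
     (\<forall>x t. 0 \<le> t \<longrightarrow> real (\<eta> w t x) = real (\<eta> w 0 x) - real (jumps \<eta> N w x t) + real (jumps \<eta> N w (x - 1) t))"

lemma AE_good: "AE w in M. good w"
proof -
  have "AE w in M. N w x 0 = 0 \<and> mono_on {0..} (N w x) \<and> (\<forall>t. continuous (at_right t) (N w x))" for x
    using poisson_clock[of x] unfolding poisson_process_def by blast
  then have "AE w in M. \<forall>x. N w x 0 = 0 \<and> mono_on {0..} (N w x) \<and> (\<forall>t. continuous (at_right t) (N w x))"
    by (intro AE_all_countable[THEN iffD2] allI)
  moreover have "AE w in M. \<forall>x t. 0 \<le> t \<longrightarrow> real (\<eta> w t x) = real (\<eta> w 0 x) - real (jumps \<eta> N w x t) + real (jumps \<eta> N w (x - 1) t)"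
    using tazrp unfolding tazrp_def by blast
  ultimately show ?thesis unfolding good_def by (rule AE_conjI)
qed

definition js :: "'a \<Rightarrow> int \<Rightarrow> real \<Rightarrow> real \<Rightarrow> real set" where
  "js w x a b = {s \<in> {a<..b}. real (N w x s) \<noteq> llim (N w x) s \<and> 1 \<le> llim (\<lambda>r. \<eta> w r x) s}"

lemma js_jt: "js w x a b = {s \<in> jt (N w x) a b. 1 \<le> llim (\<lambda>r. \<eta> w r x) s}"
  by (auto simp: js_def jt_def)

context
  fixes w :: 'a
  assumes good: "good w"
begin

lemma clock_mono: "mono_on {0..} (N w x)"
  and clock_0: "N w x 0 = 0"
  and clock_rc: "continuous (at_right t) (N w x)"
  by (rule good[unfolded good_def, THEN conjunct1, THEN spec, of x, THEN conjunct2, THEN conjunct1],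
      rule good[unfolded good_def, THEN conjunct1, THEN spec, of x, THEN conjunct1],
      rule good[unfolded good_def, THEN conjunct1, THEN spec, of x, THEN conjunct2, THEN conjunct2, THEN spec])

lemma clock_le: "0 \<le> s \<Longrightarrow> s \<le> t \<Longrightarrow> N w x s \<le> N w x t"
  by (rule mono_onD[OF clock_mono[of x]]) auto

lemma flux:
  assumes "0 \<le> a" "a \<le> b"
  shows "real (\<eta> w b x) = real (\<eta> w a x) - real (card (js w x a b)) + real (card (js w (x - 1) a b))"
proof -
  have J: "jumps \<eta> N w z b = jumps \<eta> N w z a + card (js w z a b)" for z
  proof -
    have fin: "finite (js w z u v)" if "0 \<le> u" for u v
      unfolding js_jt using jt_finite(1)[OF clock_mono that] by auto
    have "js w z 0 b = js w z 0 a \<union> js w z a b" using assms by (auto simp: js_def)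
    moreover have "js w z 0 a \<inter> js w z a b = {}" by (auto simp: js_def)
    ultimately have "card (js w z 0 b) = card (js w z 0 a) + card (js w z a b)"
      using fin assms by (simp add: card_Un_disjoint)
    then show ?thesis by (simp add: jumps_def js_def)
  qed
  have "real (\<eta> w t x) = real (\<eta> w 0 x) - real (jumps \<eta> N w x t) + real (jumps \<eta> N w (x - 1) t)" if "0 \<le> t" for t
    by (rule good[unfolded good_def, THEN conjunct2, rule_format, OF that])
  from this[of a] this[of b] show ?thesis using J[of x] J[of "x - 1"] assms by simp
qed

lemma js_empty:
  assumes "0 \<le> a" "N w x a = N w x b"
  shows "js w x a b = {}"
  unfolding js_jt jt_empty[OF clock_mono assms] by simp

lemma eta_const:
  assumes "0 \<le> a" "N w x a = N w x b" "N w (x - 1) a = N w (x - 1) b" "a \<le> b"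
  shows "\<eta> w b x = \<eta> w a x"
  using flux[OF assms(1,4), of x] unfolding js_empty[OF assms(1,2)] js_empty[OF assms(1,3)] by simp

lemma eta_right_const:
  assumes "0 \<le> t"
  obtains e where "t < e" "\<forall>r. t \<le> r \<longrightarrow> r < e \<longrightarrow> \<eta> w r x = \<eta> w t x"
proof -
  obtain e1 where e1: "t < e1" "\<forall>r. t \<le> r \<longrightarrow> r < e1 \<longrightarrow> N w x r = N w x t"
    using right_const[OF clock_rc[of t x]] by blast
  obtain e2 where e2: "t < e2" "\<forall>r. t \<le> r \<longrightarrow> r < e2 \<longrightarrow> N w (x - 1) r = N w (x - 1) t"
    using right_const[OF clock_rc[of t "x - 1"]] by blast
  have "\<eta> w r x = \<eta> w t x" if "t \<le> r" "r < min e1 e2" for r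
    using e1(2)[rule_format, of r] e2(2)[rule_format, of r] that assms by (intro eta_const) auto
  moreover have "t < min e1 e2" using e1(1) e2(1) by simp
  ultimately show ?thesis using that by blast
qed

text \<open>Only the clock of the left neighbour lets particles in, and its count at the final time
  bounds the inflow for all \<open>s\<close>. This yields the dominating function for the Riemann
  sums.\<close>

lemma eta_bound:
  assumes "0 \<le> s" "s \<le> t"
  shows "\<eta> w s x \<le> \<eta> w 0 x + N w (x - 1) t + 1"
proof -
  have "card (js w (x - 1) 0 s) \<le> card (jt (N w (x - 1)) 0 s)"
    unfolding js_jt using jt_finite(1)[OF clock_mono, of 0 "x - 1" s] by (intro card_mono) auto
  also have "\<dots> \<le> N w (x - 1) s + 1" using jt_finite(2)[OF clock_mono, of 0 "x - 1" s] by simp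
  also have "\<dots> \<le> N w (x - 1) t + 1" using clock_le assms by auto
  finally show ?thesis using flux[of 0 s x] assms by linarith
qed

text \<open>While the left clock is silent, the occupation of \<open>x\<close> cannot change before
  its own ring, so the left limit at the ring is the value at time \<open>a\<close>.\<close>

lemma js_card_single:
  assumes ab: "0 \<le> a" "a \<le> b" and one: "N w x b = N w x a + 1" and left: "N w (x - 1) b = N w (x - 1) a"
  shows "card (js w x a b) = (if 1 \<le> \<eta> w a x then 1 else 0)"
proof -
  from jt_single[where f = "N w x", OF clock_mono clock_rc ab one]
  obtain s where s0: "a < s \<and> s \<le> b \<and> jt (N w x) a b = {s} \<and> (\<forall>r. a \<le> r \<longrightarrow> r < s \<longrightarrow> N w x r = N w x a)"
    by (rule exE)
  note s = s0[THEN conjunct1] s0[THEN conjunct2, THEN conjunct1] s0[THEN conjunct2, THEN conjunct2, THEN conjunct1]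
    s0[THEN conjunct2, THEN conjunct2, THEN conjunct2]
  have "\<eta> w r x = \<eta> w a x" if "a \<le> r" "r < s" for r
  proof (rule eta_const)
    show "N w x a = N w x r" using s(4)[rule_format, of r] that by simp
    show "N w (x - 1) a = N w (x - 1) r"
      using mono_nat_const[where f = "N w (x - 1)" and b = b and r = r, OF clock_mono ab(1)] left that s(2) by simp
  qed (use ab that in auto)
  then have "llim (\<lambda>r. \<eta> w r x) s = real (\<eta> w a x)" by (rule llim_eqI[OF s(1)])
  then have "js w x a b = (if 1 \<le> \<eta> w a x then {s} else {})" unfolding js_jt s(3) by auto
  then show ?thesis by auto
qed

text \<open>Particles move to the right at rates given by the departure site. The silent clock at
  \<open>y\<close> therefore stops everything that may differ on its left, including particles
  wrapped around the seam, and sites beyond \<open>R\<close> have no influence on those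
  before.\<close>

lemma coupling:
  assumes h: "0 < h" and y: "y \<in> {-R..R}" and silent: "N w y (real m * h) = 0"
    and ok: "\<And>i. i < m \<Longrightarrow> (\<forall>x\<in>{-R..R}. inc h x i w = 0) \<or> (\<exists>x\<in>{-R..R}. sg R h x i w)"
  shows "k \<le> m \<Longrightarrow> y < x \<Longrightarrow> x \<le> R \<Longrightarrow> \<eta> w (real k * h) x = chain R h w k x"
proof (induction k arbitrary: x)
  case 0
  then show ?case using y by auto
next
  case (Suc k)
  let ?a = "real k * h" and ?b = "real (Suc k) * h"
  have ab: "0 \<le> ?a" "?a \<le> ?b" using h by (auto simp: algebra_simps)
  have IH: "\<eta> w ?a z = chain R h w k z" if "y < z" "z \<le> R" for z using Suc that by auto
  have inc0: "N w z ?b = N w z ?a" if "inc h z k w = 0" for z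
    using that clock_le[OF ab, of z] unfolding inc_def by linarith
  have yb: "N w y ?b = 0"
  proof -
    have "?b \<le> real m * h" using Suc.prems h by (intro mult_right_mono) auto
    then show ?thesis using clock_le[of ?b "real m * h" y] ab silent by auto
  qed
  then have ya: "N w y ?a = 0" using clock_le[OF ab, of y] by auto
  have x: "x \<in> {-R..R}" "x - 1 \<in> {-R..R}" using Suc.prems y by auto
  show ?case
  proof (cases "\<exists>z\<in>{-R..R}. sg R h z k w")
    case False
    then have "\<forall>x\<in>{-R..R}. inc h x k w = 0" using ok[of k] Suc.prems by auto
    then have "\<eta> w ?b x = \<eta> w ?a x" using x inc0 ab by (intro eta_const) auto
    then show ?thesis using chain_Suc_none[OF False] IH Suc.prems by simp
  next
    case True
    then obtain z where z: "z \<in> {-R..R}" "sg R h z k w" by auto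
    have others: "N w v ?b = N w v ?a" if "v \<in> {-R..R}" "v \<noteq> z" for v
      using z(2) that inc0 unfolding sg_def by auto
    have one: "N w z ?b = N w z ?a + 1" using z(2) clock_le[OF ab, of z] unfolding sg_def inc_def by linarith
    have zy: "z \<noteq> y" using one yb ya by auto
    have ch: "chain R h w (Suc k) = mv R z (chain R h w k)" by (rule chain_Suc_sg[OF z])
    \<comment> \<open>Hence a jump across the seam never lands on \<open>x\<close>.\<close>
    have xR: "x \<noteq> - R" using Suc.prems y by auto
    have jz: "card (js w z ?a ?b) = (if 1 \<le> chain R h w k z then 1 else 0)" if "y < z"
    proof -
      have "z - 1 \<in> {-R..R}" using that z y by auto
      then have "N w (z - 1) ?b = N w (z - 1) ?a" using others by auto
      then show ?thesis using js_card_single[OF ab one] IH[of z] that z by auto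
    qed
    consider "z = x" | "z = x - 1" | "z \<noteq> x" "z \<noteq> x - 1" by auto
    then show ?thesis
    proof cases
      case 1
      have "js w (x - 1) ?a ?b = {}" using others[of "x - 1"] x 1 ab by (intro js_empty) auto
      then have "real (\<eta> w ?b x) = real (chain R h w k x) - (if 1 \<le> chain R h w k x then 1 else 0)"
        using flux[OF ab, of x] jz 1 Suc.prems IH[of x] by simp
      moreover have "rnext R x \<noteq> x" using xR by (auto simp: rnext_def)
      ultimately show ?thesis unfolding ch 1 mv_def by (auto split: if_splits)
    next
      case 2
      have "js w x ?a ?b = {}" using others[of x] x 2 ab by (intro js_empty) auto
      moreover have yz: "y < z" using 2 zy Suc.prems by auto
      ultimately have "real (\<eta> w ?b x) = real (chain R h w k x) + (if 1 \<le> chain R h w k z then 1 else 0)"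
        using flux[OF ab, of x] jz[OF yz] 2 Suc.prems IH[of x] by simp
      moreover have "rnext R z = x" using 2 Suc.prems by (auto simp: rnext_def)
      ultimately show ?thesis unfolding ch mv_def using 2 by (auto split: if_splits)
    next
      case 3
      have "\<eta> w ?b x = \<eta> w ?a x" using others x 3 ab by (intro eta_const) auto
      moreover have "rnext R z \<noteq> x" using 3 xR by (auto simp: rnext_def)
      ultimately show ?thesis unfolding ch mv_def using 3 IH Suc.prems by auto
    qed
  qed
qed

end

section \<open>Summable probability of a failed coupling\<close>

definition okint :: "int \<Rightarrow> real \<Rightarrow> nat \<Rightarrow> 'a \<Rightarrow> bool" where
  "okint R h i w \<longleftrightarrow> (\<forall>x\<in>{-R..R}. inc h x i w = 0) \<or> (\<exists>x\<in>{-R..R}. sg R h x i w)"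

lemma measurable_sg [measurable]: "Measurable.pred M (sg R h x i)"
  unfolding sg_def by measurable

lemma measurable_okint [measurable]: "Measurable.pred M (okint R h i)"
  unfolding okint_def by measurable

text \<open>With \<open>L\<close> clocks, no ring or one single ring has probability
  \<open>exp (- (L * h)) * (1 + L * h)\<close>, so failure is of second order in
  \<open>L * h\<close>.\<close>

lemma prob_not_okint:
  fixes h :: real
  assumes R: "0 \<le> R" and h: "0 < h"
  shows "prob {w\<in>space M. \<not> okint R h i w} \<le> (card {-R..R} * h)\<^sup>2"
proof -
  let ?W = "{-R..R}"
  define L where "L = real (card ?W)"
  let ?Z = "{w\<in>space M. \<forall>x\<in>?W. inc h x i w = 0}"
  let ?S = "\<lambda>x. {w\<in>space M. sg R h x i w}"
  have W: "finite ?W" "?W \<noteq> {}" using R by auto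
  have pZ: "prob ?Z = exp (- h) ^ card ?W"
  proof -
    define C where "C x j = (if j = i then {0} else (UNIV :: nat set))" for x :: int and j :: nat
    have "?Z = {w\<in>space M. (\<forall>x\<in>?W. \<eta> w 0 x \<in> UNIV) \<and> (\<forall>x\<in>?W. \<forall>j<Suc i. inc h x j w \<in> C x j)}"
      by (auto simp: C_def)
    then have "prob ?Z = prob {w\<in>space M. \<forall>x\<in>?W. \<eta> w 0 x \<in> UNIV} * (\<Prod>x\<in>?W. \<Prod>j<Suc i. prob {w\<in>space M. inc h x j w \<in> C x j})"
      using prob_joint[OF h W, where A = "\<lambda>_. UNIV" and m = "Suc i" and C = C] by simp
    moreover have "(\<Prod>j<Suc i. prob {w\<in>space M. inc h x j w \<in> C x j}) = exp (- h)" for x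
      using prob_inc[of h x i 0] h by (simp add: C_def prob_space)
    ultimately show ?thesis by (simp only: prod_constant) (simp add: prob_space)
  qed
  have pS: "prob (?S x) = pr R h" if "x \<in> ?W" for x
    using past_indep[OF h R that sigma_sets_top, of i] by (simp add: prob_space Int_absorb1 Collect_restrict)
  have disj: "disjoint_family_on ?S ?W"
    unfolding disjoint_family_on_def using sg_unique by blast
  have "prob (?Z \<union> (\<Union>x\<in>?W. ?S x)) = prob ?Z + prob (\<Union>x\<in>?W. ?S x)"
  proof (rule finite_measure_Union)
    show "?Z \<inter> (\<Union>x\<in>?W. ?S x) = {}" by (auto simp: sg_def)
  qed auto
  also have "prob (\<Union>x\<in>?W. ?S x) = (\<Sum>x\<in>?W. prob (?S x))"
    by (rule finite_measure_finite_Union) (use disj in auto)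
  also have "\<dots> = L * pr R h" using pS by (simp add: L_def)
  also have "?Z \<union> (\<Union>x\<in>?W. ?S x) = {w\<in>space M. okint R h i w}" by (auto simp: okint_def)
  finally have "prob {w\<in>space M. okint R h i w} = exp (- h) ^ card ?W * (1 + L * h)"
    unfolding pZ pr_def by (simp add: algebra_simps)
  also have "exp (- h) ^ card ?W = exp (- (L * h))"
    unfolding L_def by (simp add: exp_of_nat_mult[symmetric])
  also have "exp (- (L * h)) * (1 + L * h) \<ge> (1 - L * h) * (1 + L * h)"
    using exp_ge_add_one_self[of "- (L * h)"] h by (intro mult_right_mono) (auto simp: L_def)
  finally have "prob {w\<in>space M. okint R h i w} \<ge> 1 - (L * h)\<^sup>2"
    by (simp add: power2_eq_square algebra_simps)
  moreover have "{w\<in>space M. \<not> okint R h i w} = space M - {w\<in>space M. okint R h i w}" by auto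
  then have "prob {w\<in>space M. \<not> okint R h i w} = 1 - prob {w\<in>space M. okint R h i w}"
    using prob_compl[of "{w\<in>space M. okint R h i w}"] by simp
  ultimately show ?thesis by (simp add: L_def)
qed

text \<open>Failure within one step costs the square of ring size times step length; over all steps
  this is of order \<open>j^2 / steps j\<close>. The fourth power makes it summable, as
  Borel-Cantelli requires.\<close>

definition steps :: "nat \<Rightarrow> nat" where "steps j = (j + 1) ^ 4"

definition dt :: "real \<Rightarrow> nat \<Rightarrow> real" where "dt T j = T / real (steps j)"

text \<open>The ring has radius \<open>2 * j\<close>, the observed window radius \<open>j\<close>;
  the shielding site is sought in the gap to the left of the window. \<open>inc T y 0\<close> counts
  all rings of a clock up to \<open>T\<close>.\<close>

definition bad :: "real \<Rightarrow> nat \<Rightarrow> 'a set" where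
  "bad T j = (\<Union>i<steps j. {w\<in>space M. \<not> okint (2 * int j) (dt T j) i w})
     \<union> {w\<in>space M. \<forall>y\<in>{- 2 * int j..- int j - 1}. inc T y 0 w \<noteq> 0}"

lemma bad_events [measurable]: "bad T j \<in> events"
  unfolding bad_def by measurable

lemma prob_all_ring:
  assumes T: "0 < T"
  shows "prob {w\<in>space M. \<forall>y\<in>{- 2 * int j..- int j - 1}. inc T y 0 w \<noteq> 0} \<le> (1 - exp (- T)) ^ j"
proof (cases "j = 0")
  case False
  let ?W = "{- 2 * int j..- int j - 1}"
  have W: "finite ?W" "?W \<noteq> {}" "card ?W = j" using False by auto
  have "prob {w\<in>space M. inc T y 0 w \<in> - {0}} = 1 - exp (- T)" for y
  proof -
    have "{w\<in>space M. inc T y 0 w \<in> - {0}} = space M - {w\<in>space M. inc T y 0 w = 0}" by auto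
    then show ?thesis using prob_compl[of "{w\<in>space M. inc T y 0 w = 0}"] prob_inc[of T y 0 0] T by simp
  qed
  moreover have "{w\<in>space M. \<forall>y\<in>?W. inc T y 0 w \<noteq> 0}
      = {w\<in>space M. (\<forall>x\<in>?W. \<eta> w 0 x \<in> UNIV) \<and> (\<forall>x\<in>?W. \<forall>i<1. inc T x i w \<in> - {0})}" by auto
  ultimately have "prob {w\<in>space M. \<forall>y\<in>?W. inc T y 0 w \<noteq> 0} = (1 - exp (- T)) ^ j"
    using prob_joint[OF T W(1,2), of "\<lambda>_. UNIV" 1 "\<lambda>_ _. - {0}"] W(3) by (simp add: prob_space)
  then show ?thesis by simp
qed simp

lemma prob_bad:
  assumes T: "0 < T"
  shows "prob (bad T j) \<le> 16 * T\<^sup>2 * (1 / real (j + 1) ^ 2) + (1 - exp (- T)) ^ j"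
proof -
  let ?R = "2 * int j"
  have dt: "0 < dt T j" using T by (simp add: dt_def steps_def)
  have "prob (bad T j) \<le> prob (\<Union>i<steps j. {w\<in>space M. \<not> okint ?R (dt T j) i w})
     + prob {w\<in>space M. \<forall>y\<in>{- 2 * int j..- int j - 1}. inc T y 0 w \<noteq> 0}"
    unfolding bad_def by (rule measure_Un_le) auto
  also have "prob (\<Union>i<steps j. {w\<in>space M. \<not> okint ?R (dt T j) i w})
     \<le> (\<Sum>i<steps j. prob {w\<in>space M. \<not> okint ?R (dt T j) i w})"
    by (rule finite_measure_subadditive_finite) auto
  also have "\<dots> \<le> (\<Sum>i<steps j. (card {-?R..?R} * dt T j)\<^sup>2)"
    by (intro sum_mono prob_not_okint dt) auto
  also have "\<dots> = real (steps j) * (real (4 * j + 1) * dt T j)\<^sup>2"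
    by (simp add: nat_add_distrib nat_mult_distrib)
  also have "\<dots> \<le> real (steps j) * (4 * real (j + 1) * dt T j)\<^sup>2"
    using dt by (intro mult_left_mono power_mono mult_right_mono) auto
  also have "\<dots> = 16 * T\<^sup>2 * (1 / real (j + 1) ^ 2)"
  proof -
    have "q ^ 4 * (4 * q * (T / q ^ 4))\<^sup>2 = 16 * T\<^sup>2 * (1 / q ^ 2)" if "0 < q" for q :: real
      using that by (simp add: field_simps power2_eq_square power4_eq_xxxx)
    from this[of "real (j + 1)"] show ?thesis by (simp add: dt_def steps_def)
  qed
  finally show ?thesis using prob_all_ring[OF T, of j] by linarith
qed

lemma AE_eventually_not_bad:
  assumes T: "0 < T"
  shows "AE w in M. eventually (\<lambda>j. w \<notin> bad T j) sequentially"
proof -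
  have "summable (\<lambda>j. 16 * T\<^sup>2 * (1 / real (j + 1) ^ 2) + (1 - exp (- T)) ^ j)"
  proof (intro summable_add summable_mult)
    show "summable (\<lambda>j. 1 / real (j + 1) ^ 2)"
      using inverse_squares_sums[THEN sums_summable] by (simp add: add.commute)
    show "summable (\<lambda>j. (1 - exp (- T)) ^ j)" using T by (intro summable_geometric) auto
  qed
  then have "summable (\<lambda>j. prob (bad T j))"
    by (rule summable_comparison_test'[where N = 0]) (use prob_bad[OF T] in auto)
  then have "AE w in M. eventually (\<lambda>j. w \<in> space M - bad T j) sequentially"
    by (intro borel_cantelli_AE1) (auto simp: emeasure_eq_measure)
  then show ?thesis by eventually_elim (auto elim: eventually_mono)
qed

lemma coupling_not_bad:
  assumes good: "good w" and w: "w \<in> space M" "w \<notin> bad T j" and T: "0 < T"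
    and l: "l \<le> steps j" and x: "x \<in> {- int j..int j}"
  shows "\<eta> w (real l * dt T j) x = chain (2 * int j) (dt T j) w l x"
proof -
  obtain y where y: "y \<in> {- 2 * int j..- int j - 1}" "inc T y 0 w = 0"
    using w unfolding bad_def by blast
  have dt: "0 < dt T j" using T by (simp add: dt_def steps_def)
  have mT: "real (steps j) * dt T j = T" by (simp add: dt_def steps_def)
  have N: "N w y (real (steps j) * dt T j) = 0"
    using y(2) clock_0[OF good, of y] unfolding mT inc_def by simp
  have ok: "(\<forall>x\<in>{-(2 * int j)..2 * int j}. inc (dt T j) x i w = 0) \<or> (\<exists>x\<in>{-(2 * int j)..2 * int j}. sg (2 * int j) (dt T j) x i w)"
    if "i < steps j" for i
    using w that unfolding bad_def okint_def by blast
  show ?thesis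
    by (rule coupling[OF good dt _ N ok l]) (use x y in auto)
qed

end

section \<open>Passage to the limit\<close>

lemma integrable_real_poisson_pmf:
  assumes "0 < T"
  shows "integrable (poisson_pmf T) real"
proof -
  have 1: "summable (\<lambda>k. (exp (- T) * T) * (T ^ k / fact k))"
    using summable_exp[of T] by (intro summable_mult) (simp add: field_simps)
  have eq: "(exp (- T) * T) * (T ^ k / fact k) = T ^ Suc k / fact (Suc k) * exp (- T) * real (Suc k)" for k
    by (simp add: field_simps del: of_nat_Suc)
  have "summable (\<lambda>k. T ^ Suc k / fact (Suc k) * exp (- T) * real (Suc k))"
    using 1 unfolding eq .
  then have "summable (\<lambda>k. T ^ k / fact k * exp (- T) * real k)"
    by (subst (asm) summable_Suc_iff)
  then show ?thesis
    unfolding measure_pmf_eq_density using assms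
    by (subst integrable_density) (auto simp: integrable_count_space_nat_iff abs_mult)
qed

context tazrp_process begin

lemma distr_inc:
  assumes "0 < T"
  shows "distr M (count_space UNIV) (inc T x i) = measure_pmf (poisson_pmf T)"
proof (rule measure_eqI_countable[where A = UNIV])
  fix k :: nat
  have "inc T x i -` {k} \<inter> space M = {w \<in> space M. inc T x i w = k}" by auto
  then have "emeasure (distr M (count_space UNIV) (inc T x i)) {k} = ennreal (exp (- T) * T ^ k / fact k)"
    using prob_inc[of T x i k] assms by (subst emeasure_distr) (auto simp: emeasure_eq_measure)
  then show "emeasure (distr M (count_space UNIV) (inc T x i)) {k} = emeasure (measure_pmf (poisson_pmf T)) {k}"
    using assms by (simp add: emeasure_pmf_single mult.commute)
qed auto

text \<open>The sum has finite expectation, hence is almost surely finite. Its terms will dominate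
  the spatial sums throughout the time interval.\<close>

lemma AE_weights_summable:
  assumes T: "0 < T" and C: "0 \<le> C" and a: "\<And>A. (\<Sum>x\<in>{-int A..int A}. \<bar>a x\<bar>) \<le> Ba"
  shows "AE w in M. (\<lambda>x. \<bar>a x\<bar> * (C + real (\<eta> w 0 x) + real (inc T (x - 1) 0 w))) summable_on UNIV"
proof -
  define f where "f x w = \<bar>a x\<bar> * (C + real (\<eta> w 0 x) + real (inc T (x - 1) 0 w))" for x w
  define u where "u A w = (\<Sum>x\<in>{-int A..int A}. f x w)" for A :: nat and w
  define E where "E = C + Egeo \<rho> real + measure_pmf.expectation (poisson_pmf T) real"
  have fpos: "0 \<le> f x w" for x w using C by (simp add: f_def)
  have p: "1 / (1 + \<rho>) \<in> {0<..1}" using rho_pos by auto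
  have i1: "integrable M (\<lambda>w. real (\<eta> w 0 x))" for x
    by (rule integrable_eta0) (use integrable_real_geometric_pmf[OF p] in \<open>simp add: geo_def\<close>)
  have i2: "integrable M (\<lambda>w. real (inc T x 0 w))" for x
    using integrable_distr[of "inc T x 0" M "count_space UNIV" real] integrable_real_poisson_pmf[OF T]
    by (simp add: distr_inc[OF T])
  have e2: "(\<integral>w. real (inc T x 0 w) \<partial>M) = measure_pmf.expectation (poisson_pmf T) real" for x
    using integral_distr[of "inc T x 0" M "count_space UNIV" real] by (simp add: distr_inc[OF T])
  have fi: "integrable M (f x)" for x unfolding f_def using i1 i2 by auto
  have fe: "(\<integral>w. f x w \<partial>M) = \<bar>a x\<bar> * E" for x
    unfolding f_def E_def using i1 i2 e2 expectation_eta0[of real x] by (simp add: prob_space)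
  have E: "0 \<le> E" unfolding E_def using C by (intro add_nonneg_nonneg Bochner_Integration.integral_nonneg) auto
  have ui: "integrable M (u A)" for A unfolding u_def using fi by auto
  have upos: "0 \<le> u A w" for A w unfolding u_def using fpos by (intro sum_nonneg) auto
  have ue: "(\<integral>w. u A w \<partial>M) \<le> Ba * E" for A
    unfolding u_def using fi a[of A] E
    by (simp add: Bochner_Integration.integral_sum fe sum_distrib_right[symmetric] mult_right_mono)
  have mono: "u A w \<le> u A' w" if "A \<le> A'" for A A' w
    unfolding u_def using that fpos by (intro sum_mono2) auto
  have "(\<integral>\<^sup>+w. (SUP A. ennreal (u A w)) \<partial>M) = (SUP A. \<integral>\<^sup>+w. ennreal (u A w) \<partial>M)"
    using ui mono by (intro nn_integral_monotone_convergence_SUP) (auto simp: incseq_def le_fun_def intro: ennreal_leI)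
  also have "\<dots> \<le> ennreal (Ba * E)"
    using ui upos ue by (intro SUP_least) (simp add: nn_integral_eq_integral ennreal_leI)
  finally have "(\<integral>\<^sup>+w. (SUP A. ennreal (u A w)) \<partial>M) \<noteq> \<infinity>" by (auto simp: top_unique)
  then have "AE w in M. (SUP A. ennreal (u A w)) \<noteq> \<infinity>"
    using ui by (intro nn_integral_PInf_AE) auto
  then show ?thesis
  proof eventually_elim
    case (elim w)
    define r where "r = enn2real (SUP A. ennreal (u A w))"
    have ur: "u A w \<le> r" for A
    proof -
      have "(SUP A. ennreal (u A w)) < top" 
        using elim unfolding infinity_ennreal_def by (rule top.not_eq_extremum[THEN iffD1])
      then have "ennreal r = (SUP A. ennreal (u A w))" unfolding r_def by (rule ennreal_enn2real)
      then have "ennreal (u A w) \<le> ennreal r" by (auto intro: SUP_upper)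
      then show ?thesis by (simp add: ennreal_le_iff r_def)
    qed
    have "(\<lambda>x. f x w) summable_on UNIV"
    proof (rule nonneg_bdd_above_summable_on)
      show "bdd_above (sum (\<lambda>x. f x w) ` {F. F \<subseteq> UNIV \<and> finite F})"
      proof (rule bdd_aboveI2)
        fix F :: "int set" assume F: "F \<in> {F. F \<subseteq> UNIV \<and> finite F}"
        define A where "A = nat (Max (insert 0 (abs ` F)))"
        have "F \<subseteq> {-int A..int A}"
        proof
          fix x assume "x \<in> F"
          then have "\<bar>x\<bar> \<le> Max (insert 0 (abs ` F))" using F by (intro Max_ge) auto
          then show "x \<in> {-int A..int A}" by (auto simp: A_def)
        qed
        then have "sum (\<lambda>x. f x w) F \<le> u A w" unfolding u_def using fpos by (intro sum_mono2) auto
        then show "sum (\<lambda>x. f x w) F \<le> r" using ur[of A] by linarith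
      qed
    qed (use fpos in auto)
    then show ?case by (simp add: f_def)
  qed
qed

lemma measurable_chain [measurable]: "(\<lambda>w. chain R h w l x) \<in> measurable M (count_space UNIV)"
proof (rule measurable_count_space_eq2_countable[THEN iffD2], intro conjI ballI)
  fix k :: nat
  have "(\<lambda>w. chain R h w l x) -` {k} \<inter> space M = {w\<in>space M. chain R h w l \<in> {c. c x = k}}" by auto
  then show "(\<lambda>w. chain R h w l x) -` {k} \<inter> space M \<in> events"
    using chain_events[of R h l "{c. c x = k}"] by (simp only:)
qed auto

lemma steps_ge: "real (j + 1) \<le> real (steps j)" and steps_pos: "0 < steps j"
proof -
  have "real (j + 1) ^ 1 \<le> real (j + 1) ^ 4" by (intro power_increasing) auto
  then show "real (j + 1) \<le> real (steps j)" by (simp add: steps_def)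
qed (simp add: steps_def)

text \<open>The product in the first claim appears in the denominator of the current term once the
  squared mesh of the Riemann sum is multiplied in. Its limit is \<open>T\<close> because steps with
  several rings become negligible.\<close>

lemma rate_tendsto:
  assumes T: "0 < T"
  shows "(\<lambda>j. real (steps j) * pr (2 * int j) (dt T j)) \<longlonglongrightarrow> T"
    and "(\<lambda>j. real (card {- (2 * int j)..2 * int j}) * dt T j) \<longlonglongrightarrow> 0"
proof -
  let ?L = "\<lambda>j. real (card {- (2 * int j)..2 * int j})"
  have L: "?L j = 4 * real j + 1" for j by simp
  have inv: "(\<lambda>j. c / real (j + 1)) \<longlonglongrightarrow> 0" for c :: real
    using LIMSEQ_Suc[OF lim_const_over_n[of c]] by (simp add: add.commute)
  show lim: "(\<lambda>j. ?L j * dt T j) \<longlonglongrightarrow> 0"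
  proof (rule tendsto_sandwich[OF _ _ tendsto_const inv[of "4 * T"]])
    show "eventually (\<lambda>j. 0 \<le> ?L j * dt T j) sequentially"
      using T by (intro always_eventually allI) (auto simp: dt_def)
    show "eventually (\<lambda>j. ?L j * dt T j \<le> 4 * T / real (j + 1)) sequentially"
    proof (intro always_eventually allI)
      fix j
      have "?L j * dt T j \<le> 4 * real (j + 1) * (T / real (steps j))"
        unfolding L dt_def using T by (intro mult_right_mono) auto
      also have "\<dots> = 4 * T / real (j + 1) ^ 3"
      proof -
        have "4 * q * (T / q ^ 4) = 4 * T / q ^ 3" if "0 < q" for q :: real
          using that by (simp add: field_simps power4_eq_xxxx power3_eq_cube)
        from this[of "real (j + 1)"] show ?thesis by (simp add: steps_def)
      qed
      also have "\<dots> \<le> 4 * T / real (j + 1) ^ 1"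
        using T by (intro divide_left_mono power_increasing mult_pos_pos) auto
      finally show "?L j * dt T j \<le> 4 * T / real (j + 1)" by simp
    qed
  qed
  have "real (steps j) * pr (2 * int j) (dt T j) = T * exp (- (?L j * dt T j))" for j
    using steps_pos[of j] unfolding pr_def dt_def by (simp add: exp_of_nat_mult[symmetric])
  moreover have "(\<lambda>j. T * exp (- (?L j * dt T j))) \<longlonglongrightarrow> T * exp (- 0)"
    by (intro tendsto_intros lim)
  ultimately show "(\<lambda>j. real (steps j) * pr (2 * int j) (dt T j)) \<longlonglongrightarrow> T" by simp
qed

text \<open>\<open>K\<close> stays fixed while ring and time step are refined and is optimised only
  afterwards. Absolute sums of \<open>a\<close> serve the convergence, square sums the
  variance.\<close>

lemma boltzmann_gibbs_bound:
  assumes t: "0 < t" and \<kappa>: "0 < \<kappa>" and K: "1 \<le> K"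
    and a1: "\<And>A. (\<Sum>x\<in>{-int A..int A}. \<bar>a x\<bar>) \<le> Ba"
    and a2: "\<And>A. (\<Sum>x\<in>{-int A..int A}. (a x)\<^sup>2) \<le> s2"
  shows "(\<integral>\<^sup>+w. ennreal ((LBINT s=0..t. (\<Sum>\<^sub>\<infinity>x. a x * Vg \<rho> (\<eta> w (s * \<kappa>) x)))\<^sup>2) \<partial>M)
     \<le> ennreal ((vr \<rho> + 1) * s2 * t\<^sup>2 * (32 * real K / (\<kappa> * t) + 2 / real K))"
proof -
  define T where "T = \<kappa> * t"
  have T: "0 < T" using t \<kappa> by (simp add: T_def)
  define Y where "Y w = (LBINT s=0..t. (\<Sum>\<^sub>\<infinity>x. a x * Vg \<rho> (\<eta> w (s * \<kappa>) x)))" for w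
  define D where "D j w = (\<Sum>l=1..steps j. \<Sum>x\<in>{-int j..int j}. a x * Vg \<rho> (chain (2 * int j) (dt T j) w l x))" for j w
  have s2: "0 \<le> s2" using a2[of 0] by (simp add: order_trans[OF zero_le_power2])
  have [measurable]: "D j \<in> borel_measurable M" for j unfolding D_def by measurable
  have r2: "0 \<le> 2 + \<rho>" using rho_pos by simp
  \<comment> \<open>Almost surely, from some \<open>j\<close> on, chain and process agree in the
    window at all grid times, so \<open>D j\<close> is eventually a Riemann sum of the process
    itself.\<close>
  have conv: "AE w in M. (\<lambda>j. t / real (steps j) * D j w) \<longlonglongrightarrow> Y w"
    using AE_good AE_eventually_not_bad[OF T] AE_space
      AE_weights_summable[OF T r2 a1]
  proof eventually_elim
    case (elim w)
    note good = elim(1)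
    let ?\<phi> = "\<lambda>x s. a x * Vg \<rho> (\<eta> w (s * \<kappa>) x)"
    let ?b = "\<lambda>x. \<bar>a x\<bar> * (2 + \<rho> + real (\<eta> w 0 x) + real (inc T (x - 1) 0 w))"
    have "(\<lambda>j. (t / real (steps j)) * (\<Sum>l=1..steps j. \<Sum>x\<in>{-int j..int j}. ?\<phi> x (real l * (t / real (steps j)))))
      \<longlonglongrightarrow> (LBINT s=0..t. (\<Sum>\<^sub>\<infinity>x. ?\<phi> x s))"
    proof (rule riemann_sums_converge[OF t, where b = ?b])
      show "1 \<le> steps j" for j using steps_pos[of j] by simp
      show "filterlim (\<lambda>j. real (steps j)) at_top sequentially"
      proof (rule filterlim_at_top_mono)
        show "filterlim real at_top sequentially" by (rule filterlim_real_sequentially)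
        show "eventually (\<lambda>j. real j \<le> real (steps j)) sequentially"
        proof (intro always_eventually allI)
          fix j show "real j \<le> real (steps j)" using steps_ge[of j] by simp
        qed
      qed
      show "\<exists>e>s. \<forall>r. s \<le> r \<longrightarrow> r < e \<longrightarrow> ?\<phi> x r = ?\<phi> x s" if s: "0 \<le> s" for x s
      proof -
        have "0 \<le> s * \<kappa>" using s \<kappa> by simp
        then obtain e where e: "s * \<kappa> < e" "\<forall>r. s * \<kappa> \<le> r \<longrightarrow> r < e \<longrightarrow> \<eta> w r x = \<eta> w (s * \<kappa>) x"
          using eta_right_const[OF good, of "s * \<kappa>" x] by blast
        show ?thesis
        proof (intro exI[of _ "e / \<kappa>"] conjI allI impI)
          show "s < e / \<kappa>" using e(1) \<kappa> by (simp add: field_simps)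
          fix r assume r: "s \<le> r" "r < e / \<kappa>"
          have "s * \<kappa> \<le> r * \<kappa>" "r * \<kappa> < e" using r \<kappa> by (auto simp: field_simps)
          then have "\<eta> w (r * \<kappa>) x = \<eta> w (s * \<kappa>) x" using e(2)[rule_format, of "r * \<kappa>"] by simp
          then show "?\<phi> x r = ?\<phi> x s" by simp
        qed
      qed
      show "\<bar>?\<phi> x s\<bar> \<le> ?b x" if s: "0 \<le> s" "s \<le> t" for x s
      proof -
        have sT: "0 \<le> s * \<kappa>" "s * \<kappa> \<le> T" using s \<kappa> by (auto simp: T_def)
        have N: "N w (x - 1) T = inc T (x - 1) 0 w" using clock_0[OF good, of "x - 1"] by (simp add: inc_def)
        have "\<eta> w (s * \<kappa>) x \<le> \<eta> w 0 x + inc T (x - 1) 0 w + 1"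
          using eta_bound[OF good sT, of x] unfolding N .
        then have "real (\<eta> w (s * \<kappa>) x) \<le> real (\<eta> w 0 x) + real (inc T (x - 1) 0 w) + 1" by linarith
        then have "\<bar>Vg \<rho> (\<eta> w (s * \<kappa>) x)\<bar> \<le> 2 + \<rho> + real (\<eta> w 0 x) + real (inc T (x - 1) 0 w)"
          using abs_Vg_le[OF rho_pos, of "\<eta> w (s * \<kappa>) x"] rho_pos unfolding hat_def by linarith
        then show ?thesis unfolding abs_mult by (intro mult_left_mono) auto
      qed
      show "?b summable_on UNIV" using elim(4) .
    qed
    then show "(\<lambda>j. t / real (steps j) * D j w) \<longlonglongrightarrow> Y w"
      unfolding Y_def
    proof (rule Lim_transform_eventually)
      show "eventually (\<lambda>j. (t / real (steps j)) * (\<Sum>l=1..steps j. \<Sum>x\<in>{-int j..int j}. ?\<phi> x (real l * (t / real (steps j))))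
        = t / real (steps j) * D j w) sequentially"
        using elim(2)
      proof eventually_elim
        case (elim j)
        have "real l * (t / real (steps j)) * \<kappa> = real l * dt T j" for l by (simp add: dt_def T_def mult_ac)
        then show ?case
          unfolding D_def using coupling_not_bad[OF good \<open>w \<in> space M\<close> elim T] by simp
      qed
    qed
  qed
  define B where "B j = 32 * real (steps j) * real K / pr (2 * int j) (dt T j)
     + 16 * (int j + 1) + 2 * (real (steps j))\<^sup>2 / real K" for j
  define c where "c j = (t / real (steps j))\<^sup>2 * ((vr \<rho> + 1) * s2 * B j)" for j
  have Dbound: "eventually (\<lambda>j. (\<integral>\<^sup>+w. ennreal ((t / real (steps j) * D j w)\<^sup>2) \<partial>M) \<le> ennreal (c j)) sequentially"
  proof -
    have "eventually (\<lambda>j. real (card {- (2 * int j)..2 * int j}) * dt T j < 1) sequentially"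
      by (rule order_tendstoD(2)[OF rate_tendsto(2)[OF T]]) simp
    then show ?thesis using eventually_ge_at_top[of K]
    proof eventually_elim
      case (elim j)
      \<comment> \<open>The weights are cut to the window to have finite support;
        \<open>K \<le> j\<close> leaves room for the averaging windows, as
        \<open>j + K \<le> 2 * j\<close>.\<close>
      let ?R = "2 * int j" and ?a = "\<lambda>x. if x \<in> {-int j..int j} then a x else 0"
      have dt: "0 < dt T j" using T steps_pos[of j] by (simp add: dt_def)
      have pr: "pr ?R (dt T j) \<le> dt T j"
        unfolding pr_def using dt by (intro mult_left_le power_le_one) auto
      then have "pr ?R (dt T j) * card {-?R..?R} \<le> dt T j * card {-?R..?R}" by (intro mult_right_mono) auto
      then have pc: "pr ?R (dt T j) * card {-?R..?R} \<le> 1" 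
        using elim(1) unfolding mult.commute[of "dt T j"] by linarith
      have R: "1 \<le> ?R" using elim(2) K by simp
      have ppos: "0 < pr ?R (dt T j)" by (rule pr_pos[OF R dt pc])
      have "(\<integral>\<^sup>+w. ennreal ((\<Sum>l=1..steps j. \<Sum>x\<in>{-int j..int j}. ?a x * Vg \<rho> (chain ?R (dt T j) w l x))\<^sup>2) \<partial>M)
        \<le> ennreal ((vr \<rho> + 1) * (\<Sum>x\<in>{-int j..int j}. (?a x)\<^sup>2) * B j)"
        unfolding B_def by (rule chain_square_bound[OF R dt pc K]) (use elim in auto)
      also have "(\<Sum>x\<in>{-int j..int j}. (?a x)\<^sup>2) = (\<Sum>x\<in>{-int j..int j}. (a x)\<^sup>2)" by simp
      also have "(\<lambda>w. \<Sum>l=1..steps j. \<Sum>x\<in>{-int j..int j}. ?a x * Vg \<rho> (chain ?R (dt T j) w l x)) = D j"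
        by (auto simp: D_def fun_eq_iff)
      also have "ennreal ((vr \<rho> + 1) * (\<Sum>x\<in>{-int j..int j}. (a x)\<^sup>2) * B j)
        \<le> ennreal ((vr \<rho> + 1) * s2 * B j)"
        using a2[of j] vr_nonneg ppos unfolding B_def
        by (intro ennreal_leI mult_right_mono mult_left_mono add_nonneg_nonneg) auto
      finally have *: "(\<integral>\<^sup>+w. ennreal ((D j w)\<^sup>2) \<partial>M) \<le> ennreal ((vr \<rho> + 1) * s2 * B j)" .
      have "(\<integral>\<^sup>+w. ennreal ((t / real (steps j) * D j w)\<^sup>2) \<partial>M) = ennreal ((t / real (steps j))\<^sup>2) * (\<integral>\<^sup>+w. ennreal ((D j w)\<^sup>2) \<partial>M)"
      proof -
        have "ennreal ((t / real (steps j) * D j w)\<^sup>2) = ennreal ((t / real (steps j))\<^sup>2) * ennreal ((D j w)\<^sup>2)" for w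
          unfolding power_mult_distrib by (rule ennreal_mult) simp_all
        then show ?thesis by (simp only:) (rule nn_integral_cmult, measurable)
      qed
      also have "\<dots> \<le> ennreal ((t / real (steps j))\<^sup>2) * ennreal ((vr \<rho> + 1) * s2 * B j)"
        by (intro mult_left_mono *) auto
      also have "\<dots> = ennreal (c j)"
        unfolding c_def by (rule ennreal_mult'[symmetric]) simp
      finally show ?case .
    qed
  qed
  \<comment> \<open>The boundary term is of order \<open>j / (steps j)^2\<close> and drops
    out.\<close>
  have clim: "c \<longlonglongrightarrow> (vr \<rho> + 1) * s2 * t\<^sup>2 * (32 * real K / T + 0 + 2 / real K)"
  proof -
    have eq: "c j = (vr \<rho> + 1) * s2 * t\<^sup>2 * (32 * real K / (real (steps j) * pr (2 * int j) (dt T j))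
        + 16 * (real (j + 1) / (real (steps j))\<^sup>2) + 2 / real K)" for j
    proof -
      have gen: "(t / m)\<^sup>2 * (v * (x + w + z)) = v * t\<^sup>2 * (x / m\<^sup>2 + w / m\<^sup>2 + z / m\<^sup>2)" for m v x w z :: real
        unfolding power_divide add_divide_distrib[symmetric] by simp
      have alg: "(t / m)\<^sup>2 * (v * (32 * m * k / p + w + 2 * m\<^sup>2 / k)) = v * t\<^sup>2 * (32 * k / (m * p) + w / m\<^sup>2 + 2 / k)"
        if "m \<noteq> 0" for m v k p w :: real
      proof -
        have "(t / m)\<^sup>2 * (v * (32 * m * k / p + w + 2 * m\<^sup>2 / k))
           = v * t\<^sup>2 * ((32 * m * k / p) / m\<^sup>2 + w / m\<^sup>2 + (2 * m\<^sup>2 / k) / m\<^sup>2)"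
          using gen by blast
        also have "(32 * m * k / p) / m\<^sup>2 = 32 * k / (m * p)" using that by (simp add: power2_eq_square)
        also have "(2 * m\<^sup>2 / k) / m\<^sup>2 = 2 / k" using that by simp
        finally show ?thesis .
      qed
      have w: "real_of_int (16 * (int j + 1)) = 16 * real (j + 1)" by simp
      have nz: "real (steps j) \<noteq> 0" using steps_pos[of j] by simp
      show ?thesis unfolding c_def B_def w alg[OF nz] by simp
    qed
    have "(\<lambda>j. real (j + 1) / (real (steps j))\<^sup>2) \<longlonglongrightarrow> 0"
    proof (rule tendsto_sandwich[OF _ _ tendsto_const LIMSEQ_Suc[OF lim_const_over_n[of 1]]])
      show "eventually (\<lambda>j. real (j + 1) / (real (steps j))\<^sup>2 \<le> 1 / of_nat (Suc j)) sequentially"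
      proof (intro always_eventually allI)
        fix j
        have q: "0 < real (j + 1)" by simp
        have "(real (j + 1))\<^sup>2 \<le> (real (steps j))\<^sup>2" using steps_ge[of j] by (intro power_mono) auto
        then have "real (j + 1) / (real (steps j))\<^sup>2 \<le> real (j + 1) / (real (j + 1))\<^sup>2"
          using steps_pos[of j] by (intro divide_left_mono) auto
        also have "\<dots> = 1 / of_nat (Suc j)" using q by (simp add: power2_eq_square)
        finally show "real (j + 1) / (real (steps j))\<^sup>2 \<le> 1 / of_nat (Suc j)" .
      qed
    qed auto
    then have "(\<lambda>j. (vr \<rho> + 1) * s2 * t\<^sup>2 * (32 * real K / (real (steps j) * pr (2 * int j) (dt T j))
        + 16 * (real (j + 1) / (real (steps j))\<^sup>2) + 2 / real K))
      \<longlonglongrightarrow> (vr \<rho> + 1) * s2 * t\<^sup>2 * (32 * real K / T + 16 * 0 + 2 / real K)"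
      using T by (intro tendsto_intros rate_tendsto(1)) auto
    then show ?thesis unfolding eq by simp
  qed
  \<comment> \<open>Almost everywhere the limit is a liminf of measurable functions, to which
    Fatou's lemma applies.\<close>
  have "(\<integral>\<^sup>+w. ennreal ((Y w)\<^sup>2) \<partial>M) = (\<integral>\<^sup>+w. liminf (\<lambda>j. ennreal ((t / real (steps j) * D j w)\<^sup>2)) \<partial>M)"
  proof (rule nn_integral_cong_AE)
    show "AE w in M. ennreal ((Y w)\<^sup>2) = liminf (\<lambda>j. ennreal ((t / real (steps j) * D j w)\<^sup>2))"
      using conv
    proof eventually_elim
      case (elim w)
      then have "(\<lambda>j. ennreal ((t / real (steps j) * D j w)\<^sup>2)) \<longlonglongrightarrow> ennreal ((Y w)\<^sup>2)"
        by (intro tendsto_ennrealI tendsto_power)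
      then show ?case by (intro lim_imp_Liminf[symmetric]) auto
    qed
  qed
  also have "\<dots> \<le> liminf (\<lambda>j. \<integral>\<^sup>+w. ennreal ((t / real (steps j) * D j w)\<^sup>2) \<partial>M)"
    by (rule nn_integral_liminf) measurable
  also have "\<dots> \<le> liminf (\<lambda>j. ennreal (c j))"
    by (rule Liminf_mono[OF Dbound])
  also have "\<dots> = ennreal ((vr \<rho> + 1) * s2 * t\<^sup>2 * (32 * real K / T + 0 + 2 / real K))"
    by (intro lim_imp_Liminf tendsto_ennrealI clim) auto
  finally show ?thesis unfolding Y_def T_def by simp
qed

end

section \<open>Sums of a sampled Schwartz function\<close>

lemma lorentzian_sum_le:
  fixes n :: real
  assumes "1 \<le> n"
  shows "(\<Sum>x\<in>{-int A..int A}. n\<^sup>2 / (n\<^sup>2 + (real_of_int x)\<^sup>2)) \<le> 1 + 4 * n - 4 * n\<^sup>2 / (n + real A)"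
proof (induction A)
  case 0
  then show ?case using assms by (simp add: power2_eq_square)
next
  case (Suc A)
  define q where "q x = n\<^sup>2 / (n\<^sup>2 + (real_of_int x)\<^sup>2)" for x
  define y where "y = n + real A"
  have y: "1 \<le> y" using assms by (simp add: y_def)
  have set: "{-int (Suc A)..int (Suc A)} = insert (int (Suc A)) (insert (- int (Suc A)) {-int A..int A})" by auto
  have "(\<Sum>x\<in>{-int (Suc A)..int (Suc A)}. q x) = q (int (Suc A)) + (q (- int (Suc A)) + (\<Sum>x\<in>{-int A..int A}. q x))"
    unfolding set by (subst sum.insert, simp, simp, subst sum.insert) auto
  also have "\<dots> = 2 * (n\<^sup>2 / (n\<^sup>2 + (real (Suc A))\<^sup>2)) + (\<Sum>x\<in>{-int A..int A}. q x)"
  proof -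
    have "q (- x) = q x" for x by (simp add: q_def)
    then show ?thesis by (simp only:) (simp add: q_def)
  qed
  \<comment> \<open>Twice the sum of squares dominates the square of the sum, and
    \<open>(y + 1)^2\<close> dominates \<open>y * (y + 1)\<close>, whose reciprocal telescopes. The
    term subtracted in the claim is the tail of this telescoping sum.\<close>
  also have "n\<^sup>2 / (n\<^sup>2 + (real (Suc A))\<^sup>2) \<le> 2 * (n\<^sup>2 / y - n\<^sup>2 / (y + 1))"
  proof -
    have sq: "(y + 1)\<^sup>2 \<le> 2 * (n\<^sup>2 + (real (Suc A))\<^sup>2)"
      using sum_squares_bound[of n "real (Suc A)"] unfolding y_def
      by (simp add: power2_eq_square algebra_simps)
    have "n\<^sup>2 / (n\<^sup>2 + (real (Suc A))\<^sup>2) = 2 * n\<^sup>2 / (2 * (n\<^sup>2 + (real (Suc A))\<^sup>2))"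
      by (rule mult_divide_mult_cancel_left[symmetric]) simp
    also have "\<dots> \<le> 2 * n\<^sup>2 / (y + 1)\<^sup>2" using y sq assms by (intro divide_left_mono) (auto intro!: mult_pos_pos add_pos_pos)
    also have "\<dots> \<le> 2 * n\<^sup>2 / (y * (y + 1))" using y by (intro divide_left_mono) (auto simp: power2_eq_square)
    also have "\<dots> = 2 * (n\<^sup>2 / y - n\<^sup>2 / (y + 1))" using y by (simp add: field_simps)
    finally show ?thesis .
  qed
  finally have "(\<Sum>x\<in>{-int (Suc A)..int (Suc A)}. q x) \<le> 4 * (n\<^sup>2 / y - n\<^sup>2 / (y + 1)) + (\<Sum>x\<in>{-int A..int A}. q x)" by simp
  also have "(\<Sum>x\<in>{-int A..int A}. q x) \<le> 1 + 4 * n - 4 * n\<^sup>2 / y" using Suc by (simp add: q_def y_def)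
  finally show ?case unfolding q_def y_def by (simp add: add.commute add.left_commute)
qed

lemma lorentzian_sum_le':
  fixes n :: real
  assumes "1 \<le> n"
  shows "(\<Sum>x\<in>{-int A..int A}. n\<^sup>2 / (n\<^sup>2 + (real_of_int x)\<^sup>2)) \<le> 5 * n"
proof -
  have "0 \<le> 4 * n\<^sup>2 / (n + real A)" using assms by (intro divide_nonneg_nonneg) auto
  then show ?thesis using lorentzian_sum_le[OF assms, of A] assms by linarith
qed

lemma schwartz_decay:
  assumes "schwartz H"
  obtains C where "0 \<le> C" "\<And>u. \<bar>H u\<bar> * (1 + u\<^sup>2) \<le> C"
proof -
  have "bounded (range (\<lambda>x. x ^ k * H x))" for k
    using assms unfolding schwartz_def by (metis funpow_0)
  from this[of 0] this[of 2] obtain B0 B2 where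
    B: "\<And>x. norm (x ^ 0 * H x) \<le> B0" "\<And>x. norm (x ^ 2 * H x) \<le> B2"
    unfolding bounded_iff by (metis rangeI)
  have B': "\<bar>H u\<bar> * (1 + u\<^sup>2) \<le> B0 + B2" for u
    using B(1)[of u] B(2)[of u] by (simp add: abs_mult algebra_simps)
  have "0 \<le> \<bar>H 0\<bar> * (1 + 0\<^sup>2)" by simp
  then have "0 \<le> B0 + B2" using B'[of 0] by linarith
  with B' that show ?thesis by blast
qed

text \<open>\<open>H\<close> lies below a Lorentzian, and sampling at spacing \<open>1 / n\<close>
  costs a factor of order \<open>n\<close>. The squares obey the same kind of bound because the
  Lorentzian is at most one.\<close>

lemma schwartz_sample_sums:
  assumes C: "0 \<le> C" "\<And>u. \<bar>H u\<bar> * (1 + u\<^sup>2) \<le> C" and n: "1 \<le> (n::real)"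
  shows "(\<Sum>x\<in>{-int A..int A}. \<bar>H (real_of_int x / n)\<bar>) \<le> C * (5 * n)"
    and "(\<Sum>x\<in>{-int A..int A}. (H (real_of_int x / n))\<^sup>2) \<le> C\<^sup>2 * (5 * n)"
proof -
  define q where "q x = n\<^sup>2 / (n\<^sup>2 + (real_of_int x)\<^sup>2)" for x
  have npos: "0 < n\<^sup>2" using n by simp
  have q: "0 \<le> q x" "q x \<le> 1" for x
    using npos by (auto simp: q_def divide_le_eq_1 add_pos_nonneg)
  have H: "\<bar>H (real_of_int x / n)\<bar> \<le> C * q x" for x
  proof -
    have "1 + (real_of_int x / n)\<^sup>2 = (n\<^sup>2 + (real_of_int x)\<^sup>2) / n\<^sup>2"
      using npos by (simp add: power_divide add_divide_distrib)
    then have "\<bar>H (real_of_int x / n)\<bar> * ((n\<^sup>2 + (real_of_int x)\<^sup>2) / n\<^sup>2) \<le> C" using C(2)[of "real_of_int x / n"] by simp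
    moreover have "0 < n\<^sup>2 + (real_of_int x)\<^sup>2" using npos by (simp add: add_pos_nonneg)
    ultimately show ?thesis using npos unfolding q_def by (simp add: field_simps)
  qed
  have s: "(\<Sum>x\<in>{-int A..int A}. q x) \<le> 5 * n" unfolding q_def by (rule lorentzian_sum_le'[OF n])
  have "(\<Sum>x\<in>{-int A..int A}. \<bar>H (real_of_int x / n)\<bar>) \<le> C * (\<Sum>x\<in>{-int A..int A}. q x)"
    unfolding sum_distrib_left by (intro sum_mono H)
  also have "\<dots> \<le> C * (5 * n)" using s C(1) by (rule mult_left_mono)
  finally show "(\<Sum>x\<in>{-int A..int A}. \<bar>H (real_of_int x / n)\<bar>) \<le> C * (5 * n)" .
  have "(H (real_of_int x / n))\<^sup>2 \<le> C\<^sup>2 * q x" for x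
  proof -
    have "\<bar>H (real_of_int x / n)\<bar>\<^sup>2 \<le> (C * q x)\<^sup>2" by (intro power_mono H) auto
    also have "\<dots> \<le> C\<^sup>2 * q x"
      unfolding power_mult_distrib using q[of x] by (intro mult_left_mono) (auto simp: power2_eq_square mult_left_le)
    finally show ?thesis by simp
  qed
  then have "(\<Sum>x\<in>{-int A..int A}. (H (real_of_int x / n))\<^sup>2) \<le> C\<^sup>2 * (\<Sum>x\<in>{-int A..int A}. q x)"
    unfolding sum_distrib_left by (intro sum_mono)
  also have "\<dots> \<le> C\<^sup>2 * (5 * n)" using s by (intro mult_left_mono) auto
  finally show "(\<Sum>x\<in>{-int A..int A}. (H (real_of_int x / n))\<^sup>2) \<le> C\<^sup>2 * (5 * n)" .
qed

theorem theorem2p4: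
  fixes M :: "'a measure"
    and \<eta> :: "'a \<Rightarrow> real \<Rightarrow> int \<Rightarrow> nat"
    and N :: "'a \<Rightarrow> int \<Rightarrow> real \<Rightarrow> nat"
    and \<rho> \<gamma> t :: real
    and H :: "real \<Rightarrow> real"
  assumes "tazrp M \<rho> \<eta> N"
    and "\<rho> > 0" and "0 < \<gamma>" and "\<gamma> < 1/3"
    and "t > 0"
    and "schwartz H"
  shows "(\<lambda>n::nat. \<integral>\<omega>. (LBINT s=0..t.
            real n powr \<gamma> / sqrt (real n) *
            (\<Sum>\<^sub>\<infinity>x::int. H (real_of_int x / real n) *
                 Vg \<rho> (\<eta> \<omega> (s * real n powr (1 + \<gamma>)) x))) ^ 2 \<partial>M)
         \<longlonglongrightarrow> 0"
proof -
  interpret tazrp_process M \<rho> \<eta> N using assms by unfold_locales auto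
  obtain C where C: "0 \<le> C" "\<And>u. \<bar>H u\<bar> * (1 + u\<^sup>2) \<le> C" using schwartz_decay[OF \<open>schwartz H\<close>] by blast
  define X where "X n \<omega> = (LBINT s=0..t. real n powr \<gamma> / sqrt (real n) *
      (\<Sum>\<^sub>\<infinity>x::int. H (real_of_int x / real n) * Vg \<rho> (\<eta> \<omega> (s * real n powr (1 + \<gamma>)) x)))" for n :: nat and \<omega>
  \<comment> \<open>\<open>64 / t + 2\<close> arises from \<open>r \<le> K \<le> 2 * r\<close>, and
    the 5 from the sample sums.\<close>
  define D where "D = (vr \<rho> + 1) * (5 * C\<^sup>2) * t\<^sup>2 * (64 / t + 2)"
  have bound: "(\<integral>\<omega>. (X n \<omega>)\<^sup>2 \<partial>M) \<le> D * real n powr ((3 * \<gamma> - 1) / 2)" if n1: "1 \<le> n" for n :: nat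
  proof -
    have n: "1 \<le> real n" using n1 by simp
    define \<kappa> where "\<kappa> = real n powr (1 + \<gamma>)"
    define r where "r = real n powr ((1 + \<gamma>) / 2)"
    define p where "p = real n powr \<gamma> / sqrt (real n)"
    \<comment> \<open>Balances the two terms of the bound: \<open>r\<close> is the square root of
      the time scale \<open>\<kappa>\<close>.\<close>
    define K where "K = nat \<lceil>r\<rceil>"
    have r1: "1 \<le> r" unfolding r_def using n \<open>0 < \<gamma>\<close> by (intro ge_one_powr_ge_zero) auto
    have \<kappa>r: "\<kappa> = r * r" unfolding \<kappa>_def r_def by (simp only: powr_add[symmetric] field_sum_of_halves)
    have \<kappa>: "0 < \<kappa>" unfolding \<kappa>r using r1 by simp
    have K: "r \<le> real K" "real K \<le> 2 * r" unfolding K_def using r1 by linarith+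
    have K1: "1 \<le> K" using K(1) r1 by linarith
    have XY: "X n \<omega> = p * (LBINT s=0..t. (\<Sum>\<^sub>\<infinity>x. H (real_of_int x / real n) * Vg \<rho> (\<eta> \<omega> (s * \<kappa>) x)))" for \<omega>
      unfolding X_def p_def \<kappa>_def by (rule interval_lebesgue_integral_mult_right)
    define c where "c = (vr \<rho> + 1) * (C\<^sup>2 * (5 * real n)) * t\<^sup>2 * (32 * real K / (\<kappa> * t) + 2 / real K)"
    have c_le: "p\<^sup>2 * c \<le> D * real n powr ((3 * \<gamma> - 1) / 2)"
    proof -
      have "32 * real K / (\<kappa> * t) + 2 / real K \<le> 32 * (2 * r) / (\<kappa> * t) + 2 / r"
        using K r1 \<kappa> \<open>t > 0\<close> by (intro add_mono divide_right_mono divide_left_mono) auto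
      also have "\<dots> = (64 / t + 2) / r" unfolding \<kappa>r using r1 \<open>t > 0\<close> by (simp add: field_simps)
      finally have "c \<le> (vr \<rho> + 1) * (C\<^sup>2 * (5 * real n)) * t\<^sup>2 * ((64 / t + 2) / r)"
        unfolding c_def using vr_nonneg by (intro mult_left_mono) auto
      then have "p\<^sup>2 * c \<le> p\<^sup>2 * ((vr \<rho> + 1) * (C\<^sup>2 * (5 * real n)) * t\<^sup>2 * ((64 / t + 2) / r))"
        by (intro mult_left_mono) auto
      also have "\<dots> = D * (p\<^sup>2 * real n / r)" by (simp add: D_def field_simps)
      \<comment> \<open>Exponents: \<open>2 * \<gamma> - 1\<close> from the squared prefactor, 1
        from the sample sum, \<open>- (1 + \<gamma>) / 2\<close> from \<open>1 / r\<close>.\<close>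
      also have "p\<^sup>2 * real n / r = real n powr ((3 * \<gamma> - 1) / 2)"
      proof -
        have "p\<^sup>2 = (real n powr \<gamma>)\<^sup>2 / real n" unfolding p_def using n by (simp add: power_divide)
        then have "p\<^sup>2 * real n / r = (real n powr \<gamma>)\<^sup>2 / r" using n by simp
        also have "(real n powr \<gamma>)\<^sup>2 = real n powr (2 * \<gamma>)"
          by (simp add: power2_eq_square powr_add[symmetric])
        also have "\<dots> / r = real n powr (2 * \<gamma> - (1 + \<gamma>) / 2)" unfolding r_def by (rule powr_diff[symmetric])
        also have "2 * \<gamma> - (1 + \<gamma>) / 2 = (3 * \<gamma> - 1) / 2" by (simp add: field_simps)
        finally show ?thesis .
      qed
      finally show ?thesis .
    qed
    show ?thesis
    proof (cases "integrable M (\<lambda>\<omega>. (X n \<omega>)\<^sup>2)")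
      case True
      let ?Y = "\<lambda>\<omega>. LBINT s=0..t. (\<Sum>\<^sub>\<infinity>x. H (real_of_int x / real n) * Vg \<rho> (\<eta> \<omega> (s * \<kappa>) x))"
      have p: "0 < p" unfolding p_def using n by simp
      have Y2: "(?Y \<omega>)\<^sup>2 = (X n \<omega>)\<^sup>2 / p\<^sup>2" for \<omega> unfolding XY using p by (simp add: power_mult_distrib)
      have iY: "integrable M (\<lambda>\<omega>. (?Y \<omega>)\<^sup>2)" unfolding Y2 using True by simp
      have "ennreal (\<integral>\<omega>. (?Y \<omega>)\<^sup>2 \<partial>M) = (\<integral>\<^sup>+\<omega>. ennreal ((?Y \<omega>)\<^sup>2) \<partial>M)"
        by (rule nn_integral_eq_integral[OF iY, symmetric]) simp
      also have "\<dots> \<le> ennreal c"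
        unfolding c_def
        by (rule boltzmann_gibbs_bound[OF \<open>t > 0\<close> \<kappa> K1 schwartz_sample_sums[OF C n]])
      finally have "(\<integral>\<omega>. (?Y \<omega>)\<^sup>2 \<partial>M) \<le> c"
        by (subst (asm) ennreal_le_iff) (use vr_nonneg \<kappa> \<open>t > 0\<close> in \<open>auto simp: c_def\<close>)
      then have "p\<^sup>2 * (\<integral>\<omega>. (?Y \<omega>)\<^sup>2 \<partial>M) \<le> p\<^sup>2 * c" by (intro mult_left_mono) auto
      moreover have "(\<integral>\<omega>. (X n \<omega>)\<^sup>2 \<partial>M) = p\<^sup>2 * (\<integral>\<omega>. (?Y \<omega>)\<^sup>2 \<partial>M)"
        unfolding XY power_mult_distrib by (rule integral_mult_right_zero)
      ultimately show ?thesis using c_le by linarith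
    next
      \<comment> \<open>By convention the Bochner integral of a non-integrable function is zero, so
        the bound is trivial here.\<close>
      case False
      then have "(\<integral>\<omega>. (X n \<omega>)\<^sup>2 \<partial>M) = 0" by (rule not_integrable_integral_eq)
      then show ?thesis using vr_nonneg \<open>t > 0\<close> by (simp add: D_def)
    qed
  qed
  have "(\<lambda>n. D * real n powr ((3 * \<gamma> - 1) / 2)) \<longlonglongrightarrow> D * 0"
    using \<open>\<gamma> < 1/3\<close> by (intro tendsto_mult tendsto_const tendsto_neg_powr filterlim_real_sequentially) auto
  then have lim: "(\<lambda>n. D * real n powr ((3 * \<gamma> - 1) / 2)) \<longlonglongrightarrow> 0" by simp
  have "(\<lambda>n. \<integral>\<omega>. (X n \<omega>)\<^sup>2 \<partial>M) \<longlonglongrightarrow> 0"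
  proof (rule tendsto_sandwich[OF _ _ tendsto_const lim])
    show "eventually (\<lambda>n. 0 \<le> (\<integral>\<omega>. (X n \<omega>)\<^sup>2 \<partial>M)) sequentially"
      by (intro always_eventually allI Bochner_Integration.integral_nonneg) auto
    show "eventually (\<lambda>n. (\<integral>\<omega>. (X n \<omega>)\<^sup>2 \<partial>M) \<le> D * real n powr ((3 * \<gamma> - 1) / 2)) sequentially"
      using eventually_ge_at_top[of 1] by eventually_elim (rule bound)
  qed
  then show ?thesis unfolding X_def .
qed

end
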